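(* Suppose that $\mu\ge 1/2$ and $(p,q)\in\mathcal F(\mu)$, that $\sigma$ is a $\mu q$-Riemannian section of $\mathcal E$, and that $|\sigma|^2\colon M\to\mathbb R$ is a harmonic function. Then $\sigma$ is a $(p,q)$-harmonic section of $\mathcal E$ if and only if $\sigma$ is parallel ($\nabla\sigma=0$).
   Context: Setting: $(M,g)$ is a smooth, oriented, connected Riemannian manifold without boundary (not necessarily compact), and $\pi\colon\mathcal E\to M$ is a smooth oriented real vector bundle with a fibre metric $\langle\,,\rangle$ and a connection $\nabla$ for which the fibre metric is holonomy-invariant, i.e. $\nabla\langle\,,\rangle=0$. All sections are smooth. For a section $\sigma$, put $F=\tfrac12|\sigma|^2\colon M\to\mathbb R$, let $\nabla F$ be its gradient, and $|\nabla\sigma|^2=\sum_i|\nabla_{E_i}\sigma|^2$ for a local orthonormal tangent frame $\{E_i\}$. For $p,q\in\mathbb R$ define a symmetric 2-tensor on the total space $\mathcal E$ by $h_{p,q}(A,B)=g(d\pi(A),d\pi(B))+(1+|e|^2)^{-p}\big(\langle KA,KB\rangle+q\langle KA,e\rangle\langle KB,e\rangle\big)$ for $A,B\in T_e\mathcal E$, where $K\colon T\mathcal E\to\mathcal E$ is the connection map of $\nabla$. The vertical $(p,q)$-energy of $\sigma$ (half the integral of the $h_{p,q}$-square norm of the vertical part of $d\sigma$) is $$E^v_{p,q}(\sigma)=\frac12\int_M\frac{1}{(1+|\sigma|^2)^p}\big(|\nabla\sigma|^2+q|\nabla F|^2\big)\,\mathrm{vol}(g)$$ if $M$ is compact; if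 $M$ is non-compact the integral is taken over relatively compact domains. $\sigma$ is a $(p,q)$-harmonic section of $\mathcal E$ if $\frac{d}{dt}\big|_{t=0}E^v_{p,q}(\sigma_t)=0$ for every smooth variation $\sigma_t$ of $\sigma_0=\sigma$ through sections of $\mathcal E$ (for non-compact $M$: every variation that equals $\sigma$ outside a compact set independent of $t$, the energy being taken over a relatively compact domain containing that set). For $r\in\mathbb R$, a section $\sigma$ is $r$-Riemannian if $r|\sigma(x)|^2\ge -1$ for all $x\in M$. For $\mu>0$ define the following regions of the $(p,q)$-plane: $\mathcal F_-(\mu)=\{(p,q):p<0,\ \mu q\le 2p\}$, $\mathcal F_0=\{(p,q):0\le p\le 1\}$, $\mathcal F_1(\mu)=\{(p,q):p>1,\ \mu q<1-p\}$, and $\mathcal F(\mu)=\mathcal F_-(\mu)\cup\mathcal F_0\cup\mathcal F_1(\mu)$. *)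

theory Defs
  imports "HOL-Analysis.Analysis"
begin

section \<open>Smooth maps between normed spaces\<close>

text \<open>
  Only used on open sets \<^term>\<open>S\<close> of finite-dimensional spaces, where requiring
  all iterated directional derivatives to exist as differentiable (resp. continuous) maps is
  the usual notion of \<open>C\<close>-\<open>k\<close> up to the intended \<open>k\<close>, and hence of smoothness.
\<close>

primrec ck_on ::
  "nat \<Rightarrow> 'a::real_normed_vector set \<Rightarrow> ('a \<Rightarrow> 'b::real_normed_vector) \<Rightarrow> bool" where
  "ck_on 0 S f \<longleftrightarrow> continuous_on S f"
| "ck_on (Suc k) S f \<longleftrightarrow>
     (\<forall>x\<in>S. f differentiable (at x)) \<and>
     (\<forall>v. ck_on k S (\<lambda>x. frechet_derivative f (at x) v))"

definition smooth_on ::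
  "'a::real_normed_vector set \<Rightarrow> ('a \<Rightarrow> 'b::real_normed_vector) \<Rightarrow> bool" where
  "smooth_on S f \<longleftrightarrow> (\<forall>k. ck_on k S f)"


section \<open>Smooth oriented manifolds\<close>

text \<open>
  The manifold is the whole type \<open>'m\<close>, a Hausdorff second countable space, with a smooth
  structure given by an atlas of charts \<open>(U, \<phi>)\<close>; it has no boundary, as the charts have open
  image in \<open>\<real>\<^sup>n\<close>. An orientation is recorded by the atlas being oriented.
\<close>

type_synonym ('m, 'n) chart = "'m set \<times> ('m \<Rightarrow> real ^ 'n)"

definition chart_inv :: "('m, 'n::finite) chart \<Rightarrow> real ^ 'n \<Rightarrow> 'm" where
  "chart_inv c = inv_into (fst c) (snd c)"

definition is_chart ::
  "('m::{t2_space, second_countable_topology}, 'n::finite) chart \<Rightarrow> bool" where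
  "is_chart c \<longleftrightarrow>
     open (fst c) \<and> open (snd c ` fst c) \<and>
     homeomorphism (fst c) (snd c ` fst c) (snd c) (chart_inv c)"

definition smooth_atlas ::
  "('m::{t2_space, second_countable_topology}, 'n::finite) chart set \<Rightarrow> bool" where
  "smooth_atlas A \<longleftrightarrow>
     (\<forall>c\<in>A. is_chart c) \<and> (\<Union>c\<in>A. fst c) = UNIV \<and>
     (\<forall>c\<in>A. \<forall>d\<in>A. smooth_on (snd c ` (fst c \<inter> fst d)) (snd d \<circ> chart_inv c))"

definition oriented_atlas :: "('m, 'n::finite) chart set \<Rightarrow> bool" where
  "oriented_atlas A \<longleftrightarrow>
     (\<forall>c\<in>A. \<forall>d\<in>A. \<forall>y\<in>snd c ` (fst c \<inter> fst d).
        det (matrix (frechet_derivative (snd d \<circ> chart_inv c) (at y))) > 0)"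

definition smooth_map_on ::
  "('m, 'n::finite) chart set \<Rightarrow> 'm set \<Rightarrow> ('m \<Rightarrow> 'b::real_normed_vector) \<Rightarrow> bool" where
  "smooth_map_on A U f \<longleftrightarrow> (\<forall>c\<in>A. smooth_on (snd c ` (fst c \<inter> U)) (f \<circ> chart_inv c))"


subsection \<open>Tangent vectors\<close>

text \<open>
  A tangent vector at \<open>x\<close> is the directional derivative operator it induces on real functions,
  extended by \<open>0\<close> to functions that are not differentiable at \<open>x\<close>. Thus \<open>v f\<close> is \<open>df(v)\<close>, and
  the linear operations of the tangent space are the pointwise ones.
\<close>

type_synonym 'm tvec = "('m \<Rightarrow> real) \<Rightarrow> real"

definition chart_vec :: "('m, 'n::finite) chart \<Rightarrow> 'm \<Rightarrow> real ^ 'n \<Rightarrow> 'm tvec" where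
  "chart_vec c x w = (\<lambda>f.
     if (f \<circ> chart_inv c) differentiable (at (snd c x))
     then frechet_derivative (f \<circ> chart_inv c) (at (snd c x)) w else 0)"

definition coord_vec :: "('m, 'n::finite) chart \<Rightarrow> 'n \<Rightarrow> 'm \<Rightarrow> 'm tvec" where
  "coord_vec c i x = chart_vec c x (axis i 1)"

definition tangent_space :: "('m, 'n::finite) chart set \<Rightarrow> 'm \<Rightarrow> 'm tvec set" where
  "tangent_space A x = {chart_vec c x w | c w. c \<in> A \<and> x \<in> fst c}"

definition tv_lincomb :: "real \<Rightarrow> 'm tvec \<Rightarrow> real \<Rightarrow> 'm tvec \<Rightarrow> 'm tvec" where
  "tv_lincomb a u b v = (\<lambda>f. a * u f + b * v f)"


subsection \<open>Riemannian metrics\<close>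

type_synonym 'm metric = "'m \<Rightarrow> 'm tvec \<Rightarrow> 'm tvec \<Rightarrow> real"

definition riemannian_metric ::
  "('m, 'n::finite) chart set \<Rightarrow> 'm metric \<Rightarrow> bool" where
  "riemannian_metric A g \<longleftrightarrow>
     (\<forall>x. \<forall>u\<in>tangent_space A x. \<forall>v\<in>tangent_space A x.
        g x u v = g x v u \<and>
        (\<forall>w\<in>tangent_space A x. \<forall>a b.
           g x (tv_lincomb a u b v) w = a * g x u w + b * g x v w) \<and>
        (u \<noteq> (\<lambda>f. 0) \<longrightarrow> g x u u > 0)) \<and>
     (\<forall>c\<in>A. \<forall>i j. smooth_map_on A (fst c) (\<lambda>x. g x (coord_vec c i x) (coord_vec c j x)))"

definition gram :: "'m metric \<Rightarrow> ('m, 'n::finite) chart \<Rightarrow> 'm \<Rightarrow> real ^ 'n ^ 'n" where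
  "gram g c x = (\<chi> i j. g x (coord_vec c i x) (coord_vec c j x))"

definition vol_density :: "'m metric \<Rightarrow> ('m, 'n::finite) chart \<Rightarrow> 'm \<Rightarrow> real" where
  "vol_density g c x = sqrt (det (gram g c x))"

text \<open>
  The measure of the Riemannian volume form: the unique Borel measure which in each chart has
  density \<open>sqrt (det g\<^sub>i\<^sub>j)\<close> with respect to Lebesgue measure.
\<close>

definition riemannian_volume ::
  "('m::{t2_space, second_countable_topology}, 'n::finite) chart set \<Rightarrow> 'm metric \<Rightarrow> 'm measure"
  where
  "riemannian_volume A g = (THE M. sets M = sets borel \<and>
     (\<forall>c\<in>A. \<forall>B\<in>sets borel. B \<subseteq> fst c \<longrightarrow>
        emeasure M B =
          (\<integral>\<^sup>+ y. ennreal (vol_density g c (chart_inv c y)) * indicator (snd c ` B) y \<partial>lborel)))"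

definition orthonormal_frame ::
  "('m, 'n::finite) chart set \<Rightarrow> 'm metric \<Rightarrow> 'm \<Rightarrow> ('n \<Rightarrow> 'm tvec) \<Rightarrow> bool" where
  "orthonormal_frame A g x e \<longleftrightarrow>
     (\<forall>i. e i \<in> tangent_space A x) \<and> (\<forall>i j. g x (e i) (e j) = (if i = j then 1 else 0))"

definition gradient ::
  "('m, 'n::finite) chart set \<Rightarrow> 'm metric \<Rightarrow> ('m \<Rightarrow> real) \<Rightarrow> 'm \<Rightarrow> 'm tvec" where
  "gradient A g f x =
     (THE v. v \<in> tangent_space A x \<and> (\<forall>w\<in>tangent_space A x. g x v w = w f))"

text \<open>
  The divergence of a vector field, computed in a chart \<open>c\<close> around the point (its value does not
  depend on \<open>c\<close>); the \<open>i\<close>-th component of \<open>X\<close> is \<open>X\<close> applied to the \<open>i\<close>-th coordinate function.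
\<close>

definition divergence ::
  "'m metric \<Rightarrow> ('m, 'n::finite) chart \<Rightarrow> ('m \<Rightarrow> 'm tvec) \<Rightarrow> 'm \<Rightarrow> real" where
  "divergence g c X x =
     (\<Sum>i\<in>UNIV. coord_vec c i x (\<lambda>y. vol_density g c y * X y (\<lambda>z. snd c z $ i)))
       / vol_density g c x"

definition harmonic_function ::
  "('m, 'n::finite) chart set \<Rightarrow> 'm metric \<Rightarrow> ('m \<Rightarrow> real) \<Rightarrow> bool" where
  "harmonic_function A g f \<longleftrightarrow>
     smooth_map_on A UNIV f \<and>
     (\<forall>c\<in>A. \<forall>x\<in>fst c. divergence g c (gradient A g f) x = 0)"


section \<open>Oriented vector bundles with metric and connection\<close>

text \<open>
  The fibre over \<open>x\<close> is a subspace \<open>E x\<close> of an ambient real vector space \<open>'f\<close> (with no topology).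
  This is no restriction, since \<open>'f\<close> may be the algebraic direct sum of all fibres. The total
  space is the disjoint union of the fibres, and its smooth structure is the one determined by the
  family \<open>T\<close> of local trivialisations \<open>(U, \<Phi>)\<close>, with \<open>\<Phi> x\<close> a linear isomorphism from \<open>E x\<close> to
  \<open>\<real>\<^sup>k\<close> for \<open>x \<in> U\<close>. An orientation is recorded by the transition functions having positive
  determinant.
\<close>

type_synonym ('m, 'f, 'k) triv = "'m set \<times> ('m \<Rightarrow> 'f \<Rightarrow> real ^ 'k)"

definition triv_inv ::
  "('m \<Rightarrow> 'f set) \<Rightarrow> ('m, 'f, 'k::finite) triv \<Rightarrow> 'm \<Rightarrow> real ^ 'k \<Rightarrow> 'f" where
  "triv_inv E t x = inv_into (E x) (snd t x)"

definition vector_bundle ::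
  "('m::topological_space, 'n::finite) chart set \<Rightarrow> ('m \<Rightarrow> 'f::real_vector set) \<Rightarrow>
     ('m, 'f, 'k::finite) triv set \<Rightarrow> bool" where
  "vector_bundle A E T \<longleftrightarrow>
     (\<forall>x. subspace (E x)) \<and> (\<Union>t\<in>T. fst t) = UNIV \<and>
     (\<forall>t\<in>T. open (fst t) \<and>
        (\<forall>x\<in>fst t. bij_betw (snd t x) (E x) UNIV \<and>
           (\<forall>u\<in>E x. \<forall>v\<in>E x. \<forall>a b.
              snd t x (a *\<^sub>R u + b *\<^sub>R v) = a *\<^sub>R snd t x u + b *\<^sub>R snd t x v))) \<and>
     (\<forall>s\<in>T. \<forall>t\<in>T. \<forall>w.
        smooth_map_on A (fst s \<inter> fst t) (\<lambda>x. snd t x (triv_inv E s x w)))"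

definition oriented_bundle ::
  "('m \<Rightarrow> 'f set) \<Rightarrow> ('m, 'f, 'k::finite) triv set \<Rightarrow> bool" where
  "oriented_bundle E T \<longleftrightarrow>
     (\<forall>s\<in>T. \<forall>t\<in>T. \<forall>x\<in>fst s \<inter> fst t. det (matrix (\<lambda>w. snd t x (triv_inv E s x w))) > 0)"

definition smooth_section_on ::
  "('m, 'n::finite) chart set \<Rightarrow> ('m \<Rightarrow> 'f set) \<Rightarrow> ('m, 'f, 'k::finite) triv set \<Rightarrow>
     'm set \<Rightarrow> ('m \<Rightarrow> 'f) \<Rightarrow> bool" where
  "smooth_section_on A E T U \<sigma> \<longleftrightarrow>
     (\<forall>x\<in>U. \<sigma> x \<in> E x) \<and> (\<forall>t\<in>T. smooth_map_on A (fst t \<inter> U) (\<lambda>x. snd t x (\<sigma> x)))"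

abbreviation smooth_section ::
  "('m, 'n::finite) chart set \<Rightarrow> ('m \<Rightarrow> 'f set) \<Rightarrow> ('m, 'f, 'k::finite) triv set \<Rightarrow>
     ('m \<Rightarrow> 'f) \<Rightarrow> bool" where
  "smooth_section A E T \<sigma> \<equiv> smooth_section_on A E T UNIV \<sigma>"

type_synonym ('m, 'f) fmetric = "'m \<Rightarrow> 'f \<Rightarrow> 'f \<Rightarrow> real"

definition fibre_metric ::
  "('m, 'n::finite) chart set \<Rightarrow> ('m \<Rightarrow> 'f::real_vector set) \<Rightarrow> ('m, 'f, 'k::finite) triv set \<Rightarrow>
     ('m, 'f) fmetric \<Rightarrow> bool" where
  "fibre_metric A E T h \<longleftrightarrow>
     (\<forall>x. \<forall>u\<in>E x. \<forall>v\<in>E x.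
        h x u v = h x v u \<and>
        (\<forall>w\<in>E x. \<forall>a b. h x (a *\<^sub>R u + b *\<^sub>R v) w = a * h x u w + b * h x v w) \<and>
        (u \<noteq> 0 \<longrightarrow> h x u u > 0)) \<and>
     (\<forall>t\<in>T. \<forall>a b. smooth_map_on A (fst t) (\<lambda>x. h x (triv_inv E t x a) (triv_inv E t x b)))"

text \<open>\<open>nabla \<sigma> x v\<close> is the covariant derivative of the section \<open>\<sigma>\<close> along \<open>v\<close>, tangent at \<open>x\<close>.\<close>

type_synonym ('m, 'f) cov_deriv = "('m \<Rightarrow> 'f) \<Rightarrow> 'm \<Rightarrow> 'm tvec \<Rightarrow> 'f"

text \<open>
  A connection is an additive map from smooth sections to smooth bundle-valued 1-forms satisfying
  the Leibniz rule.
\<close>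

definition connection ::
  "('m, 'n::finite) chart set \<Rightarrow> ('m \<Rightarrow> 'f::real_vector set) \<Rightarrow> ('m, 'f, 'k::finite) triv set \<Rightarrow>
     ('m, 'f) cov_deriv \<Rightarrow> bool" where
  "connection A E T nabla \<longleftrightarrow>
     (\<forall>\<sigma>. smooth_section A E T \<sigma> \<longrightarrow>
        (\<forall>x. \<forall>u\<in>tangent_space A x. nabla \<sigma> x u \<in> E x \<and>
           (\<forall>v\<in>tangent_space A x. \<forall>a b.
              nabla \<sigma> x (tv_lincomb a u b v) = a *\<^sub>R nabla \<sigma> x u + b *\<^sub>R nabla \<sigma> x v)) \<and>
        (\<forall>c\<in>A. \<forall>i. smooth_section_on A E T (fst c) (\<lambda>x. nabla \<sigma> x (coord_vec c i x)))) \<and>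
     (\<forall>\<sigma> \<tau>. smooth_section A E T \<sigma> \<and> smooth_section A E T \<tau> \<longrightarrow>
        (\<forall>x. \<forall>v\<in>tangent_space A x.
           nabla (\<lambda>y. \<sigma> y + \<tau> y) x v = nabla \<sigma> x v + nabla \<tau> x v)) \<and>
     (\<forall>\<sigma> f. smooth_section A E T \<sigma> \<and> smooth_map_on A UNIV f \<longrightarrow>
        (\<forall>x. \<forall>v\<in>tangent_space A x.
           nabla (\<lambda>y. f y *\<^sub>R \<sigma> y) x v = v f *\<^sub>R \<sigma> x + f x *\<^sub>R nabla \<sigma> x v))"

definition metric_connection ::
  "('m, 'n::finite) chart set \<Rightarrow> ('m \<Rightarrow> 'f set) \<Rightarrow> ('m, 'f, 'k::finite) triv set \<Rightarrow>
     ('m, 'f) fmetric \<Rightarrow> ('m, 'f) cov_deriv \<Rightarrow> bool" where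
  "metric_connection A E T h nabla \<longleftrightarrow>
     (\<forall>\<sigma> \<tau>. smooth_section A E T \<sigma> \<and> smooth_section A E T \<tau> \<longrightarrow>
        (\<forall>x. \<forall>v\<in>tangent_space A x.
           v (\<lambda>y. h y (\<sigma> y) (\<tau> y)) = h x (nabla \<sigma> x v) (\<tau> x) + h x (\<sigma> x) (nabla \<tau> x v)))"

definition parallel ::
  "('m, 'n::finite) chart set \<Rightarrow> ('m, 'f::zero) cov_deriv \<Rightarrow> ('m \<Rightarrow> 'f) \<Rightarrow> bool" where
  "parallel A nabla \<sigma> \<longleftrightarrow> (\<forall>x. \<forall>v\<in>tangent_space A x. nabla \<sigma> x v = 0)"

definition r_riemannian :: "('m, 'f) fmetric \<Rightarrow> real \<Rightarrow> ('m \<Rightarrow> 'f) \<Rightarrow> bool" where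
  "r_riemannian h r \<sigma> \<longleftrightarrow> (\<forall>x. r * h x (\<sigma> x) (\<sigma> x) \<ge> -1)"


section \<open>Vertical energy and (p,q)-harmonic sections\<close>

definition nabla_norm2 ::
  "('m, 'n::finite) chart set \<Rightarrow> 'm metric \<Rightarrow> ('m, 'f) fmetric \<Rightarrow> ('m, 'f) cov_deriv \<Rightarrow>
     ('m \<Rightarrow> 'f) \<Rightarrow> 'm \<Rightarrow> real" where
  "nabla_norm2 A g h nabla \<sigma> x =
     (let e = (SOME e. orthonormal_frame A g x e)
      in \<Sum>i\<in>UNIV. h x (nabla \<sigma> x (e i)) (nabla \<sigma> x (e i)))"

definition grad_norm2 ::
  "('m, 'n::finite) chart set \<Rightarrow> 'm metric \<Rightarrow> ('m \<Rightarrow> real) \<Rightarrow> 'm \<Rightarrow> real" where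
  "grad_norm2 A g f x = g x (gradient A g f x) (gradient A g f x)"

definition vertical_energy ::
  "('m::{t2_space, second_countable_topology}, 'n::finite) chart set \<Rightarrow> 'm metric \<Rightarrow>
     ('m, 'f) fmetric \<Rightarrow> ('m, 'f) cov_deriv \<Rightarrow> real \<Rightarrow> real \<Rightarrow> 'm set \<Rightarrow> ('m \<Rightarrow> 'f) \<Rightarrow> real" where
  "vertical_energy A g h nabla p q D \<sigma> =
     1 / 2 * (LINT x:D|riemannian_volume A g.
       1 / (1 + h x (\<sigma> x) (\<sigma> x)) powr p *
       (nabla_norm2 A g h nabla \<sigma> x
         + q * grad_norm2 A g (\<lambda>y. 1 / 2 * h y (\<sigma> y) (\<sigma> y)) x))"

text \<open>Smooth one-parameter families \<open>\<Sigma> t\<close>, \<open>\<bar>t\<bar> < \<epsilon>\<close>, of sections with \<open>\<Sigma> 0 = \<sigma>\<close>.\<close>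

definition smooth_variation ::
  "('m, 'n::finite) chart set \<Rightarrow> ('m \<Rightarrow> 'f set) \<Rightarrow> ('m, 'f, 'k::finite) triv set \<Rightarrow>
     ('m \<Rightarrow> 'f) \<Rightarrow> real \<Rightarrow> (real \<Rightarrow> 'm \<Rightarrow> 'f) \<Rightarrow> bool" where
  "smooth_variation A E T \<sigma> \<epsilon> \<Sigma> \<longleftrightarrow>
     \<epsilon> > 0 \<and> \<Sigma> 0 = \<sigma> \<and> (\<forall>t\<in>{-\<epsilon><..<\<epsilon>}. \<forall>x. \<Sigma> t x \<in> E x) \<and>
     (\<forall>s\<in>T. \<forall>c\<in>A.
        smooth_on ({-\<epsilon><..<\<epsilon>} \<times> snd c ` (fst c \<inter> fst s))
          (\<lambda>(t, y). snd s (chart_inv c y) (\<Sigma> t (chart_inv c y))))"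

definition relatively_compact_domain :: "'m::topological_space set \<Rightarrow> bool" where
  "relatively_compact_domain D \<longleftrightarrow> open D \<and> connected D \<and> compact (closure D)"

definition harmonic_section ::
  "('m::{t2_space, second_countable_topology}, 'n::finite) chart set \<Rightarrow> 'm metric \<Rightarrow>
     ('m \<Rightarrow> 'f set) \<Rightarrow> ('m, 'f, 'k::finite) triv set \<Rightarrow> ('m, 'f) fmetric \<Rightarrow>
     ('m, 'f) cov_deriv \<Rightarrow> real \<Rightarrow> real \<Rightarrow> ('m \<Rightarrow> 'f) \<Rightarrow> bool" where
  "harmonic_section A g E T h nabla p q \<sigma> \<longleftrightarrow>
     smooth_section A E T \<sigma> \<and>
     (if compact (UNIV :: 'm set)
      then \<forall>\<epsilon> \<Sigma>. smooth_variation A E T \<sigma> \<epsilon> \<Sigma> \<longrightarrow>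
             ((\<lambda>t. vertical_energy A g h nabla p q UNIV (\<Sigma> t)) has_real_derivative 0) (at 0)
      else \<forall>\<epsilon> \<Sigma> K D. smooth_variation A E T \<sigma> \<epsilon> \<Sigma> \<and>
             compact K \<and> (\<forall>t\<in>{-\<epsilon><..<\<epsilon>}. \<forall>x. x \<notin> K \<longrightarrow> \<Sigma> t x = \<sigma> x) \<and>
             relatively_compact_domain D \<and> K \<subseteq> D \<longrightarrow>
             ((\<lambda>t. vertical_energy A g h nabla p q D (\<Sigma> t)) has_real_derivative 0) (at 0))"


section \<open>Regions of the (p,q)-plane\<close>

definition region_minus :: "real \<Rightarrow> (real \<times> real) set" where
  "region_minus \<mu> = {(p, q). p < 0 \<and> \<mu> * q \<le> 2 * p}"

definition region_zero :: "(real \<times> real) set" where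
  "region_zero = {(p, q). 0 \<le> p \<and> p \<le> 1}"

definition region_one :: "real \<Rightarrow> (real \<times> real) set" where
  "region_one \<mu> = {(p, q). p > 1 \<and> \<mu> * q < 1 - p}"

definition region :: "real \<Rightarrow> (real \<times> real) set" where
  "region \<mu> = region_minus \<mu> \<union> region_zero \<union> region_one \<mu>"

end

theory Submission
  imports Defs
begin

text \<open>
  Write \<open>s = |\<sigma>|\<^sup>2\<close>, \<open>N = |\<nabla>\<sigma>|\<^sup>2\<close> and \<open>G = |\<nabla>F|\<^sup>2\<close>, so that \<open>G \<le> s N\<close> by Cauchy-Schwarz.

  If \<open>\<sigma>\<close> is parallel, then \<open>\<nabla>\<sigma>\<^sub>t\<close> vanishes at \<open>t = 0\<close>, so \<open>|\<nabla>\<sigma>\<^sub>t|\<^sup>2 = O(t\<^sup>2)\<close> uniformly on compact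
  sets; it is zero off the support of the variation. Hence the energy is \<open>O(t\<^sup>2)\<close> and its
  derivative at \<open>0\<close> vanishes.

  Conversely, take the variation \<open>(1 + t \<psi>) \<sigma>\<close> with a bump function \<open>\<psi>\<close> supported in a chart. The
  derivative of the energy contains \<open>\<integral> (1 + s)\<^sup>-\<^sup>p (1 + q s) \<langle>\<nabla>\<psi>, \<nabla>s\<rangle>\<close>, which harmonicity of \<open>s\<close> turns
  into an integral of \<open>\<psi>\<close> against a multiple of \<open>G\<close>. What remains is
  \<open>\<integral> \<psi> (1 + s)\<^sup>-\<^sup>p\<^sup>-\<^sup>1 Q = 0\<close> with \<open>Q = (1 + (1 - p) s) N + p (2 + q s) G\<close>. On the region
  \<open>\<F>(\<mu>)\<close>, the inequalities \<open>\<mu> q s \<ge> -1\<close> and \<open>0 \<le> G \<le> s N\<close> force \<open>Q \<ge> 0\<close>, and \<open>Q > 0\<close> wherever \<open>N > 0\<close>.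
\<close>

section \<open>Calculus of \<open>C\<^sup>k\<close> maps\<close>

text \<open>Testing only in the direction \<open>\<psi> \<sigma>\<close> keeps the first variation
  scalar: the density along \<open>(1 + t \<psi>) \<sigma>\<close> is an explicit function of five
  scalars and \<open>\<psi>\<close>, so the Euler-Lagrange equation with its second covariant
  derivatives never appears. The correction by harmonicity integrates the divergence of
  \<open>\<psi> B(s) \<nabla>s\<close> with \<open>B(s) = (1 + s) powr (- p) * (1 + q * s)\<close>;
  it is what turns the coefficient of \<open>G\<close> into \<open>p (2 + q s)\<close>. The way the
  objects are given shapes the rest. The volume is a definite description, so a measure must be
  glued from charts and shown unique before any integral can be evaluated. Orthonormal frames are
  chosen pointwise without continuity, so traces are rewritten with the inverse Gram matrix.
  \<open>nabla\<close> accepts global sections only, so its local formula is extracted with cut-off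
  functions. Finally, \<open>q\<close> may be negative, so a parallel section need not minimise the
  energy; a bound quadratic in \<open>t\<close> replaces a minimum argument.\<close>

lemma ck_on_cong:
  assumes "open S" and "\<And>x. x \<in> S \<Longrightarrow> f x = g x"
  shows "ck_on k S f \<longleftrightarrow> ck_on k S g"
proof -
  have "ck_on k S f \<Longrightarrow> (\<And>x. x \<in> S \<Longrightarrow> f x = g x) \<Longrightarrow> ck_on k S g" for f g :: "'a \<Rightarrow> 'b"
  proof (induction k arbitrary: f g)
    case 0 then show ?case using continuous_on_cong by fastforce
  next
    case (Suc k)
    have *: "(g has_derivative frechet_derivative f (at x)) (at x)" if "x \<in> S" for x
      using Suc.prems that
      by (auto simp: frechet_derivative_works intro: has_derivative_transform_within_open[OF _ assms(1), of f])
    then have "frechet_derivative g (at x) = frechet_derivative f (at x)" if "x \<in> S" for x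
      using that frechet_derivative_at by metis
    then have "ck_on k S (\<lambda>x. frechet_derivative g (at x) v)" for v
      using Suc.prems by (auto intro: Suc.IH[of "\<lambda>x. frechet_derivative f (at x) v"])
    then show ?case using * by (auto simp: differentiable_def)
  qed
  from this[of f g] this[of g f] assms(2) show ?thesis by auto
qed

lemma ck_on_subset: "ck_on k S f \<Longrightarrow> T \<subseteq> S \<Longrightarrow> ck_on k T f"
  by (induction k arbitrary: f) (auto intro: continuous_on_subset)

lemma ck_on_Suc_imp: "ck_on (Suc k) S f \<Longrightarrow> ck_on k S f"
proof (induction k arbitrary: f)
  case 0 then show ?case
    by (auto intro!: continuous_at_imp_continuous_on differentiable_imp_continuous_within)
next
  case (Suc k) then show ?case by (metis ck_on.simps(2))
qed

lemma ck_on_imp_continuous: "ck_on k S f \<Longrightarrow> continuous_on S f"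
  by (induction k) (auto dest: ck_on_Suc_imp simp del: ck_on.simps(2))

lemma ck_on_Un: 
  assumes "open S" "open T" "ck_on k S f" "ck_on k T f"
  shows "ck_on k (S \<union> T) f"
  using assms(3,4) by (induction k arbitrary: f) (use assms continuous_on_open_Un in auto)

lemma ck_on_const [simp]: "ck_on k S (\<lambda>x. c)"
  by (induction k arbitrary: c) (auto simp: frechet_derivative_const)

lemma ck_on_SucI:
  assumes S: "open S" and D: "\<And>x. x \<in> S \<Longrightarrow> (f has_derivative f' x) (at x)"
    and k: "\<And>v. ck_on k S (\<lambda>x. f' x v)"
  shows "ck_on (Suc k) S f"
proof -
  have "ck_on k S (\<lambda>x. frechet_derivative f (at x) v)" for v
    by (subst ck_on_cong[OF S, where g="\<lambda>x. f' x v"])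
      (use D k frechet_derivative_at in \<open>fastforce+\<close>)
  with D show ?thesis by (auto simp: differentiable_def)
qed

lemma ck_on_SucD:
  assumes "ck_on (Suc k) S f" "x \<in> S"
  shows "(f has_derivative frechet_derivative f (at x)) (at x)"
  using assms by (simp add: frechet_derivative_works)

lemma ck_on_bounded_linear:
  assumes "bounded_linear L" "open S" "ck_on k S f"
  shows "ck_on k S (\<lambda>x. L (f x))"
  using assms(3)
proof (induction k arbitrary: f)
  case 0 then show ?case using bounded_linear.continuous_on[OF assms(1)] by auto
next
  case (Suc k)
  show ?case
  proof (rule ck_on_SucI[OF assms(2)])
    show "((\<lambda>x. L (f x)) has_derivative (\<lambda>v. L (frechet_derivative f (at x) v))) (at x)" 
      if "x \<in> S" for x
      using bounded_linear.has_derivative[OF assms(1) ck_on_SucD[OF Suc.prems that]] .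
  qed (use Suc in auto)
qed

lemma ck_on_add:
  assumes "open S" "ck_on k S f" "ck_on k S g"
  shows "ck_on k S (\<lambda>x. f x + g x)"
  using assms(2,3)
proof (induction k arbitrary: f g)
  case 0 then show ?case by (auto intro: continuous_intros)
next
  case (Suc k)
  show ?case
    by (rule ck_on_SucI[OF assms(1) has_derivative_add[OF ck_on_SucD ck_on_SucD]])
      (use Suc in auto)
qed

lemma ck_on_sum:
  assumes "open S" "\<And>i. i \<in> I \<Longrightarrow> ck_on k S (f i)"
  shows "ck_on k S (\<lambda>x. \<Sum>i\<in>I. f i x)"
  using assms(2)
  by (induction I rule: infinite_finite_induct) (auto intro: ck_on_add[OF assms(1)])

lemma ck_on_bilinear:
  assumes B: "bounded_bilinear B" and "open S" "ck_on k S f" "ck_on k S g"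
  shows "ck_on k S (\<lambda>x. B (f x) (g x))"
  using assms(3,4)
proof (induction k arbitrary: f g)
  case 0 then show ?case using bounded_bilinear.continuous_on[OF B] by auto
next
  case (Suc k)
  have *: "ck_on k S f" "ck_on k S g" using Suc.prems by (auto intro: ck_on_Suc_imp simp del: ck_on.simps)
  show ?case
    by (rule ck_on_SucI[OF assms(2) bounded_bilinear.FDERIV[OF B ck_on_SucD ck_on_SucD]])
      (use Suc * in \<open>auto intro!: ck_on_add[OF assms(2)]\<close>)
qed

lemmas ck_on_mult = ck_on_bilinear[OF bounded_bilinear_mult]
lemmas ck_on_scaleR = ck_on_bilinear[OF bounded_bilinear_scaleR]

lemma ck_on_minus: "open S \<Longrightarrow> ck_on k S f \<Longrightarrow> ck_on k S (\<lambda>x. - f x)"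
  by (rule ck_on_bounded_linear) (auto intro: bounded_linear_minus bounded_linear_ident)

lemma ck_on_diff: "open S \<Longrightarrow> ck_on k S f \<Longrightarrow> ck_on k S g \<Longrightarrow> ck_on k S (\<lambda>x. f x - g x)"
  using ck_on_add[of S k f "\<lambda>x. - g x"] ck_on_minus[of S k g] by simp

lemma ck_on_prod:
  fixes f :: "'i \<Rightarrow> 'a::real_normed_vector \<Rightarrow> real"
  assumes "open S" "\<And>i. i \<in> I \<Longrightarrow> ck_on k S (f i)"
  shows "ck_on k S (\<lambda>x. \<Prod>i\<in>I. f i x)"
  using assms(2)
  by (induction I rule: infinite_finite_induct) (auto intro: ck_on_mult[OF assms(1)])

lemma ck_on_linear: "bounded_linear L \<Longrightarrow> ck_on k S L"
proof (cases k)
  case (Suc n)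
  assume L: "bounded_linear L"
  have "frechet_derivative L (at x) = L" for x
    by (metis L bounded_linear_imp_has_derivative frechet_derivative_at)
  then show ?thesis using L Suc by (auto simp: bounded_linear_imp_differentiable)
qed (auto simp: linear_continuous_on)

text \<open>The chain rule differentiates \<open>f\<close> in the moving direction
  \<open>frechet_derivative r (at x) v\<close>, whereas \<open>ck_on\<close> speaks of fixed
  directions. Expanding that direction in \<open>Basis\<close> leaves only fixed ones, to which the
  induction hypothesis applies; hence the Euclidean space in the middle.\<close>

lemma ck_on_compose:
  fixes f :: "'b::euclidean_space \<Rightarrow> 'c::real_normed_vector" and r :: "'a::real_normed_vector \<Rightarrow> 'b"
  assumes "open S" "ck_on k S r" "ck_on k T f" "r ` S \<subseteq> T"
  shows "ck_on k S (\<lambda>x. f (r x))"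
  using assms(2,3)
proof (induction k arbitrary: f)
  case 0 then show ?case using assms(4) by (auto intro: continuous_on_compose2)
next
  case (Suc k)
  have *: "ck_on k S r" using Suc.prems by (auto intro: ck_on_Suc_imp simp del: ck_on.simps)
  show ?case
  proof (rule ck_on_SucI[OF assms(1)])
    fix x assume x: "x \<in> S"
    let ?r = "frechet_derivative r (at x)" and ?f = "frechet_derivative f (at (r x))"
    have f: "(f has_derivative ?f) (at (r x))" and r: "(r has_derivative ?r) (at x)"
      using ck_on_SucD Suc.prems x assms(4) by blast+
    have "?f (?r v) = (\<Sum>b\<in>Basis. (?r v \<bullet> b) *\<^sub>R ?f b)" for v
    proof -
      have "?f (\<Sum>b\<in>Basis. (?r v \<bullet> b) *\<^sub>R b) = (\<Sum>b\<in>Basis. (?r v \<bullet> b) *\<^sub>R ?f b)"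
        using has_derivative_linear[OF f] by (simp add: linear_sum linear_scale)
      then show ?thesis by (simp add: euclidean_representation)
    qed
    then show "((\<lambda>x. f (r x)) has_derivative (\<lambda>v. \<Sum>b\<in>Basis. (?r v \<bullet> b) *\<^sub>R ?f b)) (at x)"
      using has_derivative_compose[OF r f] by simp
  next
    have "ck_on k S (\<lambda>x. frechet_derivative f (at (r x)) b)" for b
      by (rule Suc.IH) (use Suc.prems * in auto)
    then show "ck_on k S (\<lambda>x. \<Sum>b\<in>Basis. (frechet_derivative r (at x) v \<bullet> b) *\<^sub>R frechet_derivative f (at (r x)) b)" for v
      using Suc.prems(1)
      by (intro ck_on_sum ck_on_scaleR assms(1) ck_on_bounded_linear[OF bounded_linear_inner_left]) auto
  qed
qed

lemma ck_on_nth: "open S \<Longrightarrow> ck_on k S f \<Longrightarrow> ck_on k S (\<lambda>x. f x $ i)"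
  by (rule ck_on_bounded_linear[OF bounded_linear_vec_nth])

lemma ck_on_det:
  fixes f :: "'a::real_normed_vector \<Rightarrow> real ^ 'k::finite ^ 'k"
  assumes "open S" "\<And>i j. ck_on k S (\<lambda>x. f x $ i $ j)"
  shows "ck_on k S (\<lambda>x. det (f x))"
  unfolding det_def by (intro ck_on_sum ck_on_mult ck_on_prod assms) auto

text \<open>Stopping at order 1 makes continuity of \<open>\<phi>'\<close> enough, so square roots,
  reciprocals and real powers require no iterated derivatives. One derivative is all that the later
  integration by parts asks of its coefficients.\<close>

lemma ck_on_1_real_compose:
  fixes f :: "'a::real_normed_vector \<Rightarrow> real" and \<phi> \<phi>' :: "real \<Rightarrow> real"
  assumes S: "open S" and f: "ck_on 1 S f"
    and d: "\<And>x. x \<in> S \<Longrightarrow> (\<phi> has_real_derivative \<phi>' (f x)) (at (f x))"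
    and c: "continuous_on (f ` S) \<phi>'"
  shows "ck_on 1 S (\<lambda>x. \<phi> (f x))"
proof -
  have "ck_on (Suc 0) S (\<lambda>x. \<phi> (f x))"
  proof (rule ck_on_SucI[OF S])
    fix x assume x: "x \<in> S"
    have "(f has_derivative frechet_derivative f (at x)) (at x)"
      using f x by (auto simp: frechet_derivative_works)
    from DERIV_compose_FDERIV[OF d[OF x] this]
    show "((\<lambda>x. \<phi> (f x)) has_derivative (\<lambda>v. frechet_derivative f (at x) v * \<phi>' (f x))) (at x)" .
  next
    have "continuous_on S f" using f ck_on_imp_continuous by blast
    then have "continuous_on S (\<lambda>x. \<phi>' (f x))"
      using c by (auto intro: continuous_on_compose2)
    then show "ck_on 0 S (\<lambda>x. frechet_derivative f (at x) v * \<phi>' (f x))" for v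
      using f by (auto intro!: continuous_intros)
  qed
  then show ?thesis by simp
qed

lemma smooth_onD: "smooth_on S f \<Longrightarrow> ck_on k S f"
  by (simp add: smooth_on_def)

section \<open>A smooth bump function\<close>

text \<open>A class that contains the classical flat function exp(-1/t) and is closed under
  differentiation, so that smoothness becomes one induction over the order with \<open>P\<close>
  arbitrary.\<close>

definition flat_poly :: "real poly \<Rightarrow> real \<Rightarrow> real" where
  "flat_poly P t = (if t > 0 then poly P (1 / t) * exp (- (1 / t)) else 0)"

lemma poly_exp_tendsto_0: "((\<lambda>u::real. poly P u * exp (- u)) \<longlongrightarrow> 0) at_top"
proof -
  have "((\<lambda>u::real. \<Sum>i\<le>degree P. coeff P i * (u ^ i / exp u)) \<longlongrightarrow> (\<Sum>i\<le>degree P. coeff P i * 0)) at_top"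
    by (intro tendsto_intros tendsto_power_div_exp_0)
  then show ?thesis by (simp add: poly_altdef exp_minus field_simps sum_distrib_left sum_divide_distrib)
qed

text \<open>For positive t, differentiating P(1/t) exp(-1/t) gives (P - P')(1/t) exp(-1/t) divided
  by t^2, and the factor 1/t^2 is the polynomial \<open>[:0, 0, 1:]\<close> evaluated at
  1/t.\<close>

lemma flat_poly_has_derivative:
  "(flat_poly P has_real_derivative flat_poly ([:0, 0, 1:] * (P - pderiv P)) t) (at t)"
proof -
  consider "t > 0" | "t < 0" | "t = 0" by linarith
  then show ?thesis
  proof cases
    case 1
    have "((\<lambda>t. poly P (1 / t) * exp (- (1 / t))) has_real_derivative
       flat_poly ([:0, 0, 1:] * (P - pderiv P)) t) (at t)"
      using 1 unfolding flat_poly_def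
      by (auto intro!: derivative_eq_intros DERIV_chain2[OF poly_DERIV] simp: field_simps power2_eq_square)
    then show ?thesis
      by (rule has_field_derivative_transform_within_open[where S="{0<..}"])
        (use 1 in \<open>auto simp: flat_poly_def\<close>)
  next
    case 2
    have "((\<lambda>t. 0) has_real_derivative flat_poly ([:0, 0, 1:] * (P - pderiv P)) t) (at t)"
      using 2 by (simp add: flat_poly_def)
    then show ?thesis
      by (rule has_field_derivative_transform_within_open[where S="{..<0}"])
        (use 2 in \<open>auto simp: flat_poly_def\<close>)
  next
    case 3
    \<comment> \<open>At the origin the difference quotient is (1/y) P(1/y) exp(-1/y);
      \<open>pCons 0 P\<close> absorbs the factor 1/y, and u = 1/y moves the limit to
      infinity.\<close>
    have "((\<lambda>u::real. poly (pCons 0 P) u * exp (- u)) \<longlongrightarrow> 0) at_top"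
      by (rule poly_exp_tendsto_0)
    then have "((\<lambda>y::real. poly (pCons 0 P) (inverse y) * exp (- inverse y)) \<longlongrightarrow> 0) (at_right 0)"
      by (simp add: filterlim_at_right_to_top)
    then have r: "((\<lambda>y. flat_poly P y / y) \<longlongrightarrow> 0) (at_right 0)"
      by (rule Lim_transform_eventually)
        (auto simp: eventually_at_filter flat_poly_def field_simps)
    have l: "((\<lambda>y. flat_poly P y / y) \<longlongrightarrow> 0) (at_left 0)"
      by (rule Lim_transform_eventually[where f="\<lambda>_. 0"])
        (auto simp: eventually_at_filter flat_poly_def)
    from l r have "((\<lambda>y. flat_poly P y / y) \<longlongrightarrow> 0) (at 0)"
      using filterlim_at_split by blast
    then show ?thesis using 3 by (simp add: has_field_derivative_iff flat_poly_def)
  qed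
qed

lemma ck_on_flat_poly: "ck_on k UNIV (flat_poly P)"
proof (induction k arbitrary: P)
  case 0 then show ?case
    using DERIV_continuous[OF flat_poly_has_derivative] by (auto intro!: continuous_at_imp_continuous_on)
next
  case (Suc k)
  show ?case
    by (rule ck_on_SucI[OF open_UNIV flat_poly_has_derivative[unfolded has_field_derivative_def]])
      (intro ck_on_mult Suc; simp)
qed

definition bump :: "'a::real_inner \<Rightarrow> real \<Rightarrow> 'a \<Rightarrow> real" where
  "bump a r y = flat_poly 1 (r\<^sup>2 - (y - a) \<bullet> (y - a))"

lemma smooth_on_bump: "open S \<Longrightarrow> smooth_on S (bump (a::'a::real_inner) r)"
  unfolding smooth_on_def bump_def
proof (intro allI ck_on_compose[OF _ _ ck_on_flat_poly])
  fix k assume S: "open S"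
  have *: "ck_on k S (\<lambda>y. y - a)"
    by (intro ck_on_diff S ck_on_const ck_on_linear bounded_linear_ident)
  show "ck_on k S (\<lambda>y. r\<^sup>2 - (y - a) \<bullet> (y - a))"
    by (intro ck_on_diff ck_on_const S ck_on_bilinear[OF bounded_bilinear_inner] *)
qed auto

lemma bump_pos_iff:
  assumes "r > 0" shows "bump a r y > 0 \<longleftrightarrow> dist a y < r" and "bump a r y \<noteq> 0 \<longleftrightarrow> dist a y < r"
proof -
  have "r\<^sup>2 - (y - a) \<bullet> (y - a) > 0 \<longleftrightarrow> dist a y < r"
    using assms power_strict_mono[of "norm (y - a)" r 2] power2_less_imp_less[of "norm (y - a)" r]
    by (auto simp: dist_norm norm_minus_commute[of a] power2_norm_eq_inner)
  then show "bump a r y > 0 \<longleftrightarrow> dist a y < r" "bump a r y \<noteq> 0 \<longleftrightarrow> dist a y < r" by (auto simp: bump_def flat_poly_def)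
qed

lemma bump_nonneg: "bump a r y \<ge> 0"
  by (auto simp: bump_def flat_poly_def)

section \<open>Orthonormal bases and integration on \<open>\<real>\<^sup>n\<close>\<close>

text \<open>Gram-Schmidt for the inner product \<open>u \<bullet> (G *v v)\<close>, adding one index
  at a time: fewer than \<open>CARD('n)\<close> vectors do not span, so a vector outside their span
  is available. Its component orthogonal to the earlier vectors is nonzero and can be
  normalised.\<close>

lemma gram_orthonormal_basis_exists:
  fixes G :: "real^'n^'n"
  assumes sym: "transpose G = G" and pos: "\<And>v. v \<noteq> 0 \<Longrightarrow> v \<bullet> (G *v v) > 0"
  shows "\<exists>b::'n \<Rightarrow> real^'n. \<forall>i j. b i \<bullet> (G *v b j) = (if i = j then 1 else 0)"
proof -
  have sym': "u \<bullet> (G *v v) = v \<bullet> (G *v u)" for u v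
    using dot_lmul_matrix[of u G v] sym by (metis inner_commute transpose_matrix_vector)
  have "\<exists>b::'n \<Rightarrow> real^'n. \<forall>i\<in>I. \<forall>j\<in>I. b i \<bullet> (G *v b j) = (if i = j then 1 else 0)" for I :: "'n set"
  proof (induction I rule: infinite_finite_induct)
    case (insert k I)
    then obtain b :: "'n \<Rightarrow> real^'n"
      where b: "\<And>i j. i \<in> I \<Longrightarrow> j \<in> I \<Longrightarrow> b i \<bullet> (G *v b j) = (if i = j then 1 else 0)" by blast
    have "dim (b ` I) \<le> card I"
      by (meson card_image_le dim_le_card' finite_imageI insert.hyps(1) le_trans)
    also have "\<dots> < CARD('n)"
      using insert.hyps by (metis UNIV_I finite psubset_card_mono top.not_eq_extremum)
    finally have "span (b ` I) \<noteq> UNIV"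
      by (metis dim_UNIV dim_span DIM_cart DIM_real mult.right_neutral nat_less_le)
    then obtain x where x: "x \<notin> span (b ` I)" by blast
    define y where "y = x - (\<Sum>i\<in>I. (b i \<bullet> (G *v x)) *\<^sub>R b i)"
    have "(\<Sum>i\<in>I. (b i \<bullet> (G *v x)) *\<^sub>R b i) \<in> span (b ` I)"
      by (intro span_sum span_scale span_base) auto
    then have "y \<noteq> 0" using x unfolding y_def by auto
    then have yp: "y \<bullet> (G *v y) > 0" by (rule pos)
    have orth: "b j \<bullet> (G *v y) = 0" if "j \<in> I" for j
    proof -
      have "b j \<bullet> (G *v y) = b j \<bullet> (G *v x) - (\<Sum>i\<in>I. (b i \<bullet> (G *v x)) * (b j \<bullet> (G *v b i)))"
        by (simp add: y_def matrix_vector_mult_diff_distrib inner_diff_right matrix_vector_mult_scaleR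
            vec.sum inner_sum_right linear_sum[OF matrix_vector_mul_linear])
      also have "\<dots> = 0" using that insert.hyps(1) b by (simp add: if_distrib[of "(*) _"] cong: sum.cong if_cong)
      finally show ?thesis .
    qed
    define z where "z = (1 / sqrt (y \<bullet> (G *v y))) *\<^sub>R y"
    have "z \<bullet> (G *v z) = 1"
      using yp by (simp add: z_def matrix_vector_mult_scaleR)
    moreover have "b j \<bullet> (G *v z) = 0" "z \<bullet> (G *v b j) = 0" if "j \<in> I" for j
      using orth[OF that] sym'[of y "b j"] by (simp_all add: z_def matrix_vector_mult_scaleR)
    ultimately have "\<forall>i\<in>insert k I. \<forall>j\<in>insert k I. (b(k := z)) i \<bullet> (G *v (b(k := z)) j) = (if i = j then 1 else 0)"
      using b insert.hyps by auto
    then show ?case by blast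
  qed auto
  from this[of UNIV] show ?thesis by simp
qed

lemma matrix_inv_mult:
  fixes G :: "real^'n^'n"
  assumes "invertible G"
  shows "G ** matrix_inv G = mat 1" "matrix_inv G ** G = mat 1"
  using someI_ex[OF assms[unfolded invertible_def]] by (simp_all add: matrix_inv_def)

text \<open>With the basis as columns of \<open>B\<close>, orthonormality reads B^T G B = 1. A
  one-sided inverse of a square matrix is two-sided, so B B^T is the inverse of \<open>G\<close>;
  its entries are the sums on the left. This is why sums over a frame do not depend on the
  frame.\<close>

lemma gram_orthonormal_basis_inverse:
  fixes G :: "real^'n^'n" and b :: "'n \<Rightarrow> real^'n"
  assumes "\<And>i j. b i \<bullet> (G *v b j) = (if i = j then 1 else 0)"
  shows "(\<Sum>k\<in>UNIV. b k $ i * b k $ j) = matrix_inv G $ i $ j" and "invertible G"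
proof -
  define B where "B = (\<chi> i j. b j $ i)"
  have "(transpose B ** (G ** B)) $ i $ j = b i \<bullet> (G *v b j)" for i j
    by (simp add: matrix_matrix_mult_def transpose_def B_def inner_vec_def matrix_vector_mult_def)
  then have "transpose B ** (G ** B) = mat 1"
    using assms by (simp add: vec_eq_iff mat_def)
  then have 1: "(G ** B) ** transpose B = mat 1" using matrix_left_right_inverse by blast
  then have 2: "G ** (B ** transpose B) = mat 1" by (simp add: matrix_mul_assoc)
  then have 3: "(B ** transpose B) ** G = mat 1" using matrix_left_right_inverse by blast
  from 2 3 show inv: "invertible G" unfolding invertible_def by blast
  have "matrix_inv G = B ** transpose B"
    using 2 matrix_inv_mult(2)[of G] inv by (metis matrix_mul_assoc matrix_mul_lid matrix_mul_rid)
  then show "(\<Sum>k\<in>UNIV. b k $ i * b k $ j) = matrix_inv G $ i $ j"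
    by (simp add: matrix_matrix_mult_def transpose_def B_def)
qed

text \<open>Cramer's rule for the j-th column of the inverse. It exhibits the entries as quotients
  of polynomials in the entries of \<open>G\<close>, from which differentiability can be read
  off.\<close>

lemma matrix_inv_nth:
  fixes G :: "real^'n^'n"
  assumes "invertible G"
  shows "matrix_inv G $ i $ j = det (\<chi> k l. if l = i then (if k = j then 1 else 0) else G $ k $ l) / det G"
proof -
  have "G *v column j (matrix_inv G) = axis j 1"
    using assms by (metis matrix_inv_mult(1) matrix_vector_mul_assoc matrix_vector_mul_lid matrix_vector_mult_basis)
  moreover have "det G \<noteq> 0" using assms invertible_det_nz by blast
  ultimately have "column j (matrix_inv G) = (\<chi> k. det (\<chi> m l. if l = k then axis j 1 $ m else G $ m $ l) / det G)"
    using cramer by blast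
  then have "column j (matrix_inv G) $ i = det (\<chi> m l. if l = i then axis j 1 $ m else G $ m $ l) / det G"
    by simp
  then show ?thesis by (simp add: column_def axis_def if_distrib cong: if_cong)
qed

section \<open>Integration by parts for compactly supported functions\<close>

lemma integral_UNIV_eq_superset:
  fixes f :: "'a::euclidean_space \<Rightarrow> real"
  assumes "\<And>x. x \<notin> S \<Longrightarrow> f x = 0"
  shows "integral S f = integral UNIV f"
proof -
  have "integral UNIV (\<lambda>x. if x \<in> S then f x else 0) = integral S f" by (rule integral_restrict_UNIV)
  moreover have "(\<lambda>x. if x \<in> S then f x else 0) = f" using assms by auto
  ultimately show ?thesis by simp
qed

text \<open>The integrals of the translates of \<open>Y\<close> along \<open>v\<close> do not depend on the translation.\<close>

lemma integral_directional_derivative_eq_0: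
  fixes Y :: "'a::euclidean_space \<Rightarrow> real"
  assumes Y: "\<And>y. Y differentiable (at y)"
    and cont: "continuous_on UNIV (\<lambda>y. frechet_derivative Y (at y) v)"
    and K: "compact K" and supp: "\<And>y. y \<notin> K \<Longrightarrow> Y y = 0" and KS: "K \<subseteq> S"
  shows "integral S (\<lambda>y. frechet_derivative Y (at y) v) = 0"
proof -
  let ?D = "\<lambda>y. frechet_derivative Y (at y) v"
  obtain R where R: "K \<subseteq> cball 0 R" 
    using compact_imp_bounded[OF K] unfolding bounded_iff by (meson mem_cball_0 subsetI)
  \<comment> \<open>The box contains all translates of \<open>K\<close> by multiples
    \<open>t *\<^sub>R v\<close> with \<open>t\<close> between -1 and 1, so for these
    \<open>t\<close> the integral over one fixed compact box is the full integral.\<close>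
  obtain a where a: "cball 0 (R + norm v) \<subseteq> cbox (-a) (a::'a)"
    by (rule bounded_subset_cbox_symmetric[OF bounded_cball])
  have in_box: "y - t *\<^sub>R v \<in> cbox (-a) a" if "y \<in> K" "\<bar>t\<bar> \<le> 1" for y t
  proof -
    have "norm (y - t *\<^sub>R v) \<le> norm y + norm (t *\<^sub>R v)" by (rule norm_triangle_ineq4)
    moreover have "norm (t *\<^sub>R v) \<le> norm v" using that by (simp add: mult_left_le_one_le)
    moreover have "norm y \<le> R" using that R by auto
    ultimately show ?thesis using a by force
  qed
  have D0: "?D y = 0" if "y \<notin> K" for y
  proof -
    have "((\<lambda>_. 0) has_derivative (\<lambda>_. 0)) (at y)" by simp
    then have "(Y has_derivative (\<lambda>_. 0)) (at y)"
      by (rule has_derivative_transform_within_open[where s="- K"])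
        (use that supp compact_imp_closed[OF K] in auto)
    then show ?thesis by (metis frechet_derivative_at)
  qed
  have const: "integral (cbox (-a) a) (\<lambda>y. Y (y + t *\<^sub>R v)) = integral UNIV Y" if "t \<in> {-1<..<1}" for t
  proof -
    have "integral (cbox (-a) a) (Y \<circ> (+) (t *\<^sub>R v)) = integral (cbox (- a + t *\<^sub>R v) (a + t *\<^sub>R v)) Y"
      by (rule integral_shift_cbox_plus)
    also have "\<dots> = integral UNIV Y"
    proof (rule integral_UNIV_eq_superset)
      fix y assume y: "y \<notin> cbox (- a + t *\<^sub>R v) (a + t *\<^sub>R v)"
      have "y \<notin> K"
      proof
        assume "y \<in> K"
        then have "y - t *\<^sub>R v \<in> cbox (-a) a" using in_box that by auto
        then show False using y by (auto simp: mem_box inner_simps algebra_simps)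
      qed
      then show "Y y = 0" by (rule supp)
    qed
    finally show ?thesis by (simp add: o_def add.commute)
  qed
  have der: "((\<lambda>t. Y (y + t *\<^sub>R v)) has_real_derivative ?D (y + t *\<^sub>R v)) (at t within {-1<..<1})" for y t
  proof -
    have Y': "(Y has_derivative frechet_derivative Y (at (y + t *\<^sub>R v))) (at (y + t *\<^sub>R v))"
      using Y frechet_derivative_works by blast
    have "((\<lambda>t. y + t *\<^sub>R v) has_derivative (\<lambda>s. s *\<^sub>R v)) (at t within {-1<..<1})"
      by (auto intro!: derivative_eq_intros)
    from has_derivative_compose[OF this Y']
    have "((\<lambda>t. Y (y + t *\<^sub>R v)) has_derivative (\<lambda>s. frechet_derivative Y (at (y + t *\<^sub>R v)) (s *\<^sub>R v))) (at t within {-1<..<1})" .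
    then show ?thesis
      using has_derivative_linear[OF Y'] by (simp add: has_field_derivative_def linear_scale mult_commute_abs)
  qed
  have Yc: "continuous_on UNIV Y"
    using Y differentiable_imp_continuous_within continuous_at_imp_continuous_on by blast
  have "((\<lambda>t. integral (cbox (-a) a) (\<lambda>y. Y (y + t *\<^sub>R v))) has_field_derivative
      integral (cbox (-a) a) (\<lambda>y. ?D (y + 0 *\<^sub>R v))) (at 0 within {-1<..<1})"
  proof (rule leibniz_rule_field_derivative[where fx="\<lambda>t y. ?D (y + t *\<^sub>R v)"])
    show "(\<lambda>y. Y (y + t *\<^sub>R v)) integrable_on cbox (-a) a" for t
      by (intro integrable_continuous continuous_on_compose2[OF Yc]) (auto intro!: continuous_intros)
    show "continuous_on ({-1<..<1} \<times> cbox (-a) a) (\<lambda>(t, y). ?D (y + t *\<^sub>R v))"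
      unfolding split_beta
      by (intro continuous_on_compose2[OF cont]) (auto intro!: continuous_intros)
  qed (use der in auto)
  moreover have "((\<lambda>t. integral (cbox (-a) a) (\<lambda>y. Y (y + t *\<^sub>R v))) has_field_derivative 0) (at 0 within {-1<..<1})"
    by (rule has_field_derivative_transform_within[where f="\<lambda>_. integral UNIV Y" and d=1]) (use const in auto)
  ultimately have "integral (cbox (-a) a) ?D = 0"
    by (simp add: at_within_open[of _ "{-1<..<1::real}"] DERIV_unique)
  moreover have "integral (cbox (-a) a) ?D = integral UNIV ?D"
    by (rule integral_UNIV_eq_superset) (use in_box[of _ 0] D0 in fastforce)
  moreover have "integral S ?D = integral UNIV ?D"
    by (rule integral_UNIV_eq_superset) (use KS D0 in blast)
  ultimately show ?thesis by simp
qed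

section \<open>Change of variables for an arbitrary finite index type\<close>

text \<open>The change of variables theorem of the library requires a well-ordered index type.\<close>

typedef ('n::finite) ordered_index = "{..<CARD('n)}"
  by (auto intro!: exI[of _ 0])

instantiation ordered_index :: (finite) linorder
begin
definition "a \<le> b \<longleftrightarrow> Rep_ordered_index a \<le> Rep_ordered_index b"
definition "a < b \<longleftrightarrow> Rep_ordered_index a < Rep_ordered_index b"
instance
  by standard (auto simp: less_eq_ordered_index_def less_ordered_index_def Rep_ordered_index_inject)
end

instance ordered_index :: (finite) "{finite, wellorder}"
proof
  have "(UNIV :: 'a ordered_index set) = Abs_ordered_index ` {..<CARD('a)}"
    using type_definition.Abs_image[OF type_definition_ordered_index] by metis
  then show "finite (UNIV :: 'a ordered_index set)" by (metis finite_imageI finite_lessThan)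
  fix P :: "'a ordered_index \<Rightarrow> bool" and a
  assume step: "\<And>x. (\<And>y. y < x \<Longrightarrow> P y) \<Longrightarrow> P x"
  show "P a"
  proof (induction "Rep_ordered_index a" arbitrary: a rule: less_induct)
    case less
    then show ?case by (rule step) (simp add: less_ordered_index_def)
  qed
qed

lemma ordered_index_bij: "\<exists>f::'n::finite ordered_index \<Rightarrow> 'n. bij f"
proof -
  have "card (UNIV :: 'n ordered_index set) = card (UNIV :: 'n set)"
    using type_definition.card[OF type_definition_ordered_index] by auto
  then show ?thesis using finite_same_card_bij[of "UNIV :: 'n ordered_index set" "UNIV :: 'n set"] by simp
qed

text \<open>Relabelling rows and columns by the same bijection conjugates the permutations in the
  Leibniz formula, and conjugation preserves signs.\<close>

lemma det_reindex:
  fixes A :: "real^'b^'b" and f :: "'a::finite \<Rightarrow> 'b::finite"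
  assumes f: "bij f"
  shows "det (\<chi> i j. A $ f i $ f j) = det A"
proof -
  have inj: "inj f" using f bij_is_inj by auto
  let ?m = "map_permutation UNIV f"
  have bij: "bij_betw ?m {p. p permutes UNIV} {p. p permutes UNIV}"
  proof (rule bij_betw_byWitness[where f'="map_permutation UNIV (inv f)"])
    show "\<forall>p\<in>{p. p permutes UNIV}. map_permutation UNIV (inv f) (?m p) = p"
      using f by (auto intro!: map_permutation_compose_inv simp: bij_is_inj)
    show "\<forall>p\<in>{p. p permutes UNIV}. ?m (map_permutation UNIV (inv f) p) = p"
      using f by (auto intro!: map_permutation_compose_inv bij_imp_bij_inv simp: bij_is_surj surj_f_inv_f)
    show "?m ` {p. p permutes UNIV} \<subseteq> {p. p permutes UNIV}"
      using f map_permutation_permutes by blast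
    show "map_permutation UNIV (inv f) ` {p. p permutes UNIV} \<subseteq> {p. p permutes UNIV}"
      using f bij_imp_bij_inv map_permutation_permutes by blast
  qed
  have "det A = (\<Sum>p\<in>{p. p permutes UNIV}. of_int (sign (?m p)) * (\<Prod>i\<in>UNIV. A $ i $ ?m p i))"
    unfolding det_def by (rule sum.reindex_bij_betw[OF bij, symmetric])
  also have "\<dots> = (\<Sum>p\<in>{p. p permutes UNIV}. of_int (sign p) * (\<Prod>i\<in>UNIV. A $ f i $ f (p i)))"
  proof (rule sum.cong[OF refl])
    fix p :: "'a \<Rightarrow> 'a" assume p: "p \<in> {p. p permutes UNIV}"
    have "(\<Prod>i\<in>UNIV. A $ i $ ?m p i) = (\<Prod>i\<in>UNIV. A $ f i $ ?m p (f i))"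
      by (rule prod.reindex_bij_betw[OF f, symmetric])
    then show "of_int (sign (?m p)) * (\<Prod>i\<in>UNIV. A $ i $ ?m p i) = of_int (sign p) * (\<Prod>i\<in>UNIV. A $ f i $ f (p i))"
      using sign_map_permutation[of f UNIV p] p inj map_permutation_apply[OF inj] by simp
  qed
  finally show ?thesis by (simp add: det_def)
qed

definition reindex_vec :: "('a::finite \<Rightarrow> 'b::finite) \<Rightarrow> real^'b \<Rightarrow> real^'a" where
  "reindex_vec f v = (\<chi> i. v $ f i)"

lemma bounded_linear_reindex_vec: "bounded_linear (reindex_vec f)"
  by (intro linear_conv_bounded_linear[THEN iffD1] linearI) (auto simp: reindex_vec_def vec_eq_iff)

lemma reindex_vec_inv:
  assumes "bij f"
  shows "reindex_vec (inv f) (reindex_vec f v) = v" "reindex_vec f (reindex_vec (inv f) w) = w"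
  using assms by (auto simp: reindex_vec_def vec_eq_iff bij_is_surj surj_f_inv_f bij_is_inj)

text \<open>A box pulls back to the box with permuted sides, which has the same product of side
  lengths, and Lebesgue measure is determined by boxes.\<close>

lemma distr_reindex_vec:
  fixes f :: "'a::finite \<Rightarrow> 'b::finite"
  assumes f: "bij f"
  shows "distr lborel borel (reindex_vec f) = lborel"
proof (rule sym, rule lborel_eqI)
  have [measurable]: "reindex_vec f \<in> borel_measurable borel"
    using bounded_linear_reindex_vec by (intro borel_measurable_continuous_onI linear_continuous_on)
  fix l u :: "real^'a" assume le: "\<And>b. b \<in> Basis \<Longrightarrow> l \<bullet> b \<le> u \<bullet> b"
  have eq: "reindex_vec f -` box l u = box (reindex_vec (inv f) l) (reindex_vec (inv f) u)"
  proof -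
    have "(\<forall>i. l $ i < v $ f i \<and> v $ f i < u $ i) \<longleftrightarrow> (\<forall>k. l $ inv f k < v $ k \<and> v $ k < u $ inv f k)" for v :: "real^'b"
      using f by (metis bij_inv_eq_iff)
    then show ?thesis by (auto simp: mem_box_cart reindex_vec_def)
  qed
  have le': "l $ i \<le> u $ i" for i using le[of "axis i 1"] by (auto simp: inner_axis axis_in_Basis_iff)
  have prod_cart: "(\<Prod>b\<in>Basis. (w - v) \<bullet> b) = (\<Prod>i\<in>UNIV. (w - v) $ i)" for v w :: "real^'c"
    by (subst prod.reindex_bij_betw[where h="\<lambda>i. axis i 1" and S=UNIV, symmetric])
      (auto simp: Basis_vec_def bij_betw_def inj_on_def axis_eq_axis inner_axis)
  have "emeasure lborel (box (reindex_vec (inv f) l) (reindex_vec (inv f) u)) =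
     (\<Prod>b\<in>Basis. (reindex_vec (inv f) u - reindex_vec (inv f) l) \<bullet> b)"
    using le' by (subst emeasure_lborel_box) (auto simp: Basis_vec_def inner_axis reindex_vec_def)
  also have "\<dots> = ennreal (\<Prod>i\<in>UNIV. (u - l) $ inv f i)" unfolding prod_cart by (simp add: reindex_vec_def)
  also have "(\<Prod>i\<in>UNIV. (u - l) $ inv f i) = (\<Prod>i\<in>UNIV. (u - l) $ i)"
    using bij_imp_bij_inv[OF f] by (rule prod.reindex_bij_betw)
  finally show "emeasure (distr lborel borel (reindex_vec f)) (box l u) = ennreal (\<Prod>b\<in>Basis. (u - l) \<bullet> b)"
    by (simp add: emeasure_distr eq prod_cart)
qed simp

section \<open>Substitution in nonnegative, possibly infinite integrals\<close>

lemma nn_integral_change_of_variables_wellorder: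
  fixes f :: "real^'n::{finite,wellorder} \<Rightarrow> real" and \<tau> :: "real^'n::_ \<Rightarrow> real^'n::_"
  assumes S: "S \<in> sets borel"
    and der: "\<And>x. x \<in> S \<Longrightarrow> (\<tau> has_derivative \<tau>' x) (at x within S)" and inj: "inj_on \<tau> S"
    and nonneg: "\<And>x. f x \<ge> 0" and supp: "\<And>y. y \<notin> \<tau> ` S \<Longrightarrow> f y = 0"
    and f: "f \<in> borel_measurable borel"
    and F: "(\<lambda>x. indicat_real S x * (\<bar>det (matrix (\<tau>' x))\<bar> * f (\<tau> x))) \<in> borel_measurable borel"
  shows "(\<integral>\<^sup>+x. ennreal (indicat_real S x * (\<bar>det (matrix (\<tau>' x))\<bar> * f (\<tau> x))) \<partial>lborel) = (\<integral>\<^sup>+y. ennreal (f y) \<partial>lborel)"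
proof -
  let ?F = "\<lambda>x. indicat_real S x * (\<bar>det (matrix (\<tau>' x))\<bar> * f (\<tau> x))"
  \<comment> \<open>The substitution theorem concerns absolutely integrable functions with vector
    values, hence the detour through \<open>real^1\<close>. For nonnegative functions absolute
    integrability is integrability, so the theorem becomes an equivalence of
    \<open>has_integral\<close> relations, which also transfers divergence.\<close>
  have iff: "(?F has_integral r) UNIV \<longleftrightarrow> (f has_integral r) UNIV" for r
  proof -
    have v: "vec x = (vec y :: real^1) \<longleftrightarrow> x = y" for x y :: real by (simp add: vec_eq_iff)
    have "(?F has_integral r) UNIV \<longleftrightarrow> ((\<lambda>x. \<bar>det (matrix (\<tau>' x))\<bar> *\<^sub>R f (\<tau> x)) has_integral r) S"
      by (subst (2) has_integral_restrict_UNIV[symmetric]) (rule arg_cong[where f="\<lambda>h. (h has_integral r) UNIV"], auto)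
    also have "\<dots> \<longleftrightarrow> (\<lambda>x. \<bar>det (matrix (\<tau>' x))\<bar> *\<^sub>R f (\<tau> x)) absolutely_integrable_on S \<and> 
        integral S (\<lambda>x. \<bar>det (matrix (\<tau>' x))\<bar> *\<^sub>R f (\<tau> x)) = r"
      using nonneg by (subst absolutely_integrable_on_iff_nonneg) (auto simp: has_integral_iff)
    also have "\<dots> \<longleftrightarrow> f absolutely_integrable_on (\<tau> ` S) \<and> integral (\<tau> ` S) f = r"
      using has_absolute_integral_change_of_variables[OF _ der inj, of "\<lambda>x. vec (f x) :: real^1" "vec r"] S
      unfolding absolutely_integrable_on_1_iff integral_on_1_eq v by simp
    also have "\<dots> \<longleftrightarrow> (f has_integral r) (\<tau> ` S)"
      using nonneg by (subst absolutely_integrable_on_iff_nonneg) (auto simp: has_integral_iff)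
    also have "\<dots> \<longleftrightarrow> (f has_integral r) UNIV"
      by (subst has_integral_restrict_UNIV[symmetric]) (rule arg_cong[where f="\<lambda>h. (h has_integral r) UNIV"], use supp in auto)
    finally show ?thesis .
  qed
  \<comment> \<open>The nonnegative integral depends only on the relation
    \<open>has_integral\<close>, with value infinity if no \<open>r\<close> satisfies it. Equal
    relations therefore give equal integrals.\<close>
  have *: "(\<integral>\<^sup>+x. ennreal (h x) \<partial>lborel) = (if \<exists>r. (h has_integral r) UNIV then ennreal (THE r. (h has_integral r) UNIV) else \<infinity>)"
    if h: "h \<in> borel_measurable borel" "\<And>x. h x \<ge> 0" for h :: "real^'n::_ \<Rightarrow> real"
  proof (cases "\<exists>r. (h has_integral r) UNIV")
    case True
    then obtain r where r: "(h has_integral r) UNIV" by blast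
    then have "(THE r. (h has_integral r) UNIV) = r" using has_integral_unique by blast
    then show ?thesis using nn_integral_has_integral_lborel[OF h r] True by simp
  next
    case False
    then have "\<not> (\<integral>\<^sup>+x. ennreal (h x) \<partial>lborel) < \<infinity>"
      using nn_integral_integrable_on[OF h] by (auto simp: integrable_on_def)
    then show ?thesis using False by (simp add: not_less top.extremum_unique)
  qed
  show ?thesis using *[OF F] *[OF f] nonneg iff by (simp add: indicator_def)
qed

text \<open>Conjugating \<open>\<tau>\<close> with the coordinate permutations \<open>R\<close> and
  \<open>Q\<close> moves the problem to the well-ordered index type. This changes neither Lebesgue
  measure nor the Jacobian determinant, since rows and columns are relabelled alike.\<close>

lemma nn_integral_change_of_variables:
  fixes f :: "real^'n::finite \<Rightarrow> real" and \<tau> :: "real^'n \<Rightarrow> real^'n"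
  assumes S: "S \<in> sets borel"
    and der: "\<And>x. x \<in> S \<Longrightarrow> (\<tau> has_derivative \<tau>' x) (at x within S)" and inj: "inj_on \<tau> S"
    and nonneg: "\<And>x. f x \<ge> 0" and supp: "\<And>y. y \<notin> \<tau> ` S \<Longrightarrow> f y = 0"
    and f: "f \<in> borel_measurable borel"
    and F: "(\<lambda>x. indicat_real S x * (\<bar>det (matrix (\<tau>' x))\<bar> * f (\<tau> x))) \<in> borel_measurable borel"
  shows "(\<integral>\<^sup>+x. ennreal (indicat_real S x * (\<bar>det (matrix (\<tau>' x))\<bar> * f (\<tau> x))) \<partial>lborel) = (\<integral>\<^sup>+y. ennreal (f y) \<partial>lborel)"
proof -
  obtain k :: "'n ordered_index \<Rightarrow> 'n" where k: "bij k" using ordered_index_bij by blast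
  define R where "R = reindex_vec k"
  define Q where "Q = reindex_vec (inv k)"
  have QR [simp]: "Q (R v) = v" "R (Q w) = w" for v w
    using reindex_vec_inv[OF k] by (auto simp: R_def Q_def)
  have bl: "bounded_linear R" "bounded_linear Q" by (auto simp: R_def Q_def bounded_linear_reindex_vec)
  have [measurable]: "R \<in> borel_measurable borel" "Q \<in> borel_measurable borel"
    using bl by (auto intro!: borel_measurable_continuous_onI linear_continuous_on)
  note f[measurable]
  have dQ: "distr lborel borel Q = lborel"
    unfolding Q_def by (rule distr_reindex_vec[OF bij_imp_bij_inv[OF k]])
  have nn: "(\<integral>\<^sup>+y. ennreal (h y) \<partial>lborel) = (\<integral>\<^sup>+w. ennreal (h (Q w)) \<partial>lborel)"
    if [measurable]: "h \<in> borel_measurable borel" for h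
    by (subst dQ[symmetric]) (simp add: nn_integral_distr)
  let ?S = "Q -` S" and ?\<tau> = "\<lambda>w. R (\<tau> (Q w))" and ?\<tau>' = "\<lambda>w u. R (\<tau>' (Q w) (Q u))"
  have det: "det (matrix (?\<tau>' w)) = det (matrix (\<tau>' (Q w)))" for w
  proof -
    have "matrix (?\<tau>' w) $ i $ j = matrix (\<tau>' (Q w)) $ k i $ k j" for i j
    proof -
      have "inv k l = j \<longleftrightarrow> l = k j" for l using k by (metis bij_inv_eq_iff)
      then have "Q (axis j 1) = axis (k j) 1"
        by (auto simp: Q_def reindex_vec_def vec_eq_iff axis_def)
      then show ?thesis by (simp add: matrix_def R_def reindex_vec_def)
    qed
    then have "matrix (?\<tau>' w) = (\<chi> i j. matrix (\<tau>' (Q w)) $ k i $ k j)" by (simp add: vec_eq_iff)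
    then show ?thesis using det_reindex[OF k] by simp
  qed
  have ind: "indicat_real S (Q w) = indicat_real ?S w" for w by (simp add: indicator_def)
  have "(\<integral>\<^sup>+x. ennreal (indicat_real S x * (\<bar>det (matrix (\<tau>' x))\<bar> * f (\<tau> x))) \<partial>lborel)
      = (\<integral>\<^sup>+w. ennreal (indicat_real ?S w * (\<bar>det (matrix (?\<tau>' w))\<bar> * f (Q (?\<tau> w)))) \<partial>lborel)"
    by (subst nn[OF F]) (simp add: det ind)
  also have "\<dots> = (\<integral>\<^sup>+w. ennreal (f (Q w)) \<partial>lborel)"
  proof (rule nn_integral_change_of_variables_wellorder)
    show "?S \<in> sets borel" using measurable_sets[OF \<open>Q \<in> borel_measurable borel\<close> S] by simp
    show "(?\<tau> has_derivative ?\<tau>' w) (at w within ?S)" if "w \<in> ?S" for w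
    proof -
      have "(\<tau> has_derivative \<tau>' (Q w)) (at (Q w) within Q ` ?S)"
        using der[of "Q w"] that by (auto intro: has_derivative_subset)
      from has_derivative_in_compose[OF bounded_linear_imp_has_derivative[OF bl(2)] this]
      show ?thesis using bounded_linear.has_derivative[OF bl(1)] by fastforce
    qed
    show "inj_on ?\<tau> ?S" 
    proof (rule inj_onI)
      fix v w assume "v \<in> ?S" "w \<in> ?S" "?\<tau> v = ?\<tau> w"
      then have "Q v = Q w" using inj QR(1) by (metis inj_onD vimageE)
      then show "v = w" using QR(2) by metis
    qed
    show "f (Q w) = 0" if "w \<notin> ?\<tau> ` ?S" for w
    proof (rule supp)
      show "Q w \<notin> \<tau> ` S"
      proof
        assume "Q w \<in> \<tau> ` S"
        then obtain x where "x \<in> S" "Q w = \<tau> x" by blast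
        then have "w = ?\<tau> (R x)" using QR by metis
        moreover have "R x \<in> ?S" using \<open>x \<in> S\<close> by simp
        ultimately show False using that by blast
      qed
    qed
    have "(\<lambda>w. indicat_real S (Q w) * (\<bar>det (matrix (\<tau>' (Q w)))\<bar> * f (\<tau> (Q w)))) \<in> borel_measurable borel"
      using measurable_compose[OF _ F] by measurable
    then show "(\<lambda>w. indicat_real ?S w * (\<bar>det (matrix (?\<tau>' w))\<bar> * f (Q (?\<tau> w)))) \<in> borel_measurable borel"
      by (simp add: det ind)
  qed (use nonneg in auto)
  also have "\<dots> = (\<integral>\<^sup>+y. ennreal (f y) \<partial>lborel)"
    by (rule nn[OF f, symmetric])
  finally show ?thesis .
qed

section \<open>Smooth maps on a manifold\<close>

lemma smooth_map_on_subset: "smooth_map_on A U f \<Longrightarrow> V \<subseteq> U \<Longrightarrow> smooth_map_on A V f"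
  unfolding smooth_map_on_def smooth_on_def by (meson Int_mono ck_on_subset image_mono order_refl)

definition tv_bilinear :: "('m, 'n::finite) chart set \<Rightarrow> 'm \<Rightarrow> ('m tvec \<Rightarrow> 'm tvec \<Rightarrow> real) \<Rightarrow> bool" where
  "tv_bilinear A x Q \<longleftrightarrow> (\<forall>u\<in>tangent_space A x. \<forall>v\<in>tangent_space A x. \<forall>w\<in>tangent_space A x. \<forall>a b.
     Q (tv_lincomb a u b v) w = a * Q u w + b * Q v w \<and>
     Q w (tv_lincomb a u b v) = a * Q w u + b * Q w v)"

locale atlas =
  fixes A :: "('m::{t2_space, second_countable_topology}, 'n::finite) chart set"
  assumes atlas: "smooth_atlas A"
begin

lemma chart_open: "c \<in> A \<Longrightarrow> open (fst c)" and chart_image_open: "c \<in> A \<Longrightarrow> open (snd c ` fst c)"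
  and chart_homeo: "c \<in> A \<Longrightarrow> homeomorphism (fst c) (snd c ` fst c) (snd c) (chart_inv c)"
  using atlas by (auto simp: smooth_atlas_def is_chart_def)

lemma chart_ex: "\<exists>c\<in>A. x \<in> fst c"
  using atlas by (auto simp: smooth_atlas_def)

lemma chart_inv_chart [simp]: "c \<in> A \<Longrightarrow> x \<in> fst c \<Longrightarrow> chart_inv c (snd c x) = x"
  using chart_homeo homeomorphism_apply1 by blast

lemma chart_inv_in: "c \<in> A \<Longrightarrow> y \<in> snd c ` fst c \<Longrightarrow> chart_inv c y \<in> fst c"
  by auto

lemma chart_image_Int:
  assumes "c \<in> A"
  shows "y \<in> snd c ` (fst c \<inter> U) \<longleftrightarrow> y \<in> snd c ` fst c \<and> chart_inv c y \<in> U"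
proof
  assume "y \<in> snd c ` fst c \<and> chart_inv c y \<in> U"
  then obtain x where "x \<in> fst c" "y = snd c x" "chart_inv c y \<in> U" by blast
  then show "y \<in> snd c ` (fst c \<inter> U)" using assms by auto
qed (use assms in auto)

lemma chart_image_open_Int:
  assumes "c \<in> A" "open U" shows "open (snd c ` (fst c \<inter> U))"
proof -
  have "openin (top_of_set (snd c ` fst c)) (snd c ` (fst c \<inter> U))"
    by (rule homeomorphism_imp_open_map[OF chart_homeo[OF assms(1)]]) (use assms in \<open>auto simp: openin_open\<close>)
  then show ?thesis using chart_image_open[OF assms(1)] openin_open_eq by blast
qed

lemma chart_inv_continuous: "c \<in> A \<Longrightarrow> continuous_on (snd c ` fst c) (chart_inv c)"
  and chart_continuous: "c \<in> A \<Longrightarrow> continuous_on (fst c) (snd c)"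
  using chart_homeo homeomorphism_def by blast+

lemma transition_smooth:
  "c \<in> A \<Longrightarrow> d \<in> A \<Longrightarrow> smooth_on (snd c ` (fst c \<inter> fst d)) (snd d \<circ> chart_inv c)"
  using atlas by (auto simp: smooth_atlas_def)

lemma smooth_on_imp_differentiable: "smooth_on S f \<Longrightarrow> x \<in> S \<Longrightarrow> f differentiable (at x)"
  using smooth_onD[of S f "Suc 0"] by simp

lemma smooth_map_on_differentiable:
  "smooth_map_on A U f \<Longrightarrow> c \<in> A \<Longrightarrow> x \<in> fst c \<Longrightarrow> x \<in> U \<Longrightarrow> (f \<circ> chart_inv c) differentiable (at (snd c x))"
  unfolding smooth_map_on_def by (auto intro: smooth_on_imp_differentiable)

lemma smooth_map_on_ck:
  "smooth_map_on A U f \<Longrightarrow> c \<in> A \<Longrightarrow> ck_on k (snd c ` (fst c \<inter> U)) (\<lambda>y. f (chart_inv c y))"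
  unfolding smooth_map_on_def smooth_on_def comp_def by auto

lemma smooth_map_onI:
  "(\<And>c k. c \<in> A \<Longrightarrow> ck_on k (snd c ` (fst c \<inter> U)) (\<lambda>y. f (chart_inv c y))) \<Longrightarrow> smooth_map_on A U f"
  unfolding smooth_map_on_def smooth_on_def comp_def by auto

lemma smooth_map_on_cong:
  assumes "open U" "\<And>x. x \<in> U \<Longrightarrow> f x = f' x" "smooth_map_on A U f"
  shows "smooth_map_on A U f'"
proof (rule smooth_map_onI)
  fix c k assume c: "c \<in> A"
  show "ck_on k (snd c ` (fst c \<inter> U)) (\<lambda>y. f' (chart_inv c y))"
    using smooth_map_on_ck[OF assms(3) c] chart_image_Int[OF c] assms(2)
    by (subst ck_on_cong[OF chart_image_open_Int[OF c assms(1)], where g="\<lambda>y. f (chart_inv c y)"]) auto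
qed

lemma smooth_map_on_Un:
  assumes "open U" "open V" "smooth_map_on A U f" "smooth_map_on A V f"
  shows "smooth_map_on A (U \<union> V) f"
proof (rule smooth_map_onI)
  fix c k assume c: "c \<in> A"
  have "snd c ` (fst c \<inter> (U \<union> V)) = snd c ` (fst c \<inter> U) \<union> snd c ` (fst c \<inter> V)" by blast
  then show "ck_on k (snd c ` (fst c \<inter> (U \<union> V))) (\<lambda>y. f (chart_inv c y))"
    using ck_on_Un[OF chart_image_open_Int[OF c assms(1)] chart_image_open_Int[OF c assms(2)]]
      smooth_map_on_ck[OF assms(3) c] smooth_map_on_ck[OF assms(4) c] by metis
qed

lemma smooth_map_on_chartI:
  assumes d: "d \<in> A" and U: "open U" "U \<subseteq> fst d"
    and f: "\<And>k. ck_on k (snd d ` U) (\<lambda>y. f (chart_inv d y))"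
  shows "smooth_map_on A U f"
proof (rule smooth_map_onI)
  fix c k assume c: "c \<in> A"
  let ?S = "snd c ` (fst c \<inter> U)"
  have S: "open ?S" by (rule chart_image_open_Int[OF c U(1)])
  have "ck_on k ?S (\<lambda>y. f (chart_inv d ((snd d \<circ> chart_inv c) y)))"
  proof (rule ck_on_compose[OF S _ f])
    show "ck_on k ?S (snd d \<circ> chart_inv c)"
      using smooth_onD[OF transition_smooth[OF c d]] by (rule ck_on_subset) (use U in auto)
    show "(snd d \<circ> chart_inv c) ` ?S \<subseteq> snd d ` U" using c by auto
  qed
  then show "ck_on k ?S (\<lambda>y. f (chart_inv c y))"
    by (subst ck_on_cong[OF S, where g="\<lambda>y. f (chart_inv d ((snd d \<circ> chart_inv c) y))"]) (use c d U in auto)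
qed

lemma smooth_map_on_const: "smooth_map_on A U (\<lambda>x. a)"
  by (rule smooth_map_onI) simp

lemma smooth_map_on_add:
  "open U \<Longrightarrow> smooth_map_on A U f \<Longrightarrow> smooth_map_on A U f' \<Longrightarrow> smooth_map_on A U (\<lambda>x. f x + f' x)"
  by (rule smooth_map_onI) (intro ck_on_add chart_image_open_Int smooth_map_on_ck)

lemma smooth_map_on_scaleR:
  "open U \<Longrightarrow> smooth_map_on A U f \<Longrightarrow> smooth_map_on A U f' \<Longrightarrow> smooth_map_on A U (\<lambda>x. f x *\<^sub>R f' x)"
  by (rule smooth_map_onI) (intro ck_on_scaleR chart_image_open_Int smooth_map_on_ck)

lemma smooth_map_on_mult:
  fixes f f' :: "'m \<Rightarrow> real"
  shows "open U \<Longrightarrow> smooth_map_on A U f \<Longrightarrow> smooth_map_on A U f' \<Longrightarrow> smooth_map_on A U (\<lambda>x. f x * f' x)"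
  using smooth_map_on_scaleR[of U f f'] by simp

lemma smooth_map_on_continuous:
  assumes "smooth_map_on A U f" "open U" shows "continuous_on U f"
proof (subst continuous_on_eq_continuous_at[OF assms(2)], rule ballI)
  fix x assume x: "x \<in> U"
  obtain c where c: "c \<in> A" "x \<in> fst c" using chart_ex by blast
  have o: "open (fst c \<inter> U)" using chart_open[OF c(1)] assms(2) by auto
  have "continuous_on (fst c \<inter> U) (\<lambda>x. f (chart_inv c (snd c x)))"
    by (rule continuous_on_compose2[OF ck_on_imp_continuous[OF smooth_map_on_ck[OF assms(1) c(1), of 0]]])
      (auto intro: continuous_on_subset[OF chart_continuous[OF c(1)]])
  then have "continuous_on (fst c \<inter> U) f"
    by (rule continuous_on_eq) (use c in auto)
  then show "isCont f x" using o x c by (simp add: continuous_on_eq_continuous_at)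
qed

section \<open>Tangent spaces in a chart\<close>

lemma chart_vec_differentiable:
  "(f \<circ> chart_inv c) differentiable (at (snd c x)) \<Longrightarrow>
     chart_vec c x w f = frechet_derivative (f \<circ> chart_inv c) (at (snd c x)) w"
  by (simp add: chart_vec_def)

lemma transition_has_derivative:
  assumes "c \<in> A" "d \<in> A" "x \<in> fst c" "x \<in> fst d"
  shows "((snd d \<circ> chart_inv c) has_derivative frechet_derivative (snd d \<circ> chart_inv c) (at (snd c x))) (at (snd c x))"
  using smooth_on_imp_differentiable[OF transition_smooth[OF assms(1,2)]] assms
  by (auto simp: frechet_derivative_works)

lemma chart_change_has_derivative:
  assumes cd: "c \<in> A" "d \<in> A" "x \<in> fst c" "x \<in> fst d"
    and f: "((f \<circ> chart_inv d) has_derivative D) (at (snd d x))"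
  shows "((f \<circ> chart_inv c) has_derivative (D \<circ> frechet_derivative (snd d \<circ> chart_inv c) (at (snd c x)))) (at (snd c x))"
proof -
  have "((f \<circ> chart_inv d) has_derivative D) (at ((snd d \<circ> chart_inv c) (snd c x)))" using f cd by simp
  from diff_chain_at[OF transition_has_derivative[OF cd] this]
  show ?thesis
    by (rule has_derivative_transform_within_open[where s="snd c ` (fst c \<inter> fst d)"])
      (use cd chart_image_open_Int chart_open in auto)
qed

text \<open>Besides the chain rule, the default value 0 has to agree: transition maps are smooth in
  both directions, so \<open>f\<close> is differentiable in one chart exactly if it is in the
  other.\<close>

lemma chart_vec_change:
  assumes cd: "c \<in> A" "d \<in> A" "x \<in> fst c" "x \<in> fst d"
  shows "chart_vec c x w = chart_vec d x (frechet_derivative (snd d \<circ> chart_inv c) (at (snd c x)) w)"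
proof
  fix f
  show "chart_vec c x w f = chart_vec d x (frechet_derivative (snd d \<circ> chart_inv c) (at (snd c x)) w) f"
  proof (cases "(f \<circ> chart_inv d) differentiable (at (snd d x))")
    case True
    then have *: "((f \<circ> chart_inv c) has_derivative (frechet_derivative (f \<circ> chart_inv d) (at (snd d x)) \<circ> frechet_derivative (snd d \<circ> chart_inv c) (at (snd c x)))) (at (snd c x))"
      using chart_change_has_derivative[OF cd] by (simp add: frechet_derivative_works)
    then have "(f \<circ> chart_inv c) differentiable (at (snd c x))" by (auto simp: differentiable_def)
    then show ?thesis using True frechet_derivative_at[OF *] by (metis chart_vec_differentiable comp_apply)
  next
    case False
    then have "\<not> (f \<circ> chart_inv c) differentiable (at (snd c x))"
      using chart_change_has_derivative[of d c x f] cd by (auto simp: differentiable_def)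
    then show ?thesis using False by (simp add: chart_vec_def)
  qed
qed

lemma tangent_space_chart:
  assumes "c \<in> A" "x \<in> fst c"
  shows "tangent_space A x = range (chart_vec c x)"
proof
  show "tangent_space A x \<subseteq> range (chart_vec c x)"
    unfolding tangent_space_def using chart_vec_change[OF _ assms(1) _ assms(2)] by blast
  show "range (chart_vec c x) \<subseteq> tangent_space A x"
    unfolding tangent_space_def using assms by blast
qed

lemma chart_vec_in: "c \<in> A \<Longrightarrow> x \<in> fst c \<Longrightarrow> chart_vec c x w \<in> tangent_space A x"
  and coord_vec_in: "c \<in> A \<Longrightarrow> x \<in> fst c \<Longrightarrow> coord_vec c i x \<in> tangent_space A x"
  unfolding tangent_space_def coord_vec_def by blast+

lemma tv_lincomb_chart_vec:
  "tv_lincomb a (chart_vec c x u) b (chart_vec c x v) = chart_vec c (x :: 'm) (a *\<^sub>R u + b *\<^sub>R v)"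
proof
  fix f :: "'m \<Rightarrow> real"
  have "linear (frechet_derivative (f \<circ> chart_inv c) (at (snd c x)))"
    if "(f \<circ> chart_inv c) differentiable (at (snd c x))"
    using that frechet_derivative_works has_derivative_linear by blast
  then show "tv_lincomb a (chart_vec c x u) b (chart_vec c x v) f = chart_vec c x (a *\<^sub>R u + b *\<^sub>R v) f"
    by (simp add: tv_lincomb_def chart_vec_def linear_add linear_scale)
qed

lemma tv_lincomb_in:
  assumes "u \<in> tangent_space A x" "v \<in> tangent_space A x"
  shows "tv_lincomb a u b v \<in> tangent_space A x"
proof -
  obtain c where "c \<in> A" "x \<in> fst c" using chart_ex by blast
  then show ?thesis using assms by (auto simp: tangent_space_chart tv_lincomb_chart_vec)
qed

text \<open>Linearity of \<open>L\<close> is expressed through \<open>tv_lincomb\<close>, as tangent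
  vectors are functionals and not a vector space type. The target is an arbitrary real vector space
  so that the lemma serves evaluation at functions, bilinear forms and the fibre-valued
  \<open>nabla\<close> alike.\<close>

lemma tv_linear_chart_vec:
  fixes L :: "'m tvec \<Rightarrow> 'v::real_vector"
  assumes c: "c \<in> A" "x \<in> fst c"
    and L: "\<And>u v a b. u \<in> tangent_space A x \<Longrightarrow> v \<in> tangent_space A x \<Longrightarrow> L (tv_lincomb a u b v) = a *\<^sub>R L u + b *\<^sub>R L v"
  shows "L (chart_vec c x w) = (\<Sum>i\<in>UNIV. w $ i *\<^sub>R L (coord_vec c i x))"
proof -
  have *: "L (chart_vec c x (a *\<^sub>R u + b *\<^sub>R v)) = a *\<^sub>R L (chart_vec c x u) + b *\<^sub>R L (chart_vec c x v)" for a b u v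
    using L[OF chart_vec_in[OF c] chart_vec_in[OF c], of a u b v] by (simp add: tv_lincomb_chart_vec)
  have lin: "linear (\<lambda>u. L (chart_vec c x u))"
    using *[of 1 _ 1] *[of _ _ 0] by (intro linearI) auto
  have "w = (\<Sum>i\<in>UNIV. w $ i *\<^sub>R axis i 1)"
    using basis_expansion[of w] by (simp add: scalar_mult_eq_scaleR)
  then have "L (chart_vec c x w) = L (chart_vec c x (\<Sum>i\<in>UNIV. w $ i *\<^sub>R axis i 1))" by simp
  also have "\<dots> = (\<Sum>i\<in>UNIV. w $ i *\<^sub>R L (chart_vec c x (axis i 1)))"
    by (simp add: linear_sum[OF lin] linear_scale[OF lin])
  finally show ?thesis by (simp add: coord_vec_def)
qed

lemma chart_vec_eval: "c \<in> A \<Longrightarrow> x \<in> fst c \<Longrightarrow> chart_vec c x w f = (\<Sum>i\<in>UNIV. w $ i * coord_vec c i x f)"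
  using tv_linear_chart_vec[of c x "\<lambda>v. v f" w] by (simp add: tv_lincomb_def)

lemma chart_has_derivative:
  assumes c: "c \<in> A" "x \<in> fst c"
  shows "((snd c \<circ> chart_inv c) has_derivative (\<lambda>v. v)) (at (snd c x))"
  by (rule has_derivative_transform_within_open[where s="snd c ` fst c" and f="\<lambda>y. y"])
    (use c chart_image_open in \<open>auto intro: has_derivative_ident\<close>)

text \<open>In its own chart a coordinate function is a linear projection, hence its own derivative.
  This recovers components from a tangent vector, both for injectivity of \<open>chart_vec\<close>
  and for the components used by \<open>divergence\<close>.\<close>

lemma chart_vec_coord_fun:
  assumes c: "c \<in> A" "x \<in> fst c"
  shows "chart_vec c x w (\<lambda>z. snd c z $ i) = w $ i"
proof -
  have *: "((\<lambda>z. snd c z $ i) \<circ> chart_inv c has_derivative (\<lambda>v. v $ i)) (at (snd c x))"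
    using bounded_linear.has_derivative[OF bounded_linear_vec_nth chart_has_derivative[OF c]]
    by (simp add: comp_def)
  then show ?thesis
    using frechet_derivative_at[OF *] by (metis chart_vec_differentiable differentiableI)
qed

lemma chart_vec_inj: "c \<in> A \<Longrightarrow> x \<in> fst c \<Longrightarrow> chart_vec c x u = chart_vec c x v \<Longrightarrow> u = v"
  by (metis chart_vec_coord_fun vec_eq_iff)

lemma chart_vec_0: "chart_vec c (x :: 'm) 0 = (\<lambda>f. 0)"
  using tv_lincomb_chart_vec[of 0 c x 0 0 0] by (simp add: tv_lincomb_def)

lemma tangent_vec_local:
  assumes v: "v \<in> tangent_space A x" and W: "open W" "x \<in> W" and eq: "\<And>y. y \<in> W \<Longrightarrow> f y = f' y"
  shows "v f = v f'"
proof -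
  obtain c w where c: "c \<in> A" "x \<in> fst c" and v_eq: "v = chart_vec c x w"
    using v by (auto simp: tangent_space_def)
  have *: "((f \<circ> chart_inv c) has_derivative D) (at (snd c x)) \<Longrightarrow> ((f' \<circ> chart_inv c) has_derivative D) (at (snd c x))"
    if "\<And>y. y \<in> W \<Longrightarrow> f y = f' y" for f f' :: "'m \<Rightarrow> real" and D
    by (erule has_derivative_transform_within_open[where s="snd c ` (fst c \<inter> W)"])
      (use c W that chart_image_open_Int in auto)
  \<comment> \<open>\<open>chart_vec\<close> sees \<open>f\<close> only through this relation, so
    its equality for \<open>f\<close> and \<open>f'\<close> also settles the case where neither is
    differentiable and the default 0 is taken.\<close>
  have iff: "((f \<circ> chart_inv c) has_derivative D) (at (snd c x)) \<longleftrightarrow> ((f' \<circ> chart_inv c) has_derivative D) (at (snd c x))" for D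
    using *[of f f'] *[of f' f] eq by metis
  show ?thesis unfolding v_eq chart_vec_def differentiable_def frechet_derivative_def iff ..
qed

lemma tangent_vec_mult:
  assumes v: "v \<in> tangent_space A x" and f: "smooth_map_on A U f" "smooth_map_on A U f'" and x: "x \<in> U"
  shows "v (\<lambda>y. f y * f' y) = f x * v f' + v f * f' x"
proof -
  obtain c w where c: "c \<in> A" "x \<in> fst c" and v_eq: "v = chart_vec c x w"
    using v by (auto simp: tangent_space_def)
  have d: "(f \<circ> chart_inv c) differentiable (at (snd c x))" "(f' \<circ> chart_inv c) differentiable (at (snd c x))"
    using smooth_map_on_differentiable f c x by blast+
  then have *: "((\<lambda>y. f y * f' y) \<circ> chart_inv c has_derivative
     (\<lambda>w. f x * frechet_derivative (f' \<circ> chart_inv c) (at (snd c x)) w + frechet_derivative (f \<circ> chart_inv c) (at (snd c x)) w * f' x)) (at (snd c x))"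
    using has_derivative_mult[of "f \<circ> chart_inv c" _ "snd c x" UNIV "f' \<circ> chart_inv c"] c
    by (simp add: frechet_derivative_works comp_def)
  then have "((\<lambda>y. f y * f' y) \<circ> chart_inv c) differentiable (at (snd c x))" by (auto simp: differentiable_def)
  then show ?thesis
    unfolding v_eq using d frechet_derivative_at[OF *, symmetric] by (simp add: chart_vec_differentiable)
qed

lemma tangent_vec_add:
  assumes v: "v \<in> tangent_space A x" and f: "smooth_map_on A U f" "smooth_map_on A U f'" and x: "x \<in> U"
  shows "v (\<lambda>y. f y + f' y) = v f + v f'"
proof -
  obtain c w where c: "c \<in> A" "x \<in> fst c" and v_eq: "v = chart_vec c x w"
    using v by (auto simp: tangent_space_def)
  have d: "(f \<circ> chart_inv c) differentiable (at (snd c x))" "(f' \<circ> chart_inv c) differentiable (at (snd c x))"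
    using smooth_map_on_differentiable f c x by blast+
  then have *: "((\<lambda>y. f y + f' y) \<circ> chart_inv c has_derivative
     (\<lambda>w. frechet_derivative (f \<circ> chart_inv c) (at (snd c x)) w + frechet_derivative (f' \<circ> chart_inv c) (at (snd c x)) w)) (at (snd c x))"
    using has_derivative_add[of "f \<circ> chart_inv c" _ "at (snd c x)" "f' \<circ> chart_inv c"] c
    by (simp add: frechet_derivative_works comp_def)
  then have "((\<lambda>y. f y + f' y) \<circ> chart_inv c) differentiable (at (snd c x))" by (auto simp: differentiable_def)
  then show ?thesis
    unfolding v_eq using d frechet_derivative_at[OF *, symmetric] by (simp add: chart_vec_differentiable)
qed

lemma tangent_vec_const:
  assumes v: "v \<in> tangent_space A x" shows "v (\<lambda>y. a) = 0"
proof -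
  obtain c w where c: "c \<in> A" "x \<in> fst c" and v_eq: "v = chart_vec c x w"
    using v by (auto simp: tangent_space_def)
  have "(\<lambda>y. a) \<circ> chart_inv c = (\<lambda>y. a)" by auto
  then show ?thesis by (simp add: v_eq chart_vec_def frechet_derivative_const)
qed

lemma tangent_vec_cmult:
  assumes v: "v \<in> tangent_space A x" and f: "smooth_map_on A U f" and x: "x \<in> U"
  shows "v (\<lambda>y. a * f y) = a * v f"
  using tangent_vec_mult[OF v smooth_map_on_const f x, of a] tangent_vec_const[OF v] by simp

lemma coord_vec_frechet:
  assumes "smooth_map_on A U f" "c \<in> A" "y \<in> snd c ` (fst c \<inter> U)"
  shows "coord_vec c i (chart_inv c y) f = frechet_derivative (\<lambda>y. f (chart_inv c y)) (at y) (axis i 1)"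
proof -
  obtain x where x: "x \<in> fst c" "x \<in> U" "y = snd c x" using assms by blast
  have "(f \<circ> chart_inv c) differentiable (at (snd c x))"
    using smooth_map_on_differentiable assms x by blast
  then show ?thesis using assms(2) x by (simp add: coord_vec_def chart_vec_differentiable comp_def)
qed

lemma coord_vec_continuous:
  assumes f: "smooth_map_on A UNIV f" and c: "c \<in> A"
  shows "continuous_on (fst c) (\<lambda>x. coord_vec c i x f)"
proof -
  have "ck_on (Suc 0) (snd c ` (fst c \<inter> UNIV)) (\<lambda>y. f (chart_inv c y))" by (rule smooth_map_on_ck[OF f c])
  then have *: "continuous_on (snd c ` fst c) (\<lambda>y. frechet_derivative (\<lambda>y. f (chart_inv c y)) (at y) (axis i 1))" by simp
  have "continuous_on (fst c) (\<lambda>x. frechet_derivative (\<lambda>y. f (chart_inv c y)) (at (snd c x)) (axis i 1))"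
    by (rule continuous_on_compose2[OF * chart_continuous[OF c]]) auto
  then show ?thesis
    by (rule continuous_on_eq) (use coord_vec_frechet[OF f c] c in fastforce)
qed

end

section \<open>Orthonormal frames and gradients\<close>

locale riemannian = atlas A
  for A :: "('m::{t2_space, second_countable_topology}, 'n::finite) chart set" +
  fixes g :: "'m metric"
  assumes metric: "riemannian_metric A g"
begin

lemma metric_sym: "u \<in> tangent_space A x \<Longrightarrow> v \<in> tangent_space A x \<Longrightarrow> g x u v = g x v u"
  and metric_lin: "u \<in> tangent_space A x \<Longrightarrow> v \<in> tangent_space A x \<Longrightarrow> w \<in> tangent_space A x \<Longrightarrow>
     g x (tv_lincomb a u b v) w = a * g x u w + b * g x v w"
  and metric_pos: "u \<in> tangent_space A x \<Longrightarrow> u \<noteq> (\<lambda>f. 0) \<Longrightarrow> g x u u > 0"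
  using metric unfolding riemannian_metric_def by blast+

lemma metric_smooth:
  "c \<in> A \<Longrightarrow> smooth_map_on A (fst c) (\<lambda>x. g x (coord_vec c i x) (coord_vec c j x))"
  using metric by (auto simp: riemannian_metric_def)

lemma metric_bilinear: "tv_bilinear A x (g x)"
  unfolding tv_bilinear_def by (metis metric_lin metric_sym tv_lincomb_in)

lemma tv_bilinear_chart_vec:
  assumes Q: "tv_bilinear A x Q" and c: "c \<in> A" "x \<in> fst c"
  shows "Q (chart_vec c x u) (chart_vec c x v) = (\<Sum>i\<in>UNIV. \<Sum>j\<in>UNIV. u $ i * v $ j * Q (coord_vec c i x) (coord_vec c j x))"
proof -
  have "Q (chart_vec c x u) (chart_vec c x v) = (\<Sum>i\<in>UNIV. u $ i *\<^sub>R Q (coord_vec c i x) (chart_vec c x v))"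
    by (rule tv_linear_chart_vec[OF c]) (use Q chart_vec_in[OF c] in \<open>auto simp: tv_bilinear_def\<close>)
  also have "\<dots> = (\<Sum>i\<in>UNIV. u $ i *\<^sub>R (\<Sum>j\<in>UNIV. v $ j *\<^sub>R Q (coord_vec c i x) (coord_vec c j x)))"
    by (intro sum.cong refl arg_cong2[where f=scaleR] tv_linear_chart_vec[OF c])
      (use Q coord_vec_in[OF c] in \<open>auto simp: tv_bilinear_def\<close>)
  finally show ?thesis by (simp add: sum_distrib_left mult.assoc)
qed

lemma metric_chart_vec:
  assumes c: "c \<in> A" "x \<in> fst c"
  shows "g x (chart_vec c x u) (chart_vec c x v) = u \<bullet> (gram g c x *v v)"
  unfolding tv_bilinear_chart_vec[OF metric_bilinear c]
  by (simp add: inner_vec_def matrix_vector_mult_def gram_def sum_distrib_left mult_ac)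

lemma gram_sym: "c \<in> A \<Longrightarrow> x \<in> fst c \<Longrightarrow> transpose (gram g c x) = gram g c x"
  using metric_sym coord_vec_in by (auto simp: transpose_def gram_def vec_eq_iff)

lemma gram_pos:
  assumes c: "c \<in> A" "x \<in> fst c" and "v \<noteq> 0" shows "v \<bullet> (gram g c x *v v) > 0"
proof -
  have "chart_vec c x v \<noteq> (\<lambda>f. 0)"
    using chart_vec_inj[OF c, of v 0] assms(3) by (auto simp: chart_vec_0)
  from metric_pos[OF chart_vec_in[OF c] this] show ?thesis by (simp add: metric_chart_vec[OF c])
qed

lemma orthonormal_frame_ex: "\<exists>e. orthonormal_frame A g x e"
proof -
  obtain c where c: "c \<in> A" "x \<in> fst c" using chart_ex by blast
  obtain b :: "'n \<Rightarrow> real^'n" where "\<And>i j. b i \<bullet> (gram g c x *v b j) = (if i = j then 1 else 0)"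
    using gram_orthonormal_basis_exists[OF gram_sym[OF c] gram_pos[OF c]] by blast
  then have "orthonormal_frame A g x (\<lambda>i. chart_vec c x (b i))"
    unfolding orthonormal_frame_def using metric_chart_vec[OF c] chart_vec_in[OF c] by simp
  then show ?thesis by blast
qed

lemma orthonormal_frame_chart:
  assumes e: "orthonormal_frame A g x e" and c: "c \<in> A" "x \<in> fst c"
  shows "\<exists>b :: 'n \<Rightarrow> real^'n. (\<forall>k. e k = chart_vec c x (b k)) \<and>
    (\<forall>i j. b i \<bullet> (gram g c x *v b j) = (if i = j then 1 else 0))"
proof -
  have "\<exists>w. e k = chart_vec c x w" for k
    using e tangent_space_chart[OF c] by (auto simp: orthonormal_frame_def)
  then obtain b where b: "\<And>k. e k = chart_vec c x (b k)" by metis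
  moreover have "b i \<bullet> (gram g c x *v b j) = (if i = j then 1 else 0)" for i j
    using e metric_chart_vec[OF c, of "b i" "b j"] b by (simp add: orthonormal_frame_def)
  ultimately show ?thesis by blast
qed

lemma gram_invertible:
  assumes c: "c \<in> A" "x \<in> fst c" shows "invertible (gram g c x)"
proof -
  obtain b :: "'n \<Rightarrow> real^'n" where "\<And>i j. b i \<bullet> (gram g c x *v b j) = (if i = j then 1 else 0)"
    using gram_orthonormal_basis_exists[OF gram_sym[OF c] gram_pos[OF c]] by blast
  then show ?thesis by (rule gram_orthonormal_basis_inverse(2))
qed

text \<open>The metric trace of \<open>Q\<close> in coordinates. The right-hand side does not
  mention the frame, so traces formed with arbitrarily chosen frames still vary with the point as
  regularly as the coordinate expressions do.\<close>

lemma frame_trace: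
  assumes Q: "tv_bilinear A x Q" and e: "orthonormal_frame A g x e" and c: "c \<in> A" "x \<in> fst c"
  shows "(\<Sum>k\<in>UNIV. Q (e k) (e k)) =
    (\<Sum>i\<in>UNIV. \<Sum>j\<in>UNIV. matrix_inv (gram g c x) $ i $ j * Q (coord_vec c i x) (coord_vec c j x))"
proof -
  obtain b :: "'n \<Rightarrow> real^'n" where b: "\<And>k. e k = chart_vec c x (b k)"
    and o: "\<And>i j. b i \<bullet> (gram g c x *v b j) = (if i = j then 1 else 0)"
    using orthonormal_frame_chart[OF e c] by metis
  have "(\<Sum>k\<in>UNIV. Q (e k) (e k)) = (\<Sum>k\<in>UNIV. \<Sum>i\<in>UNIV. \<Sum>j\<in>UNIV. b k $ i * b k $ j * Q (coord_vec c i x) (coord_vec c j x))"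
    by (simp add: b tv_bilinear_chart_vec[OF Q c])
  also have "\<dots> = (\<Sum>i\<in>UNIV. \<Sum>j\<in>UNIV. \<Sum>k\<in>UNIV. b k $ i * b k $ j * Q (coord_vec c i x) (coord_vec c j x))"
    unfolding sum.swap[of "\<lambda>k i. \<Sum>j\<in>UNIV. b k $ i * b k $ j * Q (coord_vec c i x) (coord_vec c j x)" UNIV UNIV]
    by (intro sum.cong refl sum.swap)
  also have "\<dots> = (\<Sum>i\<in>UNIV. \<Sum>j\<in>UNIV. matrix_inv (gram g c x) $ i $ j * Q (coord_vec c i x) (coord_vec c j x))"
    by (simp add: sum_distrib_right[symmetric] gram_orthonormal_basis_inverse(1)[OF o])
  finally show ?thesis .
qed

lemma differential_bilinear: "tv_bilinear A x (\<lambda>u v. u f * v f')"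
  by (auto simp: tv_bilinear_def tv_lincomb_def algebra_simps)

text \<open>Raising the index of the differential with the inverse Gram matrix gives a vector that
  represents \<open>f\<close>; the difference of two such vectors is orthogonal to itself, so
  positivity makes the definite description proper.\<close>

lemma gradient_chart:
  assumes c: "c \<in> A" "x \<in> fst c"
  shows "gradient A g f x = chart_vec c x (matrix_inv (gram g c x) *v (\<chi> i. coord_vec c i x f))"
    and "gradient A g f x \<in> tangent_space A x"
    and "w \<in> tangent_space A x \<Longrightarrow> g x (gradient A g f x) w = w f"
proof -
  let ?G = "gram g c x" and ?d = "\<chi> i. coord_vec c i x f"
  let ?v = "chart_vec c x (matrix_inv ?G *v ?d)"
  have v: "?v \<in> tangent_space A x \<and> (\<forall>w\<in>tangent_space A x. g x ?v w = w f)"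
  proof (intro conjI ballI chart_vec_in c)
    fix w assume w: "w \<in> tangent_space A x"
    then obtain u where u: "w = chart_vec c x u" using tangent_space_chart[OF c] by blast
    have "g x ?v w = g x w ?v" using metric_sym[OF chart_vec_in[OF c] w] .
    also have "\<dots> = u \<bullet> ?d"
      using matrix_inv_mult(1)[OF gram_invertible[OF c]]
      by (simp add: u metric_chart_vec[OF c] matrix_vector_mul_assoc)
    also have "\<dots> = w f" by (simp add: u chart_vec_eval[OF c] inner_vec_def)
    finally show "g x ?v w = w f" .
  qed
  have "gradient A g f x = ?v" unfolding gradient_def
  proof (rule the_equality)
    show "?v \<in> tangent_space A x \<and> (\<forall>w\<in>tangent_space A x. g x ?v w = w f)" by (rule v)
  next
    fix v' assume v': "v' \<in> tangent_space A x \<and> (\<forall>w\<in>tangent_space A x. g x v' w = w f)"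
    let ?z = "tv_lincomb 1 v' (-1) ?v"
    have z: "?z \<in> tangent_space A x" using v v' tv_lincomb_in by blast
    have "g x ?z ?z = 0"
      using v v' z metric_lin[of v' x ?v ?z 1 "-1"] by simp
    then have "?z = (\<lambda>f. 0)" using metric_pos[OF z] by fastforce
    then show "v' = ?v" by (auto simp: tv_lincomb_def fun_eq_iff)
  qed
  then show "gradient A g f x = ?v" "gradient A g f x \<in> tangent_space A x"
    "w \<in> tangent_space A x \<Longrightarrow> g x (gradient A g f x) w = w f" using v by auto
qed

lemma grad_norm2_frame:
  assumes e: "orthonormal_frame A g x e"
  shows "grad_norm2 A g f x = (\<Sum>k\<in>UNIV. (e k f)\<^sup>2)"
proof -
  obtain c where c: "c \<in> A" "x \<in> fst c" using chart_ex by blast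
  have "grad_norm2 A g f x = gradient A g f x f"
    unfolding grad_norm2_def using gradient_chart(2,3)[OF c] by blast
  also have "\<dots> = (\<Sum>i\<in>UNIV. \<Sum>j\<in>UNIV. matrix_inv (gram g c x) $ i $ j * (coord_vec c i x f * coord_vec c j x f))"
    unfolding gradient_chart(1)[OF c] chart_vec_eval[OF c]
    by (simp add: matrix_vector_mult_def sum_distrib_left sum_distrib_right mult_ac)
  also have "\<dots> = (\<Sum>k\<in>UNIV. (e k f)\<^sup>2)"
    using frame_trace[OF differential_bilinear e c, of f f] by (simp add: power2_eq_square)
  finally show ?thesis .
qed

text \<open>With \<open>J\<close> the Jacobian matrix of the transition map, the Gram matrix becomes
  J^T G J, so its determinant gains the square of det J and the density gains |det J|, as the
  substitution rule demands.\<close>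

lemma det_gram_change:
  assumes cd: "c \<in> A" "d \<in> A" "x \<in> fst c" "x \<in> fst d"
  shows "vol_density g c x = \<bar>det (matrix (frechet_derivative (snd d \<circ> chart_inv c) (at (snd c x))))\<bar> * vol_density g d x"
proof -
  let ?D = "frechet_derivative (snd d \<circ> chart_inv c) (at (snd c x))"
  define J where "J = matrix ?D"
  have J: "?D w = J *v w" for w
    unfolding J_def by (rule fun_cong[OF matrix_vector_mul(2)[OF has_derivative_linear[OF transition_has_derivative[OF cd]]], symmetric])
  have "gram g c x = transpose J ** (gram g d x ** J)"
  proof -
    have "gram g c x $ i $ j = (J *v axis i 1) \<bullet> (gram g d x *v (J *v axis j 1))" for i j
    proof -
      have "gram g c x $ i $ j = g x (chart_vec c x (axis i 1)) (chart_vec c x (axis j 1))"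
        by (simp add: gram_def coord_vec_def)
      then show ?thesis unfolding chart_vec_change[OF cd] metric_chart_vec[OF cd(2,4)] J .
    qed
    also have "\<dots> i j = (transpose J ** (gram g d x ** J)) $ i $ j" for i j
      unfolding matrix_vector_mult_basis
      by (simp add: inner_vec_def column_def
          matrix_matrix_mult_def transpose_def matrix_vector_mult_def)
    finally show ?thesis by (simp add: vec_eq_iff)
  qed
  then have "det (gram g c x) = (det J)\<^sup>2 * det (gram g d x)"
    by (simp add: det_mul det_transpose power2_eq_square)
  then show ?thesis by (simp add: vol_density_def real_sqrt_mult J_def)
qed

text \<open>An orthonormal basis gives B^T G B = 1, so the determinant times the square of det B is
  1.\<close>

lemma det_gram_pos:
  assumes c: "c \<in> A" "x \<in> fst c" shows "det (gram g c x) > 0"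
proof -
  obtain b :: "'n \<Rightarrow> real^'n" where b: "\<And>i j. b i \<bullet> (gram g c x *v b j) = (if i = j then 1 else 0)"
    using gram_orthonormal_basis_exists[OF gram_sym[OF c] gram_pos[OF c]] by blast
  define B where "B = (\<chi> i j. b j $ i)"
  have "(transpose B ** (gram g c x ** B)) $ i $ j = b i \<bullet> (gram g c x *v b j)" for i j
    by (simp add: matrix_matrix_mult_def transpose_def B_def inner_vec_def matrix_vector_mult_def)
  then have "transpose B ** (gram g c x ** B) = mat 1"
    using b by (simp add: vec_eq_iff mat_def)
  then have "(det B)\<^sup>2 * det (gram g c x) = 1"
    using det_I[where 'n='n, where 'a=real] by (simp add: det_mul det_transpose power2_eq_square mult_ac flip: \<open>transpose B ** (gram g c x ** B) = mat 1\<close>)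
  moreover have "(det B)\<^sup>2 * det (gram g c x) \<le> 0" if "det (gram g c x) \<le> 0"
    using that by (simp add: mult_nonneg_nonpos)
  ultimately show ?thesis by fastforce
qed

lemma vol_density_pos: "c \<in> A \<Longrightarrow> x \<in> fst c \<Longrightarrow> vol_density g c x > 0"
  by (simp add: vol_density_def det_gram_pos)

lemma gram_ck:
  assumes c: "c \<in> A" shows "ck_on k (snd c ` fst c) (\<lambda>y. gram g c (chart_inv c y) $ i $ j)"
  using smooth_map_on_ck[OF metric_smooth[OF c] c] by (simp add: gram_def)

lemma vol_density_ck1:
  assumes c: "c \<in> A" shows "ck_on 1 (snd c ` fst c) (\<lambda>y. vol_density g c (chart_inv c y))"
  unfolding vol_density_def
proof (rule ck_on_1_real_compose[where \<phi>=sqrt and \<phi>'="\<lambda>u. inverse (sqrt u) / 2"])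
  show "ck_on 1 (snd c ` fst c) (\<lambda>y. det (gram g c (chart_inv c y)))"
    by (rule ck_on_det[OF chart_image_open[OF c] gram_ck[OF c]])
  show "(sqrt has_real_derivative inverse (sqrt (det (gram g c (chart_inv c y)))) / 2) (at (det (gram g c (chart_inv c y))))"
    if "y \<in> snd c ` fst c" for y
    using DERIV_real_sqrt[OF det_gram_pos[OF c chart_inv_in[OF c that]]] by simp
  show "continuous_on ((\<lambda>y. det (gram g c (chart_inv c y))) ` (snd c ` fst c)) (\<lambda>u. inverse (sqrt u) / 2)"
    using det_gram_pos[OF c] c by (auto intro!: continuous_intros simp: less_le)
qed (rule chart_image_open[OF c])

lemma matrix_inv_gram_ck1:
  assumes c: "c \<in> A" shows "ck_on 1 (snd c ` fst c) (\<lambda>y. matrix_inv (gram g c (chart_inv c y)) $ i $ j)"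
proof -
  let ?S = "snd c ` fst c" and ?G = "\<lambda>y. gram g c (chart_inv c y)"
  have S: "open ?S" by (rule chart_image_open[OF c])
  have "ck_on 1 ?S (\<lambda>y. inverse (det (?G y)))"
  proof (rule ck_on_1_real_compose[where \<phi>=inverse and \<phi>'="\<lambda>u. - (inverse u ^ Suc (Suc 0))", OF S])
    show "ck_on 1 ?S (\<lambda>y. det (?G y))" by (rule ck_on_det[OF S gram_ck[OF c]])
    show "(inverse has_real_derivative - (inverse (det (?G y)) ^ Suc (Suc 0))) (at (det (?G y)))"
      if "y \<in> ?S" for y
      by (rule DERIV_inverse) (use det_gram_pos[OF c chart_inv_in[OF c that]] in simp)
    show "continuous_on ((\<lambda>y. det (?G y)) ` ?S) (\<lambda>u. - (inverse u ^ Suc (Suc 0)))"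
      using det_gram_pos[OF c] c by (auto intro!: continuous_intros simp: less_le)
  qed
  moreover have "ck_on 1 ?S (\<lambda>y. det (\<chi> k l. if l = i then (if k = j then 1 else 0) else ?G y $ k $ l))"
  proof (rule ck_on_det[OF S])
    show "ck_on 1 ?S (\<lambda>y. (\<chi> k l. if l = i then (if k = j then 1 else 0) else ?G y $ k $ l) $ a $ b)" for a b
      using gram_ck[OF c, of 1 a b] by (cases "b = i") auto
  qed
  ultimately have *: "ck_on 1 ?S (\<lambda>y. det (\<chi> k l. if l = i then (if k = j then 1 else 0) else ?G y $ k $ l) * inverse (det (?G y)))"
    by (intro ck_on_mult S)
  have "matrix_inv (?G y) $ i $ j = det (\<chi> k l. if l = i then (if k = j then 1 else 0) else ?G y $ k $ l) * inverse (det (?G y))"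
    if "y \<in> ?S" for y
    using matrix_inv_nth[OF gram_invertible[OF c chart_inv_in[OF c that]]] by (simp only: divide_inverse)
  then show ?thesis by (subst ck_on_cong[OF S, where g="\<lambda>y. det (\<chi> k l. if l = i then (if k = j then 1 else 0) else ?G y $ k $ l) * inverse (det (?G y))"])
     (simp_all only: *)
qed

end

section \<open>The Riemannian volume\<close>

text \<open>Monotone convergence, with one of the two sums read as an integral over the counting
  measure.\<close>

lemma suminf_swap_ennreal:
  fixes f :: "nat \<Rightarrow> nat \<Rightarrow> ennreal"
  shows "(\<Sum>i. \<Sum>n. f i n) = (\<Sum>n. \<Sum>i. f i n)"
  using nn_integral_suminf[of "\<lambda>n i. f i n" "count_space UNIV"]
  by (simp add: nn_integral_count_space_nat)

context atlas
begin

lemma chart_inv_image: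
  assumes c: "c \<in> A" and W: "W \<subseteq> snd c ` fst c"
  shows "chart_inv c ` W = fst c \<inter> snd c -` W" and "snd c ` (chart_inv c ` W) = W"
    and "open W \<Longrightarrow> open (chart_inv c ` W)" and "compact W \<Longrightarrow> compact (chart_inv c ` W)"
    and "connected W \<Longrightarrow> connected (chart_inv c ` W)"
proof -
  show eq: "chart_inv c ` W = fst c \<inter> snd c -` W"
  proof
    show "chart_inv c ` W \<subseteq> fst c \<inter> snd c -` W" using W c by auto
    show "fst c \<inter> snd c -` W \<subseteq> chart_inv c ` W"
      using chart_inv_chart[OF c] by (metis IntE image_eqI subsetI vimageD)
  qed
  show "snd c ` (chart_inv c ` W) = W" using W unfolding eq by auto
  show "open W \<Longrightarrow> open (chart_inv c ` W)" unfolding eq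
    by (rule continuous_open_preimage[OF chart_continuous[OF c] chart_open[OF c]])
  show "compact W \<Longrightarrow> compact (chart_inv c ` W)" "connected W \<Longrightarrow> connected (chart_inv c ` W)"
    using continuous_on_subset[OF chart_inv_continuous[OF c] W]
    by (auto intro: compact_continuous_image connected_continuous_image)
qed

end

context riemannian
begin

definition chart_density :: "('m, 'n) chart \<Rightarrow> real ^ 'n \<Rightarrow> real" where
  "chart_density c y = vol_density g c (chart_inv c y)"

definition chart_volume :: "('m, 'n) chart \<Rightarrow> 'm set \<Rightarrow> ennreal" where
  "chart_volume c B = (\<integral>\<^sup>+ y. ennreal (chart_density c y) * indicator (snd c ` B) y \<partial>lborel)"

text \<open>A total version of the inverse chart that is Borel measurable on the whole model space.
  The value off the chart image carries no mass, since the density in \<open>chart_measure\<close>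
  vanishes there.\<close>

definition chart_param :: "('m, 'n) chart \<Rightarrow> real ^ 'n \<Rightarrow> 'm" where
  "chart_param c y = (if y \<in> snd c ` fst c then chart_inv c y else undefined)"

definition chart_measure :: "('m, 'n) chart \<Rightarrow> 'm measure" where
  "chart_measure c =
     distr (density lborel (\<lambda>y. ennreal (indicat_real (snd c ` fst c) y * chart_density c y))) borel (chart_param c)"

text \<open>The condition under the definite description in
  \<open>riemannian_volume\<close>.\<close>

definition is_volume :: "'m measure \<Rightarrow> bool" where
  "is_volume M \<longleftrightarrow> sets M = sets borel \<and>
     (\<forall>c\<in>A. \<forall>B\<in>sets borel. B \<subseteq> fst c \<longrightarrow> emeasure M B = chart_volume c B)"

lemma chart_param_measurable:
  assumes c: "c \<in> A" shows "chart_param c \<in> borel_measurable borel"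
proof (rule borel_measurableI)
  fix S :: "'m set" assume S: "open S"
  have "chart_param c -` S = snd c ` (fst c \<inter> S) \<union> (if undefined \<in> S then - (snd c ` fst c) else {})"
    unfolding set_eq_iff Un_iff chart_image_Int[OF c] by (auto simp: chart_param_def c)
  moreover have "snd c ` (fst c \<inter> S) \<in> sets borel" "- (snd c ` fst c) \<in> sets borel"
    using chart_image_open_Int[OF c S] chart_image_open[OF c] by (auto simp: borel_open)
  ultimately show "chart_param c -` S \<inter> space borel \<in> sets borel" by simp
qed

text \<open>The image under the chart is a preimage under the measurable \<open>chart_param\<close>,
  cut down to the chart image because \<open>undefined\<close> may lie in \<open>B\<close>.\<close>

lemma chart_image_borel:
  assumes c: "c \<in> A" and B: "B \<in> sets borel" shows "snd c ` (fst c \<inter> B) \<in> sets borel"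
proof -
  have "snd c ` (fst c \<inter> B) = (chart_param c -` B \<inter> space borel) \<inter> snd c ` fst c"
    using c by (auto simp: chart_param_def)
  then show ?thesis
    using measurable_sets[OF chart_param_measurable[OF c] B] chart_image_open[OF c] by (simp add: borel_open sets.Int)
qed

lemma chart_density_measurable:
  assumes c: "c \<in> A"
  shows "(\<lambda>y. indicat_real (snd c ` fst c) y * chart_density c y) \<in> borel_measurable borel"
  using borel_measurable_continuous_on_indicator[OF borel_open[OF chart_image_open[OF c]] ck_on_imp_continuous[OF vol_density_ck1[OF c]]]
  by (simp add: chart_density_def)

lemma chart_density_pos: "c \<in> A \<Longrightarrow> y \<in> snd c ` fst c \<Longrightarrow> chart_density c y > 0"
  using vol_density_pos chart_inv_in by (simp add: chart_density_def)

lemma emeasure_chart_measure: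
  assumes c: "c \<in> A" and B: "B \<in> sets borel"
  shows "emeasure (chart_measure c) B = chart_volume c (fst c \<inter> B)"
proof -
  note [measurable] = chart_param_measurable[OF c] chart_density_measurable[OF c] B
  have "emeasure (chart_measure c) B =
      (\<integral>\<^sup>+ y. ennreal (indicat_real (snd c ` fst c) y * chart_density c y) * indicator (chart_param c -` B) y \<partial>lborel)"
    unfolding chart_measure_def using measurable_sets[OF chart_param_measurable[OF c] B]
    by (simp add: emeasure_distr emeasure_density)
  also have "\<dots> = chart_volume c (fst c \<inter> B)"
    unfolding chart_volume_def
    by (rule nn_integral_cong) (use chart_image_Int[OF c] in \<open>auto simp: chart_param_def indicator_def\<close>)
  finally show ?thesis .
qed

text \<open>The densities of two charts differ by the absolute Jacobian determinant of the
  transition map, so the two integrals are related by substitution.\<close>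

lemma chart_volume_change:
  assumes cd: "c \<in> A" "d \<in> A" and B: "B \<in> sets borel" "B \<subseteq> fst c" "B \<subseteq> fst d"
  shows "chart_volume c B = chart_volume d B"
proof -
  let ?\<tau> = "snd d \<circ> chart_inv c" and ?S = "snd c ` B"
  let ?\<tau>' = "\<lambda>y. frechet_derivative ?\<tau> (at y)"
  let ?f = "\<lambda>z. indicat_real (snd d ` B) z * chart_density d z"
  have S: "?S \<in> sets borel" and Sd: "snd d ` B \<in> sets borel"
    using chart_image_borel[OF cd(1) B(1)] chart_image_borel[OF cd(2) B(1)] B by (simp_all add: Int_absorb1)
  have img: "?\<tau> ` ?S = snd d ` B" using cd(1) B(2) by (force simp: image_image)
  have F: "indicat_real ?S y * (\<bar>det (matrix (?\<tau>' y))\<bar> * ?f (?\<tau> y)) = indicat_real ?S y * chart_density c y" for y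
  proof (cases "y \<in> ?S")
    case True
    then obtain x where x: "x \<in> B" "y = snd c x" by blast
    then have "x \<in> fst c" "x \<in> fst d" using B by auto
    then show ?thesis using det_gram_change[OF cd, of x] x cd by (simp add: chart_density_def)
  qed simp
  have meas: "(\<lambda>z. indicat_real (snd e ` B) z * chart_density e z) \<in> borel_measurable borel"
    if e: "e \<in> A" "B \<subseteq> fst e" "snd e ` B \<in> sets borel" for e
  proof -
    note [measurable] = chart_density_measurable[OF e(1)] e(3)
    have "(\<lambda>z. indicat_real (snd e ` B) z * (indicat_real (snd e ` fst e) z * chart_density e z)) \<in> borel_measurable borel"
      by measurable
    moreover have "indicat_real (snd e ` B) z * (indicat_real (snd e ` fst e) z * chart_density e z) = indicat_real (snd e ` B) z * chart_density e z" for z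
      using e(2) by (auto simp: indicator_def)
    ultimately show ?thesis by simp
  qed
  have "(\<integral>\<^sup>+y. ennreal (indicat_real ?S y * (\<bar>det (matrix (?\<tau>' y))\<bar> * ?f (?\<tau> y))) \<partial>lborel) = (\<integral>\<^sup>+z. ennreal (?f z) \<partial>lborel)"
  proof (rule nn_integral_change_of_variables[OF S])
    show "(?\<tau> has_derivative ?\<tau>' y) (at y within ?S)" if "y \<in> ?S" for y
      using transition_has_derivative[OF cd] that B by (auto intro: has_derivative_at_withinI)
    show "inj_on ?\<tau> ?S"
    proof (rule inj_onI, clarsimp)
      fix x x' assume "x \<in> B" "x' \<in> B" "snd d (chart_inv c (snd c x)) = snd d (chart_inv c (snd c x'))"
      moreover from this have "x \<in> fst c" "x' \<in> fst c" "x \<in> fst d" "x' \<in> fst d" using B by auto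
      ultimately have "snd d x = snd d x'" using cd by simp
      then show "snd c x = snd c x'" using chart_inv_chart[OF cd(2)] \<open>x \<in> fst d\<close> \<open>x' \<in> fst d\<close> by metis
    qed
    show "?f z \<ge> 0" for z
      using chart_density_pos[OF cd(2), of z] B by (auto simp: indicator_def intro: less_imp_le)
    show "?f z = 0" if "z \<notin> ?\<tau> ` ?S" for z using that unfolding img by simp
    show "?f \<in> borel_measurable borel" by (rule meas[OF cd(2) B(3) Sd])
    show "(\<lambda>y. indicat_real ?S y * (\<bar>det (matrix (?\<tau>' y))\<bar> * ?f (?\<tau> y))) \<in> borel_measurable borel"
      unfolding F by (rule meas[OF cd(1) B(2) S])
  qed
  then have "(\<integral>\<^sup>+y. ennreal (indicat_real ?S y * chart_density c y) \<partial>lborel) = (\<integral>\<^sup>+z. ennreal (?f z) \<partial>lborel)"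
    unfolding F .
  moreover have "chart_volume e B = (\<integral>\<^sup>+y. ennreal (indicat_real (snd e ` B) y * chart_density e y) \<partial>lborel)" for e
    unfolding chart_volume_def by (rule nn_integral_cong) (auto simp: indicator_def)
  ultimately show ?thesis by simp
qed

section \<open>Existence and uniqueness of the volume measure\<close>

lemma countable_charts: "\<exists>C :: nat \<Rightarrow> ('m, 'n) chart. range C \<subseteq> A \<and> (\<Union>n. fst (C n)) = UNIV"
proof -
  obtain F where F: "F \<subseteq> fst ` A" "countable F" "\<Union>F = \<Union>(fst ` A)"
    by (rule Lindelof[of "fst ` A"]) (use chart_open in auto)
  have cover: "\<Union>F = UNIV" using F(3) chart_ex by auto
  then have "F \<noteq> {}" by auto
  then have r: "range (from_nat_into F) = F" using F(2) by (rule range_from_nat_into)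
  have "\<exists>c\<in>A. fst c = from_nat_into F n" for n
    using F(1) r by (metis (no_types, lifting) imageE rangeI subsetD)
  then obtain C where C: "\<And>n. C n \<in> A" "\<And>n. fst (C n) = from_nat_into F n" by metis
  then have "(\<Union>n. fst (C n)) = UNIV" using cover r by simp
  then show ?thesis using C(1) by blast
qed

text \<open>Countably many charts suffice by the Lindelof property, and removing from each the
  earlier ones leaves disjoint Borel pieces. For measures these pieces do the work of a partition of
  unity: countable additivity reduces every Borel set to parts inside one chart.\<close>

lemma borel_chart_partition:
  "\<exists>C D :: nat \<Rightarrow> 'm set. (\<forall>n. C n \<in> A \<and> D n \<in> sets borel \<and> D n \<subseteq> fst (C n)) \<and>
     (\<forall>B. disjoint_family (\<lambda>n. B \<inter> D n)) \<and> (\<Union>n. D n) = UNIV"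
proof -
  obtain C :: "nat \<Rightarrow> ('m, 'n) chart" where C: "range C \<subseteq> A" "(\<Union>n. fst (C n)) = UNIV"
    using countable_charts by blast
  let ?D = "disjointed (\<lambda>n. fst (C n))"
  have "range ?D \<subseteq> sets borel"
    by (rule sets.range_disjointed_sets) (use C(1) in \<open>auto intro!: borel_open chart_open\<close>)
  moreover have "?D n \<subseteq> fst (C n)" for n by (rule disjointed_subset)
  moreover have "disjoint_family (\<lambda>n. B \<inter> ?D n)" for B
    using disjoint_family_disjointed[of "\<lambda>n. fst (C n)"] unfolding disjoint_family_on_def by blast
  moreover have "(\<Union>n. ?D n) = UNIV" using C(2) UN_disjointed_eq[of "\<lambda>n. fst (C n)"] by simp
  ultimately show ?thesis using C(1) by (intro exI[of _ C] exI[of _ ?D]) auto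
qed

lemma is_volume_unique:
  assumes M: "is_volume M" and M': "is_volume M'" shows "M = M'"
proof (rule measure_eqI)
  show sets: "sets M = sets M'" using M M' by (simp add: is_volume_def)
  obtain C and D :: "nat \<Rightarrow> 'm set" where CA: "\<And>n. C n \<in> A" and D: "\<And>n. D n \<in> sets borel" "\<And>n. D n \<subseteq> fst (C n)"
    and disj: "\<And>B. disjoint_family (\<lambda>n. B \<inter> D n)" and UD: "(\<Union>n. D n) = UNIV"
    using borel_chart_partition by metis
  fix B assume "B \<in> sets M"
  then have B: "B \<in> sets borel" using M by (simp add: is_volume_def)
  have "emeasure N B = (\<Sum>n. chart_volume (C n) (B \<inter> D n))" if N: "is_volume N" for N
  proof -
    have "(\<Sum>n. emeasure N (B \<inter> D n)) = emeasure N (\<Union>n. B \<inter> D n)"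
    proof (rule suminf_emeasure)
      show "range (\<lambda>n. B \<inter> D n) \<subseteq> sets N" using N B D(1) by (auto simp: is_volume_def)
      show "disjoint_family (\<lambda>n. B \<inter> D n)" by (rule disj)
    qed
    moreover have "(\<Union>n. B \<inter> D n) = B" using UD by auto
    moreover have "emeasure N (B \<inter> D n) = chart_volume (C n) (B \<inter> D n)" for n
    proof -
      have "C n \<in> A" "B \<inter> D n \<in> sets borel" "B \<inter> D n \<subseteq> fst (C n)" using CA B D[of n] by auto
      then show ?thesis using N unfolding is_volume_def by simp
    qed
    ultimately show ?thesis by simp
  qed
  then show "emeasure M B = emeasure M' B" using M M' by simp
qed

lemma is_volume_exists: "\<exists>M. is_volume M"
proof -
  obtain C and D :: "nat \<Rightarrow> 'm set" where CA: "\<And>n. C n \<in> A" and D: "\<And>n. D n \<in> sets borel" "\<And>n. D n \<subseteq> fst (C n)"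
    and disj: "\<And>B. disjoint_family (\<lambda>n. B \<inter> D n)" and UD: "(\<Union>n. D n) = UNIV"
    using borel_chart_partition by metis
  \<comment> \<open>Each piece is measured in the chart assigned to it;
    \<open>chart_volume_change\<close> shows that any other chart around a piece gives the same
    value.\<close>
  define \<mu> where "\<mu> B = (\<Sum>n. emeasure (chart_measure (C n)) (B \<inter> D n))" for B
  define M where "M = measure_of UNIV (sets borel) \<mu>"
  have sets_cm: "sets (chart_measure c) = sets borel" for c by (simp add: chart_measure_def)
  have sets_M: "sets M = sets borel"
    unfolding M_def using sets.sigma_sets_eq[of "borel :: 'm measure"] by (simp add: sets_measure_of)
  have emeasure_M: "emeasure M B = \<mu> B" if B: "B \<in> sets borel" for B
    unfolding M_def
  proof (rule emeasure_measure_of_sigma)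
    show "sigma_algebra UNIV (sets (borel :: 'm measure))"
      using sets.sigma_algebra_axioms[of "borel :: 'm measure"] by simp
    show "positive (sets borel) \<mu>" by (simp add: positive_def \<mu>_def)
    show "countably_additive (sets borel) \<mu>"
    proof (rule countably_additiveI)
      fix F :: "nat \<Rightarrow> 'm set" assume F: "range F \<subseteq> sets borel" "disjoint_family F"
      have "(\<Sum>i. emeasure (chart_measure (C n)) (F i \<inter> D n)) = emeasure (chart_measure (C n)) (\<Union>(range F) \<inter> D n)" for n
      proof -
        have "(\<Sum>i. emeasure (chart_measure (C n)) (F i \<inter> D n)) = emeasure (chart_measure (C n)) (\<Union>i. F i \<inter> D n)"
          by (rule suminf_emeasure) (use F D(1) in \<open>auto simp: sets_cm disjoint_family_on_def\<close>)
        then show ?thesis by (simp add: Int_commute)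
      qed
      then show "(\<Sum>i. \<mu> (F i)) = \<mu> (\<Union>(range F))"
        unfolding \<mu>_def by (subst suminf_swap_ennreal) simp
    qed
  qed (rule B)
  have "emeasure M B = chart_volume c B" if c: "c \<in> A" and B: "B \<in> sets borel" "B \<subseteq> fst c" for c B
  proof -
    have "emeasure (chart_measure (C n)) (B \<inter> D n) = emeasure (chart_measure c) (B \<inter> D n)" for n
    proof -
      have BD: "B \<inter> D n \<in> sets borel" "fst c \<inter> (B \<inter> D n) = B \<inter> D n" "fst (C n) \<inter> (B \<inter> D n) = B \<inter> D n"
        using B D[of n] by auto
      have "chart_volume (C n) (B \<inter> D n) = chart_volume c (B \<inter> D n)"
        by (rule chart_volume_change[OF CA c BD(1)]) (use B D in auto)
      then show ?thesis using emeasure_chart_measure[OF _ BD(1)] c CA BD by simp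
    qed
    then have "emeasure M B = (\<Sum>n. emeasure (chart_measure c) (B \<inter> D n))"
      using emeasure_M[OF B(1)] by (simp add: \<mu>_def)
    also have "\<dots> = emeasure (chart_measure c) (\<Union>n. B \<inter> D n)"
      by (rule suminf_emeasure) (use B D(1) disj in \<open>auto simp: sets_cm\<close>)
    also have "(\<Union>n. B \<inter> D n) = B" using UD by auto
    also have "emeasure (chart_measure c) B = chart_volume c B"
      using emeasure_chart_measure[OF c B(1)] B(2) by (simp add: Int_absorb1)
    finally show ?thesis .
  qed
  then show ?thesis using sets_M unfolding is_volume_def by blast
qed

abbreviation vol :: "'m measure" where "vol \<equiv> riemannian_volume A g"

lemma is_volume_vol: "is_volume vol"
proof -
  have "riemannian_volume A g = (THE M. is_volume M)"
    unfolding riemannian_volume_def is_volume_def chart_volume_def chart_density_def ..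
  moreover have "\<exists>!M. is_volume M" using is_volume_exists is_volume_unique by blast
  ultimately show ?thesis using theI' by metis
qed

lemma sets_vol [simp, measurable_cong]: "sets vol = sets borel"
  using is_volume_vol by (simp add: is_volume_def)

lemma space_vol [simp]: "space vol = UNIV"
  using sets_eq_imp_space_eq[OF sets_vol] by simp

lemma emeasure_vol: "c \<in> A \<Longrightarrow> B \<in> sets borel \<Longrightarrow> B \<subseteq> fst c \<Longrightarrow> emeasure vol B = chart_volume c B"
  using is_volume_vol by (simp add: is_volume_def)

section \<open>Finiteness on compact sets and integration in a chart\<close>

lemma vol_finite_nbhd: "\<exists>W. open W \<and> x \<in> W \<and> emeasure vol W < \<infinity>"
proof -
  obtain c where c: "c \<in> A" "x \<in> fst c" using chart_ex by blast
  obtain r where r: "r > 0" "cball (snd c x) r \<subseteq> snd c ` fst c"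
    using open_contains_cball[THEN iffD1, OF chart_image_open[OF c(1)]] c by blast
  let ?b = "ball (snd c x) r" and ?cb = "cball (snd c x) r"
  let ?W = "chart_inv c ` ?b"
  have b: "?b \<subseteq> snd c ` fst c" using r(2) ball_subset_cball by blast
  note W = chart_inv_image(1)[OF c(1) b] and img = chart_inv_image(2)[OF c(1) b]
  have "open ?W" by (rule chart_inv_image(3)[OF c(1) b open_ball])
  have "continuous_on ?cb (chart_density c)"
    unfolding chart_density_def
    by (rule continuous_on_subset[OF ck_on_imp_continuous[OF vol_density_ck1[OF c(1)]] r(2)])
  then have "bounded (chart_density c ` ?cb)"
    by (intro compact_imp_bounded compact_continuous_image compact_cball)
  then obtain M where "\<forall>z\<in>chart_density c ` ?cb. norm z \<le> M" unfolding bounded_iff by blast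
  then have M: "\<And>y. y \<in> ?cb \<Longrightarrow> chart_density c y \<le> M" by (auto dest: abs_le_D1)
  have "emeasure vol ?W = chart_volume c ?W"
    using \<open>open ?W\<close> W by (intro emeasure_vol c borel_open) auto
  also have "\<dots> \<le> (\<integral>\<^sup>+ y. ennreal M * indicator ?cb y \<partial>lborel)"
    unfolding chart_volume_def img
    by (rule nn_integral_mono) (use M in \<open>auto simp: indicator_def intro: ennreal_leI\<close>)
  also have "\<dots> = ennreal M * emeasure lborel ?cb"
    by (simp add: nn_integral_cmult_indicator)
  also have "\<dots> < \<infinity>" using emeasure_lborel_cball_finite ennreal_mult_less_top by auto
  finally show ?thesis using \<open>open ?W\<close> c r(1) by (intro exI[of _ ?W]) (auto simp: W)
qed

lemma vol_compact_finite:
  assumes K: "compact K" shows "emeasure vol K < \<infinity>"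
proof -
  have "\<exists>W. \<forall>x. open (W x) \<and> x \<in> W x \<and> emeasure vol (W x) < \<infinity>"
    using vol_finite_nbhd by metis
  then obtain W where W: "\<And>x. open (W x)" "\<And>x. x \<in> W x" "\<And>x. emeasure vol (W x) < \<infinity>" by blast
  obtain I where I: "finite I" "K \<subseteq> (\<Union>x\<in>I. W x)"
    by (rule compactE_image[OF K, of UNIV W]) (use W(1,2) in blast)+
  have "emeasure vol K \<le> emeasure vol (\<Union>x\<in>I. W x)"
    by (rule emeasure_mono[OF I(2)]) (use W(1) in \<open>auto intro: borel_open\<close>)
  also have "\<dots> \<le> (\<Sum>x\<in>I. emeasure vol (W x))"
    by (rule emeasure_subadditive_finite[OF I(1)]) (use W(1) in \<open>auto intro: borel_open\<close>)
  also have "\<dots> < \<infinity>" using W(3) I(1) by (simp add: less_top)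
  finally show ?thesis .
qed

text \<open>Restricted to a chart domain the volume is the image of a Lebesgue density, so integrals
  over subsets of the chart become Lebesgue integrals by the rules for \<open>distr\<close> and
  \<open>density\<close>.\<close>

lemma density_vol_chart:
  assumes c: "c \<in> A" shows "density vol (indicator (fst c)) = chart_measure c"
proof (rule measure_eqI)
  show "sets (density vol (indicator (fst c))) = sets (chart_measure c)"
    by (simp add: chart_measure_def)
  fix B assume "B \<in> sets (density vol (indicator (fst c)))"
  then have B: "B \<in> sets borel" by simp
  have Uc: "fst c \<in> sets borel" using chart_open[OF c] by (rule borel_open)
  have "emeasure (density vol (indicator (fst c))) B = (\<integral>\<^sup>+x. indicator (fst c \<inter> B) x \<partial>vol)"
    using B Uc by (simp add: emeasure_density indicator_inter_arith)
  also have "\<dots> = emeasure vol (fst c \<inter> B)" using B Uc by (simp add: sets.Int)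
  also have "\<dots> = emeasure (chart_measure c) B"
    using B Uc by (simp add: emeasure_chart_measure[OF c B] emeasure_vol[OF c] sets.Int)
  finally show "emeasure (density vol (indicator (fst c))) B = emeasure (chart_measure c) B" .
qed

lemma integral_vol_chart:
  fixes f :: "'m \<Rightarrow> real"
  assumes c: "c \<in> A" and S: "S \<in> sets borel" "S \<subseteq> fst c"
    and f: "(\<lambda>x. indicator S x * f x) \<in> borel_measurable borel"
  shows "(LINT x:S|vol. f x) = (LINT y|lborel. indicator (snd c ` S) y * (chart_density c y * f (chart_inv c y)))"
proof -
  have Uc: "fst c \<in> sets borel" using chart_open[OF c] by (rule borel_open)
  note [measurable] = f Uc chart_param_measurable[OF c] chart_density_measurable[OF c]
  let ?f = "\<lambda>x. indicator S x * f x"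
  have "(LINT x:S|vol. f x) = (LINT x|vol. indicator (fst c) x *\<^sub>R ?f x)"
    unfolding set_lebesgue_integral_def
    by (rule Bochner_Integration.integral_cong) (use S(2) in \<open>auto simp: indicator_def\<close>)
  also have "\<dots> = (LINT x|density vol (\<lambda>x. ennreal (indicator (fst c) x)). ?f x)"
    by (rule integral_density[symmetric]) auto
  also have "\<dots> = (LINT x|chart_measure c. ?f x)"
    by (simp add: density_vol_chart[OF c, symmetric] ennreal_indicator)
  also have "\<dots> = (LINT y|lborel. (indicat_real (snd c ` fst c) y * chart_density c y) *\<^sub>R ?f (chart_param c y))"
  proof -
    have "AE y in lborel. 0 \<le> indicat_real (snd c ` fst c) y * chart_density c y"
      using chart_density_pos[OF c] by (intro AE_I2) (auto simp: indicator_def intro: less_imp_le)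
    then show ?thesis unfolding chart_measure_def
      by (subst integral_distr) (simp_all add: integral_density)
  qed
  also have "\<dots> = (LINT y|lborel. indicator (snd c ` S) y * (chart_density c y * f (chart_inv c y)))"
    unfolding indicator_def using chart_image_Int[OF c, of _ S] S(2)
    by (intro Bochner_Integration.integral_cong refl)
      (simp add: chart_param_def Int_absorb1 of_bool_def)
  finally show ?thesis .
qed

end

section \<open>Bundles with metric and connection\<close>

text \<open>The bound at 0 forces \<open>f 0 = 0\<close>, so the difference quotient is at most
  \<open>C * \<bar>t\<bar>\<close> in absolute value.\<close>

lemma has_real_derivative_quadratic_bound:
  fixes f :: "real \<Rightarrow> real"
  assumes "d > 0" and b: "\<And>t. \<bar>t\<bar> < d \<Longrightarrow> \<bar>f t\<bar> \<le> C * t\<^sup>2"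
  shows "(f has_real_derivative 0) (at 0)"
proof -
  have f0: "f 0 = 0" using b[of 0] assms(1) by simp
  have "((\<lambda>y. f y / y) \<longlongrightarrow> 0) (at 0)"
  proof (rule Lim_null_comparison)
    have "norm (f y / y) \<le> C * \<bar>y\<bar>" if "\<bar>y\<bar> < d" "y \<noteq> 0" for y
      using b[OF that(1)] that(2) by (simp add: field_simps power2_eq_square)
    then show "\<forall>\<^sub>F y in at 0. norm (f y / y) \<le> C * \<bar>y\<bar>"
      using assms(1) by (auto simp: eventually_at intro!: exI[of _ d])
    show "((\<lambda>y. C * \<bar>y\<bar>) \<longlongrightarrow> 0) (at 0)" by (intro tendsto_mult_right_zero tendsto_rabs_zero tendsto_ident_at)
  qed
  then show ?thesis by (simp add: has_field_derivative_iff f0)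
qed

text \<open>Mean value inequality in the first variable: a bound for that partial derivative on a
  compact product serves all \<open>y\<close> at once.\<close>

lemma ck_on_1_lipschitz_fst:
  fixes w :: "real \<times> 'a::euclidean_space \<Rightarrow> real"
  assumes S: "open S" and w: "ck_on 1 S w" and P: "{-d..d} \<times> C \<subseteq> S" and C: "compact C"
  shows "\<exists>L\<ge>0. \<forall>t\<in>{-d..d}. \<forall>y\<in>C. \<bar>w (t, y) - w (0, y)\<bar> \<le> L * \<bar>t\<bar>"
proof -
  let ?D = "\<lambda>z. frechet_derivative w (at z) (1, 0)"
  have "continuous_on ({-d..d} \<times> C) ?D"
    using w by (intro continuous_on_subset[OF _ P]) simp
  then have "bounded (?D ` ({-d..d} \<times> C))"
    by (intro compact_imp_bounded compact_continuous_image compact_Times C compact_Icc)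
  then obtain L where L: "\<forall>z\<in>{-d..d} \<times> C. norm (?D z) \<le> L" unfolding bounded_iff by blast
  have "\<bar>w (t, y) - w (0, y)\<bar> \<le> \<bar>L\<bar> * \<bar>t\<bar>" if t: "t \<in> {-d..d}" and y: "y \<in> C" for t y
  proof -
    have der: "((\<lambda>t. w (t, y)) has_field_derivative ?D (s, y)) (at s within {-d..d})" if s: "s \<in> {-d..d}" for s
    proof -
      have z: "(s, y) \<in> S" using P s y by auto
      have w': "(w has_derivative frechet_derivative w (at (s, y))) (at (s, y))"
        using w z by (auto simp: frechet_derivative_works)
      have "((\<lambda>t. (t, y)) has_derivative (\<lambda>h. (h, 0))) (at s within {-d..d})"
        by (auto intro!: derivative_eq_intros)
      from has_derivative_compose[OF this w']
      have 1: "((\<lambda>t. w (t, y)) has_derivative (\<lambda>h. frechet_derivative w (at (s, y)) (h, 0))) (at s within {-d..d})" .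
      have 2: "frechet_derivative w (at (s, y)) (h, 0) = ?D (s, y) * h" for h
        using linear_scale[OF has_derivative_linear[OF w'], of h "(1, 0)"] by (simp add: mult.commute)
      from 1 show ?thesis unfolding has_field_derivative_def
        by (rule has_derivative_eq_rhs) (rule ext, rule 2)
    qed
    have "norm (w (t, y) - w (0, y)) \<le> \<bar>L\<bar> * norm (t - 0)"
    proof (rule field_differentiable_bound[OF _ der])
      show "norm (?D (s, y)) \<le> \<bar>L\<bar>" if "s \<in> {-d..d}" for s using bspec[OF L, of "(s, y)"] that y by simp
    qed (use t in auto)
    then show ?thesis by simp
  qed
  then show ?thesis by (intro exI[of _ "\<bar>L\<bar>"]) auto
qed

lemma continuous_on_compact_abs_bound:
  fixes f :: "'a::topological_space \<Rightarrow> real"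
  assumes "compact C" "continuous_on C f"
  shows "\<exists>B\<ge>0. \<forall>x\<in>C. \<bar>f x\<bar> \<le> B"
proof -
  have "bounded (f ` C)" by (intro compact_imp_bounded compact_continuous_image assms)
  then obtain B where "\<forall>y\<in>f ` C. norm y \<le> B" unfolding bounded_iff by blast
  then show ?thesis by (intro exI[of _ "\<bar>B\<bar>"]) fastforce
qed

locale metric_bundle = riemannian A g
  for A :: "('m::{t2_space, second_countable_topology}, 'n::finite) chart set" and g :: "'m metric" +
  fixes E :: "'m \<Rightarrow> 'f::real_vector set" and T :: "('m, 'f, 'k::finite) triv set"
    and h :: "('m, 'f) fmetric" and nabla :: "('m, 'f) cov_deriv"
  assumes vect: "vector_bundle A E T" and fibre: "fibre_metric A E T h"
    and conn: "connection A E T nabla" and metric_conn: "metric_connection A E T h nabla"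
begin

lemma fibre_subspace: "subspace (E x)"
  and triv_ex: "\<exists>t\<in>T. x \<in> fst t"
  and triv_open: "t \<in> T \<Longrightarrow> open (fst t)"
  and triv_bij: "t \<in> T \<Longrightarrow> x \<in> fst t \<Longrightarrow> bij_betw (snd t x) (E x) UNIV"
  and triv_lin: "t \<in> T \<Longrightarrow> x \<in> fst t \<Longrightarrow> u \<in> E x \<Longrightarrow> v \<in> E x \<Longrightarrow>
    snd t x (a *\<^sub>R u + b *\<^sub>R v) = a *\<^sub>R snd t x u + b *\<^sub>R snd t x v"
  and triv_smooth: "s \<in> T \<Longrightarrow> t \<in> T \<Longrightarrow> smooth_map_on A (fst s \<inter> fst t) (\<lambda>x. snd t x (triv_inv E s x w))"
  using vect unfolding vector_bundle_def by (blast, blast, blast, blast, blast, blast)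

lemma triv_inv_in: "t \<in> T \<Longrightarrow> x \<in> fst t \<Longrightarrow> triv_inv E t x w \<in> E x"
  using triv_bij[of t x] by (simp add: triv_inv_def bij_betw_def inv_into_into)

lemma triv_triv_inv [simp]: "t \<in> T \<Longrightarrow> x \<in> fst t \<Longrightarrow> snd t x (triv_inv E t x w) = w"
  using triv_bij[of t x] by (simp add: triv_inv_def bij_betw_def f_inv_into_f)

lemma triv_inj: "t \<in> T \<Longrightarrow> x \<in> fst t \<Longrightarrow> u \<in> E x \<Longrightarrow> v \<in> E x \<Longrightarrow> snd t x u = snd t x v \<Longrightarrow> u = v"
  using triv_bij[of t x] by (metis bij_betw_def inj_onD)

lemma fibre_0 [simp]: "0 \<in> E x" and fibre_add: "u \<in> E x \<Longrightarrow> v \<in> E x \<Longrightarrow> u + v \<in> E x"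
  and fibre_scale: "u \<in> E x \<Longrightarrow> a *\<^sub>R u \<in> E x"
  using fibre_subspace subspace_0 subspace_add subspace_scale by blast+

lemma fibre_sum: "(\<And>i. i \<in> I \<Longrightarrow> u i \<in> E x) \<Longrightarrow> (\<Sum>i\<in>I. u i) \<in> E x"
  using fibre_subspace by (rule subspace_sum)

lemma triv_0: "t \<in> T \<Longrightarrow> x \<in> fst t \<Longrightarrow> snd t x 0 = 0"
  using triv_lin[of t x 0 0 0 0] by simp

lemma triv_scale: "t \<in> T \<Longrightarrow> x \<in> fst t \<Longrightarrow> u \<in> E x \<Longrightarrow> snd t x (a *\<^sub>R u) = a *\<^sub>R snd t x u"
  using triv_lin[of t x u u a 0] by simp

lemma triv_add: "t \<in> T \<Longrightarrow> x \<in> fst t \<Longrightarrow> u \<in> E x \<Longrightarrow> v \<in> E x \<Longrightarrow> snd t x (u + v) = snd t x u + snd t x v"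
  using triv_lin[of t x u v 1 1] by simp

lemma triv_sum:
  assumes t: "t \<in> T" "x \<in> fst t" and u: "\<And>i. i \<in> I \<Longrightarrow> u i \<in> E x"
  shows "snd t x (\<Sum>i\<in>I. u i) = (\<Sum>i\<in>I. snd t x (u i))"
  using u by (induction I rule: infinite_finite_induct) (simp_all add: triv_0[OF t] triv_add[OF t] fibre_sum)

lemma triv_expansion:
  assumes t: "t \<in> T" "x \<in> fst t" and u: "u \<in> E x"
  shows "u = (\<Sum>a\<in>UNIV. (snd t x u $ a) *\<^sub>R triv_inv E t x (axis a 1))"
proof (rule triv_inj[OF t u])
  show "(\<Sum>a\<in>UNIV. (snd t x u $ a) *\<^sub>R triv_inv E t x (axis a 1)) \<in> E x"
    by (intro fibre_sum fibre_scale triv_inv_in t)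
  have "snd t x (\<Sum>a\<in>UNIV. (snd t x u $ a) *\<^sub>R triv_inv E t x (axis a 1)) = (\<Sum>a\<in>UNIV. (snd t x u $ a) *\<^sub>R axis a 1)"
    by (subst triv_sum[OF t]) (simp_all only: fibre_scale triv_inv_in[OF t] triv_scale[OF t triv_inv_in[OF t]] triv_triv_inv[OF t])
  also have "\<dots> = snd t x u" using basis_expansion[of "snd t x u"] by (simp add: scalar_mult_eq_scaleR)
  finally show "snd t x u = snd t x (\<Sum>a\<in>UNIV. (snd t x u $ a) *\<^sub>R triv_inv E t x (axis a 1))" by simp
qed

lemma h_sym: "u \<in> E x \<Longrightarrow> v \<in> E x \<Longrightarrow> h x u v = h x v u"
  and h_lin: "u \<in> E x \<Longrightarrow> v \<in> E x \<Longrightarrow> w \<in> E x \<Longrightarrow> h x (a *\<^sub>R u + b *\<^sub>R v) w = a * h x u w + b * h x v w"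
  and h_pos: "u \<in> E x \<Longrightarrow> u \<noteq> 0 \<Longrightarrow> h x u u > 0"
  and h_smooth: "t \<in> T \<Longrightarrow> smooth_map_on A (fst t) (\<lambda>x. h x (triv_inv E t x v') (triv_inv E t x w'))"
  using fibre unfolding fibre_metric_def by (blast, blast, blast, blast)

lemma h_lin2: "u \<in> E x \<Longrightarrow> v \<in> E x \<Longrightarrow> w \<in> E x \<Longrightarrow> h x w (a *\<^sub>R u + b *\<^sub>R v) = a * h x w u + b * h x w v"
  using h_lin h_sym fibre_add fibre_scale by metis

lemma h_0: "u \<in> E x \<Longrightarrow> h x 0 u = 0" "u \<in> E x \<Longrightarrow> h x u 0 = 0"
  using h_lin[of 0 x 0 u 0 0] h_lin2[of 0 x 0 u 0 0] by simp_all

lemma h_nonneg: "u \<in> E x \<Longrightarrow> h x u u \<ge> 0"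
  using h_pos[of u x] h_0[of 0 x] by (cases "u = 0") auto

lemma h_eq_0: "u \<in> E x \<Longrightarrow> h x u u = 0 \<Longrightarrow> u = 0"
  using h_pos by fastforce

lemma h_scale: "u \<in> E x \<Longrightarrow> v \<in> E x \<Longrightarrow> h x (a *\<^sub>R u) (b *\<^sub>R v) = a * b * h x u v"
  using h_lin[of u x u "b *\<^sub>R v" a 0] h_lin2[of v x v u b 0] by (simp add: fibre_scale)

lemma h_cauchy_schwarz:
  assumes u: "u \<in> E x" and v: "v \<in> E x" shows "(h x u v)\<^sup>2 \<le> h x u u * h x v v"
proof (cases "v = 0")
  case True then show ?thesis by (simp add: h_0 u)
next
  case False
  then have p: "h x v v > 0" by (rule h_pos[OF v])
  \<comment> \<open>The part of \<open>u\<close> orthogonal to \<open>v\<close>, scaled by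
    \<open>h x v v\<close> to avoid a division; its squared norm is \<open>h x v v\<close> times the
    defect in the inequality.\<close>
  let ?w = "h x v v *\<^sub>R u + (- h x u v) *\<^sub>R v"
  have w: "?w \<in> E x" by (intro fibre_add fibre_scale u v)
  have "0 \<le> h x ?w ?w" by (rule h_nonneg[OF w])
  also have "h x ?w ?w = h x v v * (h x u u * h x v v - (h x u v)\<^sup>2)"
    unfolding h_lin[OF u v w] h_lin2[OF u v u] h_lin2[OF u v v] h_sym[OF v u]
    by (simp add: algebra_simps power2_eq_square)
  finally show ?thesis using p by (simp add: zero_le_mult_iff)
qed

lemma h_sum_left: "(\<And>i. i \<in> I \<Longrightarrow> u i \<in> E x) \<Longrightarrow> v \<in> E x \<Longrightarrow> h x (\<Sum>i\<in>I. u i) v = (\<Sum>i\<in>I. h x (u i) v)"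
proof (induction I rule: infinite_finite_induct)
  case (insert i I)
  then show ?case using h_lin[of "u i" x "\<Sum>i\<in>I. u i" v 1 1] by (simp add: fibre_sum)
qed (simp_all add: h_0)

lemma h_triv:
  assumes t: "t \<in> T" "x \<in> fst t" and u: "u \<in> E x" and v: "v \<in> E x"
  shows "h x u v = (\<Sum>a\<in>UNIV. \<Sum>b\<in>UNIV. snd t x u $ a * snd t x v $ b * h x (triv_inv E t x (axis a 1)) (triv_inv E t x (axis b 1)))"
proof -
  let ?e = "\<lambda>a. triv_inv E t x (axis a 1)"
  have e: "?e a \<in> E x" for a by (rule triv_inv_in[OF t])
  have exp: "h x w z = (\<Sum>a\<in>UNIV. snd t x w $ a * h x (?e a) z)" if w: "w \<in> E x" and z: "z \<in> E x" for w z
  proof -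
    have "h x w z = h x (\<Sum>a\<in>UNIV. (snd t x w $ a) *\<^sub>R ?e a) z" using triv_expansion[OF t w] by simp
    also have "\<dots> = (\<Sum>a\<in>UNIV. h x ((snd t x w $ a) *\<^sub>R ?e a) z)" by (rule h_sum_left) (auto intro: fibre_scale e z)
    also have "\<dots> = (\<Sum>a\<in>UNIV. snd t x w $ a * h x (?e a) z)"
      using h_scale[OF e z, of _ _ 1] by simp
    finally show ?thesis .
  qed
  have "h x u v = (\<Sum>a\<in>UNIV. snd t x u $ a * h x v (?e a))" using exp[OF u v] h_sym[OF v e] by simp
  also have "\<dots> = (\<Sum>a\<in>UNIV. snd t x u $ a * (\<Sum>b\<in>UNIV. snd t x v $ b * h x (?e a) (?e b)))"
    using exp[OF v e] h_sym[OF e e] by simp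
  finally show ?thesis by (simp add: sum_distrib_left mult.assoc)
qed

section \<open>Smooth sections\<close>

lemma section_in: "smooth_section A E T \<sigma> \<Longrightarrow> \<sigma> x \<in> E x"
  by (simp add: smooth_section_on_def)

lemma section_smooth: "smooth_section_on A E T U \<sigma> \<Longrightarrow> t \<in> T \<Longrightarrow> smooth_map_on A (fst t \<inter> U) (\<lambda>x. snd t x (\<sigma> x))"
  by (simp add: smooth_section_on_def)

lemma smooth_map_on_nth:
  assumes "open U" "smooth_map_on A U (f :: 'm \<Rightarrow> real ^ 'j::finite)" shows "smooth_map_on A U (\<lambda>x. f x $ i)"
  by (rule smooth_map_onI) (intro ck_on_nth chart_image_open_Int smooth_map_on_ck assms)

lemma smooth_map_on_sum:
  assumes "open U" "\<And>i. i \<in> I \<Longrightarrow> smooth_map_on A U (f i)"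
  shows "smooth_map_on A U (\<lambda>x. \<Sum>i\<in>I. f i x)"
  by (rule smooth_map_onI) (intro ck_on_sum chart_image_open_Int smooth_map_on_ck assms)

lemma smooth_map_on_local:
  assumes "\<And>x. x \<in> U \<Longrightarrow> \<exists>V. open V \<and> x \<in> V \<and> V \<subseteq> U \<and> smooth_map_on A V f"
  shows "smooth_map_on A U f"
proof (rule smooth_map_onI)
  fix c k assume c: "c \<in> A"
  obtain V where V: "\<And>x. x \<in> U \<Longrightarrow> open (V x) \<and> x \<in> V x \<and> V x \<subseteq> U \<and> smooth_map_on A (V x) f"
    using assms by metis
  have eq: "snd c ` (fst c \<inter> U) = (\<Union>x\<in>U. snd c ` (fst c \<inter> V x))" using V by blast
  have "ck_on k (\<Union>x\<in>U. snd c ` (fst c \<inter> V x)) F"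
    if "\<And>x. x \<in> U \<Longrightarrow> ck_on k (snd c ` (fst c \<inter> V x)) F" for F :: "real ^ 'n \<Rightarrow> 'z::real_normed_vector"
    using that
  proof (induction k arbitrary: F)
    case 0
    then show ?case using V c by (auto intro!: continuous_on_open_UN chart_image_open_Int)
  next
    case (Suc k) then show ?case by auto
  qed
  then show "ck_on k (snd c ` (fst c \<inter> U)) (\<lambda>y. f (chart_inv c y))"
    unfolding eq using V c by (auto intro: smooth_map_on_ck)
qed

lemma h_sections_smooth:
  assumes U: "open U" and \<sigma>: "smooth_section_on A E T U \<sigma>" and \<tau>: "smooth_section_on A E T U \<tau>"
  shows "smooth_map_on A U (\<lambda>x. h x (\<sigma> x) (\<tau> x))"
proof (rule smooth_map_on_local)
  fix x assume x: "x \<in> U"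
  obtain t where t: "t \<in> T" "x \<in> fst t" using triv_ex by blast
  let ?V = "fst t \<inter> U"
  have V: "open ?V" using triv_open[OF t(1)] U by auto
  have "smooth_map_on A ?V (\<lambda>x. \<Sum>a\<in>UNIV. \<Sum>b\<in>UNIV. snd t x (\<sigma> x) $ a * snd t x (\<tau> x) $ b * h x (triv_inv E t x (axis a 1)) (triv_inv E t x (axis b 1)))"
    by (intro smooth_map_on_sum smooth_map_on_mult smooth_map_on_nth V section_smooth \<sigma> \<tau> t
        smooth_map_on_subset[OF h_smooth[OF t(1)]]) auto
  then have "smooth_map_on A ?V (\<lambda>x. h x (\<sigma> x) (\<tau> x))"
    by (rule smooth_map_on_cong[OF V, rotated])
      (use h_triv[OF t(1)] \<sigma> \<tau> in \<open>auto simp: smooth_section_on_def\<close>)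
  then show "\<exists>V. open V \<and> x \<in> V \<and> V \<subseteq> U \<and> smooth_map_on A V (\<lambda>x. h x (\<sigma> x) (\<tau> x))"
    using V x t by blast
qed

lemma section_scale:
  assumes f: "smooth_map_on A UNIV f" and \<sigma>: "smooth_section A E T \<sigma>"
  shows "smooth_section A E T (\<lambda>x. f x *\<^sub>R \<sigma> x)"
  unfolding smooth_section_on_def
proof (intro conjI ballI)
  fix t assume t: "t \<in> T"
  have o: "open (fst t \<inter> UNIV)" using triv_open[OF t] by simp
  have "smooth_map_on A (fst t \<inter> UNIV) (\<lambda>x. f x *\<^sub>R snd t x (\<sigma> x))"
    by (intro smooth_map_on_scaleR o section_smooth \<sigma> t smooth_map_on_subset[OF f]) auto
  then show "smooth_map_on A (fst t \<inter> UNIV) (\<lambda>x. snd t x (f x *\<^sub>R \<sigma> x))"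
    by (rule smooth_map_on_cong[OF o, rotated]) (use triv_scale[OF t] section_in[OF \<sigma>] in auto)
qed (use section_in[OF \<sigma>] in \<open>auto intro: fibre_scale\<close>)

lemma section_0: "smooth_section A E T (\<lambda>x. 0)"
  unfolding smooth_section_on_def
proof (intro conjI ballI)
  fix t assume t: "t \<in> T"
  show "smooth_map_on A (fst t \<inter> UNIV) (\<lambda>x. snd t x 0)"
    by (rule smooth_map_on_cong[where f="\<lambda>x. 0"]) (use triv_open[OF t] triv_0[OF t] smooth_map_on_const in auto)
qed auto

lemma section_add:
  assumes \<sigma>: "smooth_section A E T \<sigma>" and \<tau>: "smooth_section A E T \<tau>"
  shows "smooth_section A E T (\<lambda>x. \<sigma> x + \<tau> x)"
  unfolding smooth_section_on_def
proof (intro conjI ballI)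
  fix t assume t: "t \<in> T"
  have o: "open (fst t \<inter> UNIV)" using triv_open[OF t] by simp
  have "smooth_map_on A (fst t \<inter> UNIV) (\<lambda>x. snd t x (\<sigma> x) + snd t x (\<tau> x))"
    by (intro smooth_map_on_add o section_smooth \<sigma> \<tau> t)
  then show "smooth_map_on A (fst t \<inter> UNIV) (\<lambda>x. snd t x (\<sigma> x + \<tau> x))"
    by (rule smooth_map_on_cong[OF o, rotated]) (use triv_add[OF t] section_in[OF \<sigma>] section_in[OF \<tau>] in auto)
qed (use section_in[OF \<sigma>] section_in[OF \<tau>] in \<open>auto intro: fibre_add\<close>)

lemma section_sum: "(\<And>i. i \<in> I \<Longrightarrow> smooth_section A E T (\<sigma> i)) \<Longrightarrow> smooth_section A E T (\<lambda>x. \<Sum>i\<in>I. \<sigma> i x)"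
  by (induction I rule: infinite_finite_induct) (simp_all add: section_0 section_add)

section \<open>Cut-off functions and extension by zero\<close>

definition chart_bump :: "('m, 'n) chart \<Rightarrow> real ^ 'n \<Rightarrow> real \<Rightarrow> 'm \<Rightarrow> real" where
  "chart_bump c y r x = (if x \<in> fst c then bump y r (snd c x) else 0)"

lemma chart_bump_support:
  assumes "r > 0" "chart_bump c y r x \<noteq> 0"
  shows "x \<in> fst c" "dist y (snd c x) < r"
  using assms bump_pos_iff(2)[of r y "snd c x"] by (auto simp: chart_bump_def split: if_splits)

lemma chart_bump_smooth:
  assumes c: "c \<in> A" and r: "r > 0" "cball y r \<subseteq> snd c ` fst c"
  shows "smooth_map_on A UNIV (chart_bump c y r)"
proof -
  let ?K = "chart_inv c ` cball y r"
  have "compact ?K" by (rule chart_inv_image(4)[OF c r(2) compact_cball])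
  then have K: "open (- ?K)" using compact_imp_closed by blast
  have 1: "smooth_map_on A (fst c) (chart_bump c y r)"
  proof (rule smooth_map_on_chartI[OF c chart_open[OF c]])
    show "ck_on k (snd c ` fst c) (\<lambda>z. chart_bump c y r (chart_inv c z))" for k
      by (subst ck_on_cong[OF chart_image_open[OF c], where g="bump y r"])
        (use c chart_image_open[OF c] smooth_onD[OF smooth_on_bump] in \<open>auto simp: chart_bump_def\<close>)
  qed simp
  have "smooth_map_on A (- ?K) (chart_bump c y r)"
  proof (rule smooth_map_on_cong[OF K _ smooth_map_on_const])
    fix x assume x: "x \<in> - ?K"
    show "0 = chart_bump c y r x"
    proof (rule ccontr)
      assume "0 \<noteq> chart_bump c y r x"
      then have "x \<in> fst c" "snd c x \<in> cball y r" using chart_bump_support[OF r(1), of c y x] by auto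
      then show False using x chart_inv_chart[OF c, of x] by (metis ComplD image_eqI)
    qed
  qed
  then have "smooth_map_on A (fst c \<union> - ?K) (chart_bump c y r)"
    by (rule smooth_map_on_Un[OF chart_open[OF c] K 1])
  moreover have "fst c \<union> - ?K = UNIV" using chart_inv_image(1)[OF c r(2)] by auto
  ultimately show ?thesis by simp
qed

text \<open>The product is smooth on \<open>U\<close>, it is zero on the complement of
  \<open>K\<close>, and these two open sets cover the manifold. This turns local sections into
  global ones, the only kind that \<open>nabla\<close> differentiates.\<close>

lemma extend_section:
  assumes U: "open U" and \<sigma>: "smooth_section_on A E T U \<sigma>" and \<psi>: "smooth_map_on A UNIV \<psi>"
    and K: "closed K" "K \<subseteq> U" "\<And>x. x \<notin> K \<Longrightarrow> \<psi> x = 0"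
  shows "smooth_section A E T (\<lambda>x. if x \<in> U then \<psi> x *\<^sub>R \<sigma> x else 0)" (is "smooth_section A E T ?s")
  unfolding smooth_section_on_def
proof (intro conjI ballI)
  show "?s x \<in> E x" for x using \<sigma> by (auto simp: smooth_section_on_def intro: fibre_scale)
  fix t assume t: "t \<in> T"
  have o1: "open (fst t \<inter> U)" and o2: "open (fst t \<inter> - K)" using triv_open[OF t] U K by auto
  have "smooth_map_on A (fst t \<inter> U) (\<lambda>x. \<psi> x *\<^sub>R snd t x (\<sigma> x))"
    by (intro smooth_map_on_scaleR o1 section_smooth \<sigma> t smooth_map_on_subset[OF \<psi>]) auto
  then have 1: "smooth_map_on A (fst t \<inter> U) (\<lambda>x. snd t x (?s x))"
    by (rule smooth_map_on_cong[OF o1, rotated]) (use triv_scale[OF t] \<sigma> in \<open>auto simp: smooth_section_on_def\<close>)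
  have 2: "smooth_map_on A (fst t \<inter> - K) (\<lambda>x. snd t x (?s x))"
    by (rule smooth_map_on_cong[OF o2 _ smooth_map_on_const[of _ 0]]) (use K(3) triv_0[OF t] in auto)
  have "fst t \<inter> U \<union> fst t \<inter> - K = fst t \<inter> UNIV" using K(2) by auto
  then show "smooth_map_on A (fst t \<inter> UNIV) (\<lambda>x. snd t x (?s x))"
    using smooth_map_on_Un[OF o1 o2 1 2] by simp
qed

lemma extend_function:
  fixes f :: "'m \<Rightarrow> real"
  assumes U: "open U" and f: "smooth_map_on A U f" and \<psi>: "smooth_map_on A UNIV \<psi>"
    and K: "closed K" "K \<subseteq> U" "\<And>x. x \<notin> K \<Longrightarrow> \<psi> x = 0"
  shows "smooth_map_on A UNIV (\<lambda>x. if x \<in> U then \<psi> x * f x else 0)" (is "smooth_map_on A UNIV ?s")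
proof -
  have "smooth_map_on A U (\<lambda>x. \<psi> x * f x)"
    by (intro smooth_map_on_mult U f smooth_map_on_subset[OF \<psi>]) auto
  then have 1: "smooth_map_on A U ?s" by (rule smooth_map_on_cong[OF U, rotated]) auto
  have o2: "open (- K)" using K by auto
  have 2: "smooth_map_on A (- K) ?s"
    by (rule smooth_map_on_cong[OF o2 _ smooth_map_on_const[of _ 0]]) (use K(3) in auto)
  have "U \<union> - K = UNIV" using K(2) by auto
  then show ?thesis using smooth_map_on_Un[OF U o2 1 2] by simp
qed

section \<open>The connection in a local trivialisation\<close>

lemma nabla_in: "smooth_section A E T \<sigma> \<Longrightarrow> v \<in> tangent_space A x \<Longrightarrow> nabla \<sigma> x v \<in> E x"
  and nabla_lin: "smooth_section A E T \<sigma> \<Longrightarrow> u \<in> tangent_space A x \<Longrightarrow> v \<in> tangent_space A x \<Longrightarrow>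
    nabla \<sigma> x (tv_lincomb a u b v) = a *\<^sub>R nabla \<sigma> x u + b *\<^sub>R nabla \<sigma> x v"
  and nabla_smooth: "smooth_section A E T \<sigma> \<Longrightarrow> c \<in> A \<Longrightarrow> smooth_section_on A E T (fst c) (\<lambda>x. nabla \<sigma> x (coord_vec c i x))"
  and nabla_add: "smooth_section A E T \<sigma> \<Longrightarrow> smooth_section A E T \<tau> \<Longrightarrow> v \<in> tangent_space A x \<Longrightarrow>
    nabla (\<lambda>y. \<sigma> y + \<tau> y) x v = nabla \<sigma> x v + nabla \<tau> x v"
  and nabla_leibniz: "smooth_section A E T \<sigma> \<Longrightarrow> smooth_map_on A UNIV f \<Longrightarrow> v \<in> tangent_space A x \<Longrightarrow>
    nabla (\<lambda>y. f y *\<^sub>R \<sigma> y) x v = v f *\<^sub>R \<sigma> x + f x *\<^sub>R nabla \<sigma> x v"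
  using conn unfolding connection_def by (blast, blast, blast, blast, blast)

lemma nabla_metric: "smooth_section A E T \<sigma> \<Longrightarrow> smooth_section A E T \<tau> \<Longrightarrow> v \<in> tangent_space A x \<Longrightarrow>
    v (\<lambda>y. h y (\<sigma> y) (\<tau> y)) = h x (nabla \<sigma> x v) (\<tau> x) + h x (\<sigma> x) (nabla \<tau> x v)"
  using metric_conn unfolding metric_connection_def by blast

lemma nabla_0:
  assumes v: "v \<in> tangent_space A x" shows "nabla (\<lambda>x. 0) x v = 0"
  using nabla_add[OF section_0 section_0 v] by simp

lemma nabla_sum:
  assumes v: "v \<in> tangent_space A x" and \<sigma>: "\<And>i. i \<in> I \<Longrightarrow> smooth_section A E T (\<sigma> i)"
  shows "nabla (\<lambda>y. \<Sum>i\<in>I. \<sigma> i y) x v = (\<Sum>i\<in>I. nabla (\<sigma> i) x v)"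
  using \<sigma> by (induction I rule: infinite_finite_induct)
    (simp_all add: nabla_0[OF v] nabla_add[OF _ _ v] section_sum)

text \<open>
  With a bump function \<open>\<psi>\<close>, the local frame of a trivialisation gives global sections
  \<open>s\<^sub>a = \<psi> e\<^sub>a\<close>, and \<open>\<psi>\<^sup>2 \<sigma> = \<Sum>\<^sub>a (\<psi> \<sigma>\<^sup>a) s\<^sub>a\<close> holds globally. Applying \<open>\<nabla>\<close> to both sides expresses
  \<open>\<nabla>\<sigma>\<close> in terms of the derivatives of the components where \<open>\<psi> > 0\<close>.
\<close>

lemma local_connection:
  "\<exists>c\<in>A. \<exists>t\<in>T. \<exists>N. \<exists>\<Gamma>. open N \<and> x0 \<in> N \<and> N \<subseteq> fst c \<and> N \<subseteq> fst t \<and>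
    (\<forall>i a b. continuous_on N (\<Gamma> i a b)) \<and>
    (\<forall>\<sigma> x i b. smooth_section A E T \<sigma> \<and> x \<in> N \<longrightarrow>
      snd t x (nabla \<sigma> x (coord_vec c i x)) $ b =
        coord_vec c i x (\<lambda>y. snd t y (\<sigma> y) $ b) + (\<Sum>a\<in>UNIV. \<Gamma> i a b x * snd t x (\<sigma> x) $ a))"
proof -
  obtain c where c: "c \<in> A" "x0 \<in> fst c" using chart_ex by blast
  obtain t where t: "t \<in> T" "x0 \<in> fst t" using triv_ex by blast
  have "open (snd c ` (fst c \<inter> fst t))" "snd c x0 \<in> snd c ` (fst c \<inter> fst t)"
    using chart_image_open_Int[OF c(1) triv_open[OF t(1)]] c t by auto
  then obtain r where r: "r > 0" "cball (snd c x0) r \<subseteq> snd c ` (fst c \<inter> fst t)"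
    using open_contains_cball by blast
  then have rc: "cball (snd c x0) r \<subseteq> snd c ` fst c" by blast
  have rb: "ball (snd c x0) r \<subseteq> snd c ` fst c" using rc ball_subset_cball by blast
  define \<psi> where "\<psi> = chart_bump c (snd c x0) r"
  define N where "N = chart_inv c ` ball (snd c x0) r"
  define K where "K = chart_inv c ` cball (snd c x0) r"
  have \<psi>: "smooth_map_on A UNIV \<psi>" unfolding \<psi>_def by (rule chart_bump_smooth[OF c(1) r(1) rc])
  have K: "closed K" "K \<subseteq> fst t" "\<And>x. x \<notin> K \<Longrightarrow> \<psi> x = 0"
  proof -
    show "closed K" unfolding K_def by (intro compact_imp_closed chart_inv_image(4)[OF c(1) rc] compact_cball)
    show "K \<subseteq> fst t" unfolding K_def using r(2) chart_image_Int[OF c(1), of _ "fst t"] by auto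
    show "\<psi> x = 0" if "x \<notin> K" for x
    proof (rule ccontr)
      assume "\<psi> x \<noteq> 0"
      then have "x \<in> fst c" "dist (snd c x0) (snd c x) < r"
        using chart_bump_support[OF r(1)] unfolding \<psi>_def by blast+
      then show False using that unfolding K_def chart_inv_image(1)[OF c(1) rc] by auto
    qed
  qed
  have NK: "N \<subseteq> K" unfolding N_def K_def using ball_subset_cball by blast
  have N: "open N" "x0 \<in> N" "N \<subseteq> fst c" "N \<subseteq> fst t"
    using chart_inv_image(1,3)[OF c(1) rb] c(2) r(1) NK K(2) unfolding N_def by auto
  have \<psi>N: "\<psi> x > 0" if "x \<in> N" for x
    using that bump_pos_iff(1)[OF r(1)] unfolding N_def chart_inv_image(1)[OF c(1) rb] \<psi>_def chart_bump_def by auto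
  let ?e = "\<lambda>a x. triv_inv E t x (axis a 1)"
  define s where "s a x = (if x \<in> fst t then \<psi> x *\<^sub>R ?e a x else 0)" for a :: 'k and x
  have "smooth_section_on A E T (fst t) (?e a)" for a
    using triv_smooth[OF t(1)] triv_inv_in[OF t(1)] by (auto simp: smooth_section_on_def Int_commute)
  then have s: "smooth_section A E T (s a)" for a
    unfolding s_def by (rule extend_section[OF triv_open[OF t(1)] _ \<psi> K])
  \<comment> \<open>The connection coefficients of the frame \<open>?e\<close>. As
    \<open>s a\<close> is \<open>\<psi>\<close> times \<open>?e a\<close>, the Leibniz rule adds the
    derivative of \<open>\<psi>\<close> on the diagonal; subtracting it and dividing by
    \<open>\<psi>\<close> recovers the derivative of the frame itself, which is only a local
    section.\<close>
  define \<Gamma> where "\<Gamma> i a b x = (snd t x (nabla (s a) x (coord_vec c i x)) $ b - (if a = b then coord_vec c i x \<psi> else 0)) / \<psi> x"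
    for i :: 'n and a b :: 'k and x
  have cont: "continuous_on N (\<Gamma> i a b)" for i a b
  proof -
    have 1: "continuous_on N (\<lambda>x. snd t x (nabla (s a) x (coord_vec c i x)))"
      by (rule continuous_on_subset[OF smooth_map_on_continuous[OF section_smooth[OF nabla_smooth[OF s c(1)] t(1)]]])
        (use N triv_open[OF t(1)] chart_open[OF c(1)] in auto)
    have 2: "continuous_on N (\<lambda>x. coord_vec c i x \<psi>)"
      by (rule continuous_on_subset[OF coord_vec_continuous[OF \<psi> c(1)] N(3)])
    have 3: "continuous_on N \<psi>" using smooth_map_on_continuous[OF \<psi>] continuous_on_subset by blast
    show ?thesis unfolding \<Gamma>_def
      by (cases "a = b") (use 1 2 3 \<psi>N in \<open>auto intro!: continuous_intros simp: less_le\<close>)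
  qed
  have formula: "snd t x (nabla \<sigma> x (coord_vec c i x)) $ b =
        coord_vec c i x (\<lambda>y. snd t y (\<sigma> y) $ b) + (\<Sum>a\<in>UNIV. \<Gamma> i a b x * snd t x (\<sigma> x) $ a)"
    if \<sigma>: "smooth_section A E T \<sigma>" and x: "x \<in> N" for \<sigma> x i b
  proof -
    let ?v = "coord_vec c i x" and ?u = "\<lambda>b y. snd t y (\<sigma> y) $ b"
    have v: "?v \<in> tangent_space A x" using coord_vec_in[OF c(1)] x N(3) by blast
    have xt: "x \<in> fst t" and p: "\<psi> x > 0" using x N(4) \<psi>N by auto
    define f where "f a y = (if y \<in> fst t then \<psi> y * ?u a y else 0)" for a y
    have u: "smooth_map_on A (fst t) (?u a)" for a
      using smooth_map_on_nth[OF triv_open[OF t(1)]] section_smooth[OF \<sigma> t(1)] by simp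
    have f: "smooth_map_on A UNIV (f a)" for a
      unfolding f_def by (rule extend_function[OF triv_open[OF t(1)] u \<psi> K])
    have vf: "?v (f a) = \<psi> x * ?v (?u a) + ?v \<psi> * ?u a x" for a
    proof -
      have "?v (f a) = ?v (\<lambda>y. \<psi> y * ?u a y)"
        by (rule tangent_vec_local[OF v triv_open[OF t(1)] xt]) (simp add: f_def)
      also have "\<dots> = \<psi> x * ?v (?u a) + ?v \<psi> * ?u a x"
        by (rule tangent_vec_mult[OF v smooth_map_on_subset[OF \<psi>] u xt]) simp
      finally show ?thesis .
    qed
    have p2: "smooth_map_on A UNIV (\<lambda>y. \<psi> y * \<psi> y)" by (intro smooth_map_on_mult \<psi> open_UNIV)
    have eq: "(\<lambda>y. (\<psi> y * \<psi> y) *\<^sub>R \<sigma> y) = (\<lambda>y. \<Sum>a\<in>UNIV. f a y *\<^sub>R s a y)"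
    proof
      fix y
      show "(\<psi> y * \<psi> y) *\<^sub>R \<sigma> y = (\<Sum>a\<in>UNIV. f a y *\<^sub>R s a y)"
      proof (cases "y \<in> fst t")
        case True
        have "(\<psi> y * \<psi> y) *\<^sub>R \<sigma> y = (\<psi> y * \<psi> y) *\<^sub>R (\<Sum>a\<in>UNIV. ?u a y *\<^sub>R ?e a y)"
          using triv_expansion[OF t(1) True section_in[OF \<sigma>]] by simp
        also have "\<dots> = (\<Sum>a\<in>UNIV. f a y *\<^sub>R s a y)"
          using True by (simp add: f_def s_def scaleR_sum_right mult_ac)
        finally show ?thesis .
      next
        case False
        then have "\<psi> y = 0" using K by blast
        then show ?thesis using False by (simp add: f_def)
      qed
    qed
    have "?v (\<lambda>y. \<psi> y * \<psi> y) *\<^sub>R \<sigma> x + (\<psi> x * \<psi> x) *\<^sub>R nabla \<sigma> x ?v = nabla (\<lambda>y. (\<psi> y * \<psi> y) *\<^sub>R \<sigma> y) x ?v"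
      by (rule nabla_leibniz[OF \<sigma> p2 v, symmetric])
    also have "\<dots> = (\<Sum>a\<in>UNIV. ?v (f a) *\<^sub>R s a x + f a x *\<^sub>R nabla (s a) x ?v)"
      unfolding eq by (subst nabla_sum[OF v section_scale[OF f s]]) (simp add: nabla_leibniz[OF s f v])
    finally have 1: "?v (\<lambda>y. \<psi> y * \<psi> y) *\<^sub>R \<sigma> x + (\<psi> x * \<psi> x) *\<^sub>R nabla \<sigma> x ?v =
      (\<Sum>a\<in>UNIV. ?v (f a) *\<^sub>R s a x + f a x *\<^sub>R nabla (s a) x ?v)" .
    have 2: "snd t x (?v (\<lambda>y. \<psi> y * \<psi> y) *\<^sub>R \<sigma> x + (\<psi> x * \<psi> x) *\<^sub>R nabla \<sigma> x ?v) =
        ?v (\<lambda>y. \<psi> y * \<psi> y) *\<^sub>R snd t x (\<sigma> x) + (\<psi> x * \<psi> x) *\<^sub>R snd t x (nabla \<sigma> x ?v)"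
      by (rule triv_lin[OF t(1) xt section_in[OF \<sigma>] nabla_in[OF \<sigma> v]])
    have 3: "snd t x (\<Sum>a\<in>UNIV. ?v (f a) *\<^sub>R s a x + f a x *\<^sub>R nabla (s a) x ?v) =
        (\<Sum>a\<in>UNIV. ?v (f a) *\<^sub>R snd t x (s a x) + f a x *\<^sub>R snd t x (nabla (s a) x ?v))"
      by (subst triv_sum[OF t(1) xt])
        (auto intro!: fibre_add fibre_scale section_in[OF s] nabla_in[OF s v] simp: triv_lin[OF t(1) xt section_in[OF s] nabla_in[OF s v]])
    note 23 = arg_cong[where f="snd t x", OF 1, unfolded 2 3]
    have 4: "snd t x (s a x) = \<psi> x *\<^sub>R axis a 1" for a
      using xt by (simp add: s_def triv_scale[OF t(1) xt triv_inv_in[OF t(1) xt]] t(1))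
    have vp2: "?v (\<lambda>y. \<psi> y * \<psi> y) = 2 * \<psi> x * ?v \<psi>"
      using tangent_vec_mult[OF v \<psi> \<psi>] by simp
    have fx: "f a x = \<psi> x * ?u a x" for a using xt by (simp add: f_def)
    have "2 * \<psi> x * ?v \<psi> * ?u b x + (\<psi> x * \<psi> x) * snd t x (nabla \<sigma> x ?v) $ b =
       (\<Sum>a\<in>UNIV. ?v (f a) * (\<psi> x * (if a = b then 1 else 0)) + \<psi> x * ?u a x * snd t x (nabla (s a) x ?v) $ b)"
      using arg_cong[where f="\<lambda>z. z $ b", OF 23] unfolding 4 vp2 fx
      by (simp add: axis_def eq_commute[of b] mult.assoc cong: if_cong)
    also have "\<dots> = ?v (f b) * \<psi> x + \<psi> x * (\<Sum>a\<in>UNIV. ?u a x * snd t x (nabla (s a) x ?v) $ b)"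
      by (simp add: sum.distrib if_distrib[of "(*) _"] sum_distrib_left mult_ac cong: if_cong)
    also have "\<dots> = \<psi> x * (\<psi> x * ?v (?u b) + ?v \<psi> * ?u b x + (\<Sum>a\<in>UNIV. ?u a x * snd t x (nabla (s a) x ?v) $ b))"
      by (simp add: vf algebra_simps)
    finally have "\<psi> x * (2 * ?v \<psi> * ?u b x + \<psi> x * snd t x (nabla \<sigma> x ?v) $ b) =
       \<psi> x * (\<psi> x * ?v (?u b) + ?v \<psi> * ?u b x + (\<Sum>a\<in>UNIV. ?u a x * snd t x (nabla (s a) x ?v) $ b))"
      by (simp add: algebra_simps)
    then have 5: "\<psi> x * snd t x (nabla \<sigma> x ?v) $ b =
       \<psi> x * ?v (?u b) - ?v \<psi> * ?u b x + (\<Sum>a\<in>UNIV. ?u a x * snd t x (nabla (s a) x ?v) $ b)"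
      using p by simp
    have "(\<Sum>a\<in>UNIV. \<Gamma> i a b x * ?u a x) = (\<Sum>a\<in>UNIV. ?u a x * snd t x (nabla (s a) x ?v) $ b - (if a = b then ?v \<psi> * ?u a x else 0)) / \<psi> x"
      unfolding \<Gamma>_def sum_divide_distrib by (intro sum.cong refl) (simp add: algebra_simps)
    also have "\<dots> = ((\<Sum>a\<in>UNIV. ?u a x * snd t x (nabla (s a) x ?v) $ b) - ?v \<psi> * ?u b x) / \<psi> x"
      by (simp add: sum_subtractf)
    finally have "\<psi> x * (\<Sum>a\<in>UNIV. \<Gamma> i a b x * ?u a x) = (\<Sum>a\<in>UNIV. ?u a x * snd t x (nabla (s a) x ?v) $ b) - ?v \<psi> * ?u b x"
      using p by simp
    with 5 have "\<psi> x * snd t x (nabla \<sigma> x ?v) $ b = \<psi> x * (?v (?u b) + (\<Sum>a\<in>UNIV. \<Gamma> i a b x * ?u a x))"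
      by (simp add: distrib_left)
    then show ?thesis using p by simp
  qed
  show ?thesis
    by (intro bexI[OF _ c(1)] bexI[OF _ t(1)] exI[of _ N] exI[of _ \<Gamma>]) (use N cont formula in auto)
qed

lemma coord_vec_spans:
  assumes \<sigma>: "smooth_section A E T \<sigma>" and c: "c \<in> A" "x \<in> fst c"
  shows "nabla \<sigma> x (chart_vec c x w) = (\<Sum>i\<in>UNIV. w $ i *\<^sub>R nabla \<sigma> x (coord_vec c i x))"
  by (rule tv_linear_chart_vec[OF c nabla_lin[OF \<sigma>]])

text \<open>By \<open>local_connection\<close> the value of \<open>nabla\<close> at a point is
  computed from the components and their first derivatives there, and tangent vectors are
  local.\<close>

lemma nabla_local:
  assumes \<sigma>: "smooth_section A E T \<sigma>" and \<tau>: "smooth_section A E T \<tau>"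
    and W: "open W" "x \<in> W" "\<And>y. y \<in> W \<Longrightarrow> \<sigma> y = \<tau> y" and v: "v \<in> tangent_space A x"
  shows "nabla \<sigma> x v = nabla \<tau> x v"
proof -
  obtain c t N \<Gamma> where c: "c \<in> A" and t: "t \<in> T" and N: "open N" "x \<in> N" "N \<subseteq> fst c" "N \<subseteq> fst t"
    and formula: "\<And>\<sigma> z i b. smooth_section A E T \<sigma> \<and> z \<in> N \<longrightarrow>
      snd t z (nabla \<sigma> z (coord_vec c i z)) $ b =
        coord_vec c i z (\<lambda>y. snd t y (\<sigma> y) $ b) + (\<Sum>a\<in>UNIV. \<Gamma> i a b z * snd t z (\<sigma> z) $ a)"
    using local_connection[of x] by blast
  have xc: "x \<in> fst c" and xt: "x \<in> fst t" using N by auto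
  have "nabla \<sigma> x (coord_vec c i x) = nabla \<tau> x (coord_vec c i x)" for i
  proof (rule triv_inj[OF t xt])
    have ci: "coord_vec c i x \<in> tangent_space A x" by (rule coord_vec_in[OF c xc])
    show "nabla \<sigma> x (coord_vec c i x) \<in> E x" "nabla \<tau> x (coord_vec c i x) \<in> E x"
      using nabla_in ci \<sigma> \<tau> by blast+
    have "coord_vec c i x (\<lambda>y. snd t y (\<sigma> y) $ b) = coord_vec c i x (\<lambda>y. snd t y (\<tau> y) $ b)" for b
      by (rule tangent_vec_local[OF ci W(1,2)]) (simp add: W(3))
    then show "snd t x (nabla \<sigma> x (coord_vec c i x)) = snd t x (nabla \<tau> x (coord_vec c i x))"
      using formula \<sigma> \<tau> N(2) W(2,3) by (simp add: vec_eq_iff)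
  qed
  moreover obtain w where "v = chart_vec c x w" using v tangent_space_chart[OF c xc] by blast
  ultimately show ?thesis by (simp add: coord_vec_spans[OF _ c xc] \<sigma> \<tau>)
qed

section \<open>The energy density\<close>

abbreviation sq :: "('m \<Rightarrow> 'f) \<Rightarrow> 'm \<Rightarrow> real" where "sq \<sigma> x \<equiv> h x (\<sigma> x) (\<sigma> x)"
abbreviation nn2 :: "('m \<Rightarrow> 'f) \<Rightarrow> 'm \<Rightarrow> real" where "nn2 \<equiv> nabla_norm2 A g h nabla"
abbreviation gn2 :: "('m \<Rightarrow> 'f) \<Rightarrow> 'm \<Rightarrow> real" where "gn2 \<sigma> \<equiv> grad_norm2 A g (\<lambda>y. 1 / 2 * sq \<sigma> y)"

text \<open>Names the very choice made inside \<open>nabla_norm2\<close>; nothing relates the frames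
  at different points.\<close>

definition frame :: "'m \<Rightarrow> 'n \<Rightarrow> 'm tvec" where
  "frame x = (SOME e. orthonormal_frame A g x e)"

lemma frame: "orthonormal_frame A g x (frame x)"
  unfolding frame_def using orthonormal_frame_ex by (rule someI_ex)

lemma frame_in: "frame x k \<in> tangent_space A x"
  using frame by (simp add: orthonormal_frame_def)

lemma nabla_norm2_frame: "nn2 \<sigma> x = (\<Sum>k\<in>UNIV. h x (nabla \<sigma> x (frame x k)) (nabla \<sigma> x (frame x k)))"
  by (simp add: nabla_norm2_def frame_def Let_def)

lemma nabla_bilinear:
  assumes \<sigma>: "smooth_section A E T \<sigma>"
  shows "tv_bilinear A x (\<lambda>u v. h x (nabla \<sigma> x u) (nabla \<sigma> x v))"
  unfolding tv_bilinear_def using nabla_lin[OF \<sigma>] nabla_in[OF \<sigma>] h_lin h_lin2 by simp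

lemma nabla_norm2_chart:
  assumes \<sigma>: "smooth_section A E T \<sigma>" and c: "c \<in> A" "x \<in> fst c"
  shows "nn2 \<sigma> x = (\<Sum>i\<in>UNIV. \<Sum>j\<in>UNIV. matrix_inv (gram g c x) $ i $ j *
     h x (nabla \<sigma> x (coord_vec c i x)) (nabla \<sigma> x (coord_vec c j x)))"
  unfolding nabla_norm2_frame by (rule frame_trace[OF nabla_bilinear[OF \<sigma>] frame c])

lemma nabla_norm2_nonneg: "smooth_section A E T \<sigma> \<Longrightarrow> nn2 \<sigma> x \<ge> 0"
  unfolding nabla_norm2_frame using nabla_in[OF _ frame_in] by (intro sum_nonneg h_nonneg) auto

lemma sq_smooth: "smooth_section A E T \<sigma> \<Longrightarrow> smooth_map_on A UNIV (sq \<sigma>)"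
  by (intro h_sections_smooth open_UNIV)

lemma sq_nonneg: "smooth_section A E T \<sigma> \<Longrightarrow> sq \<sigma> x \<ge> 0"
  by (intro h_nonneg section_in)

lemma tangent_vec_half_sq:
  assumes \<sigma>: "smooth_section A E T \<sigma>" and v: "v \<in> tangent_space A x"
  shows "v (\<lambda>y. 1 / 2 * sq \<sigma> y) = h x (nabla \<sigma> x v) (\<sigma> x)"
proof -
  have "v (\<lambda>y. 1 / 2 * sq \<sigma> y) = 1 / 2 * v (sq \<sigma>)"
    by (rule tangent_vec_cmult[OF v sq_smooth[OF \<sigma>]]) simp
  also have "v (sq \<sigma>) = 2 * h x (nabla \<sigma> x v) (\<sigma> x)"
    using nabla_metric[OF \<sigma> \<sigma> v] h_sym[OF section_in[OF \<sigma>] nabla_in[OF \<sigma> v]] by simp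
  finally show ?thesis by simp
qed

lemma grad_half_sq:
  assumes \<sigma>: "smooth_section A E T \<sigma>"
  shows "gn2 \<sigma> x = (\<Sum>k\<in>UNIV. (h x (nabla \<sigma> x (frame x k)) (\<sigma> x))\<^sup>2)"
  by (simp only: grad_norm2_frame[OF frame] tangent_vec_half_sq[OF \<sigma> frame_in])

text \<open>Cauchy-Schwarz in the fibre for each frame direction, since metric compatibility makes
  the derivative of half the squared norm equal to the pairing of \<open>nabla \<sigma> x v\<close>
  with \<open>\<sigma> x\<close>.\<close>

lemma kato:
  assumes \<sigma>: "smooth_section A E T \<sigma>" shows "gn2 \<sigma> x \<le> sq \<sigma> x * nn2 \<sigma> x"
  unfolding grad_half_sq[OF \<sigma>] nabla_norm2_frame sum_distrib_left
  by (intro sum_mono) (use h_cauchy_schwarz[OF nabla_in[OF \<sigma> frame_in] section_in[OF \<sigma>]] in \<open>simp add: mult.commute\<close>)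

lemma gn2_nonneg: "smooth_section A E T \<sigma> \<Longrightarrow> gn2 \<sigma> x \<ge> 0"
  by (simp only: grad_half_sq) (intro sum_nonneg zero_le_power2)

lemma parallel_iff_nabla_norm2:
  assumes \<sigma>: "smooth_section A E T \<sigma>"
  shows "parallel A nabla \<sigma> \<longleftrightarrow> (\<forall>x. nn2 \<sigma> x = 0)"
proof
  assume "parallel A nabla \<sigma>"
  then show "\<forall>x. nn2 \<sigma> x = 0"
    by (simp add: parallel_def nabla_norm2_frame frame_in h_0)
next
  assume 0: "\<forall>x. nn2 \<sigma> x = 0"
  show "parallel A nabla \<sigma>" unfolding parallel_def
  proof (intro allI ballI)
    fix x v assume v: "v \<in> tangent_space A x"
    obtain c where c: "c \<in> A" "x \<in> fst c" using chart_ex by blast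
    obtain b :: "'n \<Rightarrow> real^'n" where b: "\<And>k. frame x k = chart_vec c x (b k)"
      and o: "\<And>i j. b i \<bullet> (gram g c x *v b j) = (if i = j then 1 else 0)"
      using orthonormal_frame_chart[OF frame c] by metis
    have k0: "nabla \<sigma> x (chart_vec c x (b k)) = 0" for k
    proof -
      have "h x (nabla \<sigma> x (frame x k)) (nabla \<sigma> x (frame x k)) = 0"
        using 0[rule_format, of x] unfolding nabla_norm2_frame
        by (subst (asm) sum_nonneg_eq_0_iff) (auto intro: h_nonneg nabla_in[OF \<sigma> frame_in])
      then show ?thesis using h_eq_0[OF nabla_in[OF \<sigma> frame_in]] b by metis
    qed
    obtain w where w: "v = chart_vec c x w" using v tangent_space_chart[OF c] by blast
    have lin: "linear (\<lambda>w. nabla \<sigma> x (chart_vec c x w))"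
      using nabla_lin[OF \<sigma> chart_vec_in[OF c] chart_vec_in[OF c], unfolded tv_lincomb_chart_vec]
      by (intro linearI) (metis scaleR_one, metis add.right_neutral scaleR_zero_left)
    define B where "B = (\<chi> i j. b j $ i)"
    have BB: "B ** transpose B = matrix_inv (gram g c x)"
      using gram_orthonormal_basis_inverse(1)[OF o]
      by (simp add: vec_eq_iff matrix_matrix_mult_def transpose_def B_def)
    \<comment> \<open>Completeness of the frame: B B^T is the inverse Gram matrix, so every
      \<open>w\<close> lies in the range of \<open>B\<close>, that is, in the span of the frame
      vectors.\<close>
    then have "w = B *v (transpose B *v (gram g c x *v w))"
      using matrix_inv_mult(2)[OF gram_invertible[OF c]]
      by (simp add: matrix_vector_mul_assoc matrix_mul_assoc)
    then obtain z where "w = B *v z" by blast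
    then have "w = (\<Sum>k\<in>UNIV. z $ k *\<^sub>R b k)"
      by (simp add: vec_eq_iff matrix_vector_mult_def B_def mult.commute)
    then have "nabla \<sigma> x v = (\<Sum>k\<in>UNIV. z $ k *\<^sub>R nabla \<sigma> x (chart_vec c x (b k)))"
      unfolding w by (simp add: linear_sum[OF lin] linear_scale[OF lin])
    then show "nabla \<sigma> x v = 0" by (simp add: k0)
  qed
qed

end

section \<open>Parallel sections are critical\<close>

text \<open>If \<open>f\<close> is not integrable its integral is 0 by convention, which satisfies
  the bound because \<open>B\<close> is nonnegative. The energy over an arbitrary set
  \<open>D\<close> can thus be estimated directly.\<close>

lemma abs_integral_le_indicator:
  fixes f :: "'a \<Rightarrow> real"
  assumes b: "\<And>x. \<bar>f x\<bar> \<le> B * indicator K x" and K: "K \<in> sets M" "emeasure M K < \<infinity>" and B: "B \<ge> 0"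
  shows "\<bar>LINT x|M. f x\<bar> \<le> B * measure M K"
proof (cases "integrable M f")
  case True
  have i: "integrable M (\<lambda>x. B * indicator K x)" using K by (simp add: integrable_indicator_iff)
  have "\<bar>LINT x|M. f x\<bar> \<le> (LINT x|M. \<bar>f x\<bar>)" using integral_norm_bound[of M f] by simp
  also have "\<dots> \<le> (LINT x|M. B * indicator K x)"
    by (rule integral_mono[OF _ i]) (use True b in auto)
  also have "\<dots> = B * measure M K" using K by simp
  finally show ?thesis .
qed (use B in \<open>simp add: not_integrable_integral_eq\<close>)

context metric_bundle
begin

definition energy_density :: "real \<Rightarrow> real \<Rightarrow> ('m \<Rightarrow> 'f) \<Rightarrow> 'm \<Rightarrow> real" where
  "energy_density p q \<sigma> x = 1 / (1 + sq \<sigma> x) powr p * (nn2 \<sigma> x + q * gn2 \<sigma> x)"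

lemma vertical_energy_density:
  "vertical_energy A g h nabla p q D \<sigma> = 1 / 2 * (LINT x:D|vol. energy_density p q \<sigma> x)"
  by (simp only: vertical_energy_def energy_density_def)

text \<open>The base \<open>1 + sq \<sigma> x\<close> is at least 1, so its power is bounded by the
  one with exponent \<open>\<bar>p\<bar>\<close> whatever the sign of \<open>p\<close>;
  \<open>kato\<close> absorbs the gradient term into \<open>nn2\<close>. Hence the density vanishes
  wherever \<open>nn2\<close> does.\<close>

lemma energy_density_bound:
  assumes \<sigma>: "smooth_section A E T \<sigma>" and S: "sq \<sigma> x \<le> S"
  shows "\<bar>energy_density p q \<sigma> x\<bar> \<le> (1 + S) powr \<bar>p\<bar> * (1 + \<bar>q\<bar> * S) * nn2 \<sigma> x"
proof -
  let ?s = "sq \<sigma> x" and ?N = "nn2 \<sigma> x" and ?G = "gn2 \<sigma> x"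
  have s: "0 \<le> ?s" by (rule sq_nonneg[OF \<sigma>])
  have N: "0 \<le> ?N" by (rule nabla_norm2_nonneg[OF \<sigma>])
  have "1 / (1 + ?s) powr p = (1 + ?s) powr (- p)" by (simp only: powr_minus_divide)
  also have "\<dots> \<le> (1 + ?s) powr \<bar>p\<bar>" using s by (intro powr_mono) auto
  also have "\<dots> \<le> (1 + S) powr \<bar>p\<bar>" using s S by (intro powr_mono2) auto
  finally have w: "1 / (1 + ?s) powr p \<le> (1 + S) powr \<bar>p\<bar>" .
  have G: "\<bar>?G\<bar> \<le> S * ?N"
    using gn2_nonneg[OF \<sigma>, of x] kato[OF \<sigma>, of x] mult_right_mono[OF S N] by linarith
  have "\<bar>?N + q * ?G\<bar> \<le> ?N + \<bar>q\<bar> * \<bar>?G\<bar>" using N abs_triangle_ineq[of ?N "q * ?G"] by (simp only: abs_mult)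
  also have "\<dots> \<le> ?N + \<bar>q\<bar> * (S * ?N)" using mult_left_mono[OF G, of "\<bar>q\<bar>"] by linarith
  finally have "\<bar>?N + q * ?G\<bar> \<le> (1 + \<bar>q\<bar> * S) * ?N" by (simp add: algebra_simps)
  then have "\<bar>1 / (1 + ?s) powr p\<bar> * \<bar>?N + q * ?G\<bar> \<le> (1 + S) powr \<bar>p\<bar> * ((1 + \<bar>q\<bar> * S) * ?N)"
    using w by (intro mult_mono) auto
  then show ?thesis by (simp only: energy_density_def abs_mult mult.assoc)
qed

lemma variation_section:
  assumes \<Sigma>: "smooth_variation A E T \<sigma> \<epsilon> \<Sigma>" and t: "t \<in> {-\<epsilon><..<\<epsilon>}"
  shows "smooth_section A E T (\<Sigma> t)"
  unfolding smooth_section_on_def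
proof (intro conjI ballI smooth_map_onI)
  show "\<Sigma> t x \<in> E x" for x using \<Sigma> t by (simp add: smooth_variation_def)
  fix s c k assume s: "s \<in> T" and c: "c \<in> A"
  let ?S = "snd c ` (fst c \<inter> (fst s \<inter> UNIV))"
  have S: "open ?S" using chart_image_open_Int[OF c triv_open[OF s]] by simp
  have "ck_on k ?S (\<lambda>y. (t, 0) + (0, y))"
    by (intro ck_on_add S ck_on_const ck_on_linear bounded_linear_Pair bounded_linear_zero bounded_linear_ident)
  then have r: "ck_on k ?S (\<lambda>y. (t, y))" by simp
  have u: "ck_on k ({-\<epsilon><..<\<epsilon>} \<times> snd c ` (fst c \<inter> fst s)) (\<lambda>(t, y). snd s (chart_inv c y) (\<Sigma> t (chart_inv c y)))"
    using \<Sigma> s c by (auto simp: smooth_variation_def smooth_on_def)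
  have "ck_on k ?S (\<lambda>y. (\<lambda>(t, y). snd s (chart_inv c y) (\<Sigma> t (chart_inv c y))) (t, y))"
    by (rule ck_on_compose[OF S r u]) (use t in auto)
  then show "ck_on k ?S (\<lambda>y. snd s (chart_inv c y) (\<Sigma> t (chart_inv c y)))" by simp
qed

text \<open>In a trivialisation the components of the covariant derivative of
  \<open>\<Sigma> t\<close> are continuously differentiable in \<open>t\<close> and vanish at 0, so
  they are at most a constant times \<open>\<bar>t\<bar>\<close>. The squared norm is a quadratic
  form in them with coefficients bounded on a compact ball.\<close>

lemma variation_local_bound:
  assumes \<Sigma>: "smooth_variation A E T \<sigma> \<epsilon> \<Sigma>" and par: "parallel A nabla \<sigma>"
  shows "\<exists>W C S. open W \<and> x0 \<in> W \<and> C \<ge> 0 \<and> S \<ge> 0 \<and>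
    (\<forall>x\<in>W. \<forall>t\<in>{-(\<epsilon>/2)..\<epsilon>/2}. nn2 (\<Sigma> t) x \<le> C * t\<^sup>2 \<and> sq (\<Sigma> t) x \<le> S)"
proof -
  have \<epsilon>: "\<epsilon> > 0" and \<Sigma>0: "\<Sigma> 0 = \<sigma>" using \<Sigma> by (auto simp: smooth_variation_def)
  obtain c s N \<Gamma> where c: "c \<in> A" and s: "s \<in> T" and N: "open N" "x0 \<in> N" "N \<subseteq> fst c" "N \<subseteq> fst s"
    and \<Gamma>: "\<And>i a b. continuous_on N (\<Gamma> i a b)"
    and formula: "\<And>\<sigma> z i b. smooth_section A E T \<sigma> \<and> z \<in> N \<longrightarrow>
      snd s z (nabla \<sigma> z (coord_vec c i z)) $ b =
        coord_vec c i z (\<lambda>y. snd s y (\<sigma> y) $ b) + (\<Sum>a\<in>UNIV. \<Gamma> i a b z * snd s z (\<sigma> z) $ a)"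
    using local_connection[of x0] by blast
  let ?V = "snd c ` (fst c \<inter> fst s)" and ?O = "{-\<epsilon><..<\<epsilon>} \<times> snd c ` (fst c \<inter> fst s)"
  have V: "open ?V" by (rule chart_image_open_Int[OF c triv_open[OF s]])
  have O: "open ?O" by (intro open_Times V open_greaterThanLessThan)
  have "open (snd c ` (fst c \<inter> N))" "snd c x0 \<in> snd c ` (fst c \<inter> N)"
    using chart_image_open_Int[OF c N(1)] N by auto
  then obtain r where r: "r > 0" "cball (snd c x0) r \<subseteq> snd c ` (fst c \<inter> N)"
    using open_contains_cball by blast
  let ?B = "cball (snd c x0) r" and ?P = "{-(\<epsilon>/2)..\<epsilon>/2} \<times> cball (snd c x0) r"
  have BN: "chart_inv c y \<in> N" if "y \<in> ?B" for y
    using that r(2) chart_image_Int[OF c, of y N] by blast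
  have BV: "?B \<subseteq> ?V" and Bc: "?B \<subseteq> snd c ` fst c" using r(2) N by blast+
  \<comment> \<open>Halving the time interval gives a compact parameter set inside the open domain
    of the variation.\<close>
  have PO: "?P \<subseteq> ?O" using BV \<epsilon> by auto
  define u where "u = (\<lambda>(t, y). snd s (chart_inv c y) (\<Sigma> t (chart_inv c y)))"
  have u: "ck_on k ?O u" for k
    using \<Sigma> s c unfolding u_def by (auto simp: smooth_variation_def smooth_on_def)
  define ub where "ub b z = u z $ b" for b z
  have ub: "ck_on k ?O (ub b)" for k b unfolding ub_def by (rule ck_on_nth[OF O u])
  define ui where "ui i b z = frechet_derivative (ub b) (at z) (0, axis i 1)" for i b z
  \<comment> \<open>One of the two derivatives of \<open>ub\<close> is spent on the space direction;
    the other gives the Lipschitz bound in time.\<close>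
  have ui: "ck_on 1 ?O (ui i b)" for i b
    using ub[of "Suc 1" b] unfolding ui_def ck_on.simps(2)[of 1] by blast
  have cB: "compact ?B" by (rule compact_cball)
  have cP: "compact ?P" by (intro compact_Times cB compact_Icc)
  obtain L1 where L1: "\<And>b. L1 b \<ge> 0" "\<And>b t y. t \<in> {-(\<epsilon>/2)..\<epsilon>/2} \<Longrightarrow> y \<in> ?B \<Longrightarrow> \<bar>ub b (t, y) - ub b (0, y)\<bar> \<le> L1 b * \<bar>t\<bar>"
    using ck_on_1_lipschitz_fst[OF O ub PO cB] by metis
  have "\<exists>L2. \<forall>i b. L2 i b \<ge> 0 \<and> (\<forall>t\<in>{-(\<epsilon>/2)..\<epsilon>/2}. \<forall>y\<in>?B. \<bar>ui i b (t, y) - ui i b (0, y)\<bar> \<le> L2 i b * \<bar>t\<bar>)"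
    using ck_on_1_lipschitz_fst[OF O ui PO cB] by metis
  then obtain L2 where L2: "\<And>i b. L2 i b \<ge> 0" "\<And>i b t y. t \<in> {-(\<epsilon>/2)..\<epsilon>/2} \<Longrightarrow> y \<in> ?B \<Longrightarrow> \<bar>ui i b (t, y) - ui i b (0, y)\<bar> \<le> L2 i b * \<bar>t\<bar>"
    by blast
  have "continuous_on ?B (\<lambda>y. \<Gamma> i a b (chart_inv c y))" for i a b
    by (rule continuous_on_compose2[OF \<Gamma> continuous_on_subset[OF chart_inv_continuous[OF c] Bc]]) (use BN in auto)
  then have Gb_ex: "\<exists>B\<ge>0. \<forall>y\<in>?B. \<bar>\<Gamma> i a b (chart_inv c y)\<bar> \<le> B" for i a b
    by (rule continuous_on_compact_abs_bound[OF cB])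
  define Gb where "Gb i a b = (SOME B. B \<ge> 0 \<and> (\<forall>y\<in>?B. \<bar>\<Gamma> i a b (chart_inv c y)\<bar> \<le> B))" for i a b
  have Gb: "Gb i a b \<ge> 0" "y \<in> ?B \<Longrightarrow> \<bar>\<Gamma> i a b (chart_inv c y)\<bar> \<le> Gb i a b" for i a b y
    using someI_ex[OF Gb_ex[of i a b]] unfolding Gb_def by blast+
  have "continuous_on ?B (\<lambda>y. matrix_inv (gram g c (chart_inv c y)) $ i $ j)" for i j
    by (rule continuous_on_subset[OF ck_on_imp_continuous[OF matrix_inv_gram_ck1[OF c]] Bc])
  then have Ib_ex: "\<exists>B\<ge>0. \<forall>y\<in>?B. \<bar>matrix_inv (gram g c (chart_inv c y)) $ i $ j\<bar> \<le> B" for i j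
    by (rule continuous_on_compact_abs_bound[OF cB])
  define Ib where "Ib i j = (SOME B. B \<ge> 0 \<and> (\<forall>y\<in>?B. \<bar>matrix_inv (gram g c (chart_inv c y)) $ i $ j\<bar> \<le> B))" for i j
  have Ib: "Ib i j \<ge> 0" "y \<in> ?B \<Longrightarrow> \<bar>matrix_inv (gram g c (chart_inv c y)) $ i $ j\<bar> \<le> Ib i j" for i j y
    using someI_ex[OF Ib_ex[of i j]] unfolding Ib_def by blast+
  define H where "H a b x = h x (triv_inv E s x (axis a 1)) (triv_inv E s x (axis b 1))" for a b :: 'k and x
  have "continuous_on ?B (\<lambda>y. H a b (chart_inv c y))" for a b
    unfolding H_def by (rule continuous_on_subset[OF ck_on_imp_continuous[OF smooth_map_on_ck[OF h_smooth[OF s] c, of 0]] BV])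
  then have Hb_ex: "\<exists>B\<ge>0. \<forall>y\<in>?B. \<bar>H a b (chart_inv c y)\<bar> \<le> B" for a b
    by (rule continuous_on_compact_abs_bound[OF cB])
  define Hb where "Hb a b = (SOME B. B \<ge> 0 \<and> (\<forall>y\<in>?B. \<bar>H a b (chart_inv c y)\<bar> \<le> B))" for a b
  have Hb: "Hb a b \<ge> 0" "y \<in> ?B \<Longrightarrow> \<bar>H a b (chart_inv c y)\<bar> \<le> Hb a b" for a b y
    using someI_ex[OF Hb_ex[of a b]] unfolding Hb_def by blast+
  have "continuous_on ?P (ub b)" for b
    by (rule continuous_on_subset[OF ck_on_imp_continuous[OF ub[of 0]] PO])
  then have U_ex: "\<exists>B\<ge>0. \<forall>z\<in>?P. \<bar>ub b z\<bar> \<le> B" for b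
    by (rule continuous_on_compact_abs_bound[OF cP])
  define U where "U b = (SOME B. B \<ge> 0 \<and> (\<forall>z\<in>?P. \<bar>ub b z\<bar> \<le> B))" for b
  have U: "U b \<ge> 0" "z \<in> ?P \<Longrightarrow> \<bar>ub b z\<bar> \<le> U b" for b z
    using someI_ex[OF U_ex[of b]] unfolding U_def by blast+
  \<comment> \<open>The Lipschitz constant of the component formula of
    \<open>local_connection\<close>: \<open>L2\<close> for the differentiated component, and
    \<open>L1\<close> weighted by bounds on the connection coefficients for the rest.\<close>
  define M where "M i b = L2 i b + (\<Sum>a\<in>UNIV. Gb i a b * L1 a)" for i b
  have M0: "M i b \<ge> 0" for i b unfolding M_def using L1 L2 Gb by (intro add_nonneg_nonneg sum_nonneg mult_nonneg_nonneg)
  define C where "C = (\<Sum>i\<in>UNIV. \<Sum>j\<in>UNIV. Ib i j * (\<Sum>a\<in>UNIV. \<Sum>b\<in>UNIV. M i a * M j b * Hb a b))"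
  define S where "S = (\<Sum>a\<in>UNIV. \<Sum>b\<in>UNIV. U a * U b * Hb a b)"
  have C0: "C \<ge> 0" unfolding C_def using M0 Ib Hb by (intro sum_nonneg mult_nonneg_nonneg)
  have S0: "S \<ge> 0" unfolding S_def using U Hb by (intro sum_nonneg mult_nonneg_nonneg)
  have main: "nn2 (\<Sigma> t) (chart_inv c y) \<le> C * t\<^sup>2 \<and> sq (\<Sigma> t) (chart_inv c y) \<le> S"
    if t: "t \<in> {-(\<epsilon>/2)..\<epsilon>/2}" and y: "y \<in> ?B" for t y
  proof
    let ?x = "chart_inv c y"
    have x: "?x \<in> N" "?x \<in> fst c" "?x \<in> fst s" using BN[OF y] N by auto
    have yx: "snd c ?x = y" using y Bc c by auto
    have sec: "smooth_section A E T (\<Sigma> \<tau>)" if "\<tau> \<in> {-(\<epsilon>/2)..\<epsilon>/2}" for \<tau>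
      by (rule variation_section[OF \<Sigma>]) (use that \<epsilon> in auto)
    have comp: "snd s ?x (nabla (\<Sigma> \<tau>) ?x (coord_vec c i ?x)) $ b = ui i b (\<tau>, y) + (\<Sum>a\<in>UNIV. \<Gamma> i a b ?x * ub a (\<tau>, y))"
      if \<tau>: "\<tau> \<in> {-(\<epsilon>/2)..\<epsilon>/2}" for \<tau> i b
    proof -
      have sm: "smooth_map_on A (fst s) (\<lambda>z. snd s z (\<Sigma> \<tau> z) $ b)"
        using smooth_map_on_nth[OF triv_open[OF s]] section_smooth[OF sec[OF \<tau>] s] by simp
      have z: "(\<tau>, y) \<in> ?O" using subsetD[OF PO SigmaI[OF \<tau> y]] .
      have d: "(ub b has_derivative frechet_derivative (ub b) (at (\<tau>, y))) (at (\<tau>, y))"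
        using ck_on_SucD[OF ub z] .
      have "((\<lambda>y. (\<tau>, y)) has_derivative (\<lambda>v. (0, v))) (at y)" by (auto intro!: derivative_eq_intros)
      from has_derivative_compose[OF this d]
      have "((\<lambda>y. ub b (\<tau>, y)) has_derivative (\<lambda>v. frechet_derivative (ub b) (at (\<tau>, y)) (0, v))) (at y)" .
      then have "frechet_derivative (\<lambda>y. ub b (\<tau>, y)) (at y) (axis i 1) = ui i b (\<tau>, y)"
        unfolding ui_def by (metis frechet_derivative_at)
      moreover have "coord_vec c i ?x (\<lambda>z. snd s z (\<Sigma> \<tau> z) $ b) = frechet_derivative (\<lambda>y. ub b (\<tau>, y)) (at y) (axis i 1)"
        using coord_vec_frechet[OF sm c, of y i] BV y by (auto simp: ub_def u_def)
      moreover have "snd s ?x (\<Sigma> \<tau> ?x) $ a = ub a (\<tau>, y)" for a by (simp add: ub_def u_def)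
      ultimately show ?thesis using formula sec[OF \<tau>] x(1) by simp
    qed
    \<comment> \<open>The component formula at time 0, where the section is parallel; subtracting it
      turns the formula at time \<open>t\<close> into differences to which the Lipschitz bounds
      apply.\<close>
    have zero: "0 = ui i b (0, y) + (\<Sum>a\<in>UNIV. \<Gamma> i a b ?x * ub a (0, y))" for i b
      using comp[of 0 i b] par coord_vec_in[OF c x(2)] triv_0[OF s x(3)] \<epsilon> by (simp add: \<Sigma>0 parallel_def)
    define w where "w i b = snd s ?x (nabla (\<Sigma> t) ?x (coord_vec c i ?x)) $ b" for i b
    have w: "\<bar>w i b\<bar> \<le> M i b * \<bar>t\<bar>" for i b
    proof -
      have "w i b = (ui i b (t, y) - ui i b (0, y)) + (\<Sum>a\<in>UNIV. \<Gamma> i a b ?x * (ub a (t, y) - ub a (0, y)))"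
        using comp[OF t, of i b] zero[of i b] by (simp add: w_def right_diff_distrib sum_subtractf)
      also have "\<bar>\<dots>\<bar> \<le> \<bar>ui i b (t, y) - ui i b (0, y)\<bar> + (\<Sum>a\<in>UNIV. \<bar>\<Gamma> i a b ?x\<bar> * \<bar>ub a (t, y) - ub a (0, y)\<bar>)"
        by (rule order_trans[OF abs_triangle_ineq])
          (auto intro!: add_left_mono order_trans[OF sum_abs] simp: abs_mult)
      also have "\<dots> \<le> L2 i b * \<bar>t\<bar> + (\<Sum>a\<in>UNIV. Gb i a b * (L1 a * \<bar>t\<bar>))"
        by (intro add_mono sum_mono mult_mono L2(2)[OF t y] L1(2)[OF t y] Gb y) auto
      also have "\<dots> = M i b * \<bar>t\<bar>" by (simp add: M_def distrib_right sum_distrib_right mult.assoc)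
      finally show ?thesis .
    qed
    have inE: "nabla (\<Sigma> t) ?x (coord_vec c i ?x) \<in> E ?x" for i
      by (rule nabla_in[OF sec[OF t] coord_vec_in[OF c x(2)]])
    have "nn2 (\<Sigma> t) ?x = (\<Sum>i\<in>UNIV. \<Sum>j\<in>UNIV. matrix_inv (gram g c ?x) $ i $ j * (\<Sum>a\<in>UNIV. \<Sum>b\<in>UNIV. w i a * w j b * H a b ?x))"
      unfolding nabla_norm2_chart[OF sec[OF t] c x(2)] h_triv[OF s x(3) inE inE] w_def H_def ..
    also have "\<dots> \<le> (\<Sum>i\<in>UNIV. \<Sum>j\<in>UNIV. Ib i j * (\<Sum>a\<in>UNIV. \<Sum>b\<in>UNIV. (M i a * \<bar>t\<bar>) * (M j b * \<bar>t\<bar>) * Hb a b))"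
    proof (intro sum_mono)
      fix i j
      have "\<bar>\<Sum>a\<in>UNIV. \<Sum>b\<in>UNIV. w i a * w j b * H a b ?x\<bar> \<le> (\<Sum>a\<in>UNIV. \<Sum>b\<in>UNIV. \<bar>w i a\<bar> * \<bar>w j b\<bar> * \<bar>H a b ?x\<bar>)"
        by (intro order_trans[OF sum_abs] sum_mono) (simp add: abs_mult)
      also have "\<dots> \<le> (\<Sum>a\<in>UNIV. \<Sum>b\<in>UNIV. (M i a * \<bar>t\<bar>) * (M j b * \<bar>t\<bar>) * Hb a b)"
        by (intro sum_mono mult_mono w Hb y) (auto intro!: mult_nonneg_nonneg M0)
      finally have *: "\<bar>matrix_inv (gram g c ?x) $ i $ j\<bar> * \<bar>\<Sum>a\<in>UNIV. \<Sum>b\<in>UNIV. w i a * w j b * H a b ?x\<bar>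
          \<le> Ib i j * (\<Sum>a\<in>UNIV. \<Sum>b\<in>UNIV. (M i a * \<bar>t\<bar>) * (M j b * \<bar>t\<bar>) * Hb a b)"
        by (intro mult_mono Ib y) auto
      show "matrix_inv (gram g c ?x) $ i $ j * (\<Sum>a\<in>UNIV. \<Sum>b\<in>UNIV. w i a * w j b * H a b ?x)
          \<le> Ib i j * (\<Sum>a\<in>UNIV. \<Sum>b\<in>UNIV. (M i a * \<bar>t\<bar>) * (M j b * \<bar>t\<bar>) * Hb a b)"
        by (rule order_trans[OF abs_ge_self]) (simp only: abs_mult *)
    qed
    also have "\<dots> = C * t\<^sup>2"
    proof -
      have *: "\<bar>t\<bar> * \<bar>t\<bar> = t\<^sup>2" by (simp add: power2_eq_square)
      have "(M i a * \<bar>t\<bar>) * (M j b * \<bar>t\<bar>) * Hb a b = M i a * M j b * Hb a b * t\<^sup>2" for i j a b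
        unfolding *[symmetric] by (simp only: mult_ac)
      then show ?thesis by (simp only: C_def sum_distrib_right[symmetric] mult.assoc[symmetric])
    qed
    finally show "nn2 (\<Sigma> t) ?x \<le> C * t\<^sup>2" .
    have "sq (\<Sigma> t) ?x = (\<Sum>a\<in>UNIV. \<Sum>b\<in>UNIV. ub a (t, y) * ub b (t, y) * H a b ?x)"
      unfolding h_triv[OF s x(3) section_in[OF sec[OF t]] section_in[OF sec[OF t]]] H_def ub_def u_def by simp
    also have "\<dots> \<le> (\<Sum>a\<in>UNIV. \<Sum>b\<in>UNIV. \<bar>ub a (t, y)\<bar> * \<bar>ub b (t, y)\<bar> * \<bar>H a b ?x\<bar>)"
      by (intro sum_mono, rule order_trans[OF abs_ge_self]) (simp only: abs_mult order_refl)
    also have "\<dots> \<le> S" unfolding S_def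
      by (intro sum_mono mult_mono U Hb y) (use t y in \<open>auto intro!: mult_nonneg_nonneg U\<close>)
    finally show "sq (\<Sigma> t) ?x \<le> S" .
  qed
  let ?b = "ball (snd c x0) r" and ?W = "chart_inv c ` ball (snd c x0) r"
  have b: "?b \<subseteq> snd c ` fst c" using Bc ball_subset_cball by blast
  have "open ?W" by (rule chart_inv_image(3)[OF c b open_ball])
  moreover have "x0 \<in> ?W" unfolding chart_inv_image(1)[OF c b] using N r(1) by auto
  moreover have "\<forall>x\<in>?W. \<forall>t\<in>{-(\<epsilon>/2)..\<epsilon>/2}. nn2 (\<Sigma> t) x \<le> C * t\<^sup>2 \<and> sq (\<Sigma> t) x \<le> S"
  proof (intro ballI)
    fix x t assume "x \<in> ?W" and t: "t \<in> {-(\<epsilon>/2)..\<epsilon>/2}"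
    then obtain y where "y \<in> ?B" "x = chart_inv c y" using ball_subset_cball by blast
    then show "nn2 (\<Sigma> t) x \<le> C * t\<^sup>2 \<and> sq (\<Sigma> t) x \<le> S" using main[OF t] by blast
  qed
  ultimately show ?thesis using C0 S0 by blast
qed

lemma parallel_imp_critical:
  assumes \<Sigma>: "smooth_variation A E T \<sigma> \<epsilon> \<Sigma>" and par: "parallel A nabla \<sigma>"
    and K: "compact K" and out: "\<And>t x. t \<in> {-\<epsilon><..<\<epsilon>} \<Longrightarrow> x \<notin> K \<Longrightarrow> \<Sigma> t x = \<sigma> x"
  shows "((\<lambda>t. vertical_energy A g h nabla p q D (\<Sigma> t)) has_real_derivative 0) (at 0)"
proof -
  have \<epsilon>: "\<epsilon> > 0" and \<Sigma>0: "\<Sigma> 0 = \<sigma>" using \<Sigma> by (auto simp: smooth_variation_def)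
  have "\<exists>W C S. \<forall>x. open (W x) \<and> x \<in> W x \<and> C x \<ge> 0 \<and> S x \<ge> 0 \<and>
    (\<forall>z\<in>W x. \<forall>t\<in>{-(\<epsilon>/2)..\<epsilon>/2}. nn2 (\<Sigma> t) z \<le> C x * t\<^sup>2 \<and> sq (\<Sigma> t) z \<le> S x)"
    using variation_local_bound[OF \<Sigma> par] by metis
  then obtain W C S where W: "\<And>x. open (W x)" "\<And>x. x \<in> W x" and C: "\<And>x. C x \<ge> 0" and S: "\<And>x. S x \<ge> 0"
    and b: "\<And>x z t. z \<in> W x \<Longrightarrow> t \<in> {-(\<epsilon>/2)..\<epsilon>/2} \<Longrightarrow> nn2 (\<Sigma> t) z \<le> C x * t\<^sup>2 \<and> sq (\<Sigma> t) z \<le> S x"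
    by blast
  obtain I where I: "finite I" "K \<subseteq> (\<Union>x\<in>I. W x)"
    by (rule compactE_image[OF K, of UNIV W]) (use W(1,2) in blast)+
  \<comment> \<open>A sum of nonnegative local constants dominates each of them and is 0 for an
    empty subcover.\<close>
  define C' where "C' = (\<Sum>x\<in>I. C x)"
  define S' where "S' = (\<Sum>x\<in>I. S x)"
  define B where "B = (1 + S') powr \<bar>p\<bar> * (1 + \<bar>q\<bar> * S') * C'"
  have S'0: "S' \<ge> 0" and C'0: "C' \<ge> 0" unfolding S'_def C'_def using S C by (auto intro: sum_nonneg)
  have B0: "B \<ge> 0" unfolding B_def using S'0 C'0 by (intro mult_nonneg_nonneg) auto
  have dens: "\<bar>energy_density p q (\<Sigma> t) x\<bar> \<le> B * t\<^sup>2 * indicator K x" if t: "\<bar>t\<bar> < \<epsilon> / 2" for t x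
  proof -
    have t': "t \<in> {-\<epsilon><..<\<epsilon>}" and t'': "t \<in> {-(\<epsilon>/2)..\<epsilon>/2}" using t \<epsilon> by auto
    have sec: "smooth_section A E T (\<Sigma> t)" by (rule variation_section[OF \<Sigma> t'])
    show ?thesis
    proof (cases "x \<in> K")
      case True
      then obtain z where z: "z \<in> I" "x \<in> W z" using I(2) by blast
      have CS: "C z \<le> C'" "S z \<le> S'" unfolding C'_def S'_def using z(1) I(1) C S by (auto intro: member_le_sum)
      have s: "sq (\<Sigma> t) x \<le> S'" using b[OF z(2) t''] CS by linarith
      have n: "nn2 (\<Sigma> t) x \<le> C' * t\<^sup>2" using b[OF z(2) t''] mult_right_mono[OF CS(1), of "t\<^sup>2"] by simp
      have "\<bar>energy_density p q (\<Sigma> t) x\<bar> \<le> (1 + S') powr \<bar>p\<bar> * (1 + \<bar>q\<bar> * S') * nn2 (\<Sigma> t) x"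
        by (rule energy_density_bound[OF sec s])
      also have "\<dots> \<le> (1 + S') powr \<bar>p\<bar> * (1 + \<bar>q\<bar> * S') * (C' * t\<^sup>2)"
        using S'0 by (intro mult_left_mono n mult_nonneg_nonneg) auto
      finally show ?thesis using True by (simp add: B_def mult.assoc)
    next
      case False
      have sec0: "smooth_section A E T \<sigma>" using variation_section[OF \<Sigma>, of 0] \<epsilon> by (simp add: \<Sigma>0)
      \<comment> \<open>The complement of \<open>K\<close> is open and the variation is constant on
        it, so covariant derivatives agree there with those of the parallel section.\<close>
      have "nabla (\<Sigma> t) x v = 0" if v: "v \<in> tangent_space A x" for v
      proof -
        have "nabla (\<Sigma> t) x v = nabla \<sigma> x v"
          by (rule nabla_local[OF sec sec0, of "- K"]) (use False out[OF t'] v compact_imp_closed[OF K] in auto)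
        then show ?thesis using par v by (simp add: parallel_def)
      qed
      then have "nn2 (\<Sigma> t) x = 0" by (simp add: nabla_norm2_frame frame_in h_0)
      then show ?thesis using energy_density_bound[OF sec order_refl, of p q x] False by simp
    qed
  qed
  have Kb: "K \<in> sets vol" using K by (simp add: borel_closed compact_imp_closed)
  show ?thesis
  proof (rule has_real_derivative_quadratic_bound[where d="\<epsilon> / 2" and C="1 / 2 * (B * measure vol K)"])
    fix t :: real assume t: "\<bar>t\<bar> < \<epsilon> / 2"
    have "\<bar>LINT x|vol. indicat_real D x *\<^sub>R energy_density p q (\<Sigma> t) x\<bar> \<le> (B * t\<^sup>2) * measure vol K"
    proof (rule abs_integral_le_indicator[OF _ Kb vol_compact_finite[OF K]])
      show "\<bar>indicat_real D x *\<^sub>R energy_density p q (\<Sigma> t) x\<bar> \<le> B * t\<^sup>2 * indicator K x" for x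
        using dens[OF t, of x] by (auto simp: indicator_def split: if_splits)
    qed (use B0 in simp)
    then show "\<bar>vertical_energy A g h nabla p q D (\<Sigma> t)\<bar> \<le> 1 / 2 * (B * measure vol K) * t\<^sup>2"
      unfolding vertical_energy_density set_lebesgue_integral_def by (simp add: abs_mult mult_ac)
  qed (use \<epsilon> in simp)
qed

end

section \<open>The first variation along a rescaling\<close>

lemma region_pos:
  fixes s N G :: real
  assumes \<mu>: "\<mu> \<ge> 1 / 2" and reg: "(p, q) \<in> region \<mu>" and s: "s \<ge> 0" "\<mu> * q * s \<ge> - 1"
    and N: "N > 0" and G: "0 \<le> G" "G \<le> s * N"
  shows "(1 + s - p * s) * N + p * (2 + q * s) * G > 0"
proof -
  have qs: "2 + q * s \<ge> 0"
  proof (cases "q \<ge> 0")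
    case False
    then have "q * s \<le> 0" using s by (simp add: mult_nonpos_nonneg)
    then have "\<mu> * (q * s) \<le> 1 / 2 * (q * s)" using \<mu> by (intro mult_right_mono_neg)
    then show ?thesis using s(2) by (simp add: mult.assoc)
  qed (use s in simp)
  consider "p < 0" "\<mu> * q \<le> 2 * p" | "0 \<le> p" "p \<le> 1" | "p > 1" "\<mu> * q < 1 - p"
    using reg by (auto simp: region_def region_minus_def region_zero_def region_one_def)
  then show ?thesis
  proof cases
    case 1
    have "\<mu> * q < 0" using 1 by simp
    then have q: "q < 0" using \<mu> by (simp add: mult_less_0_iff)
    have "2 * p * s \<ge> \<mu> * q * s" using 1(2) s(1) by (intro mult_right_mono)
    then have ps: "p * s \<ge> - 1 / 2" using s(2) by simp
    have "p * q * (s * s) \<ge> 0" using 1(1) q s(1) by (simp add: mult_nonpos_nonpos)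
    \<comment> \<open>At \<open>G = s * N\<close> the coefficient of \<open>N\<close> is
      \<open>1 + s + p * s + p * q * s * s\<close>, which is at least
      \<open>1 / 2 + s\<close>.\<close>
    then have c: "1 + s - p * s + p * (2 + q * s) * s > 0" using ps s(1) by (simp add: algebra_simps)
    have "p * (2 + q * s) * (s * N) \<le> p * (2 + q * s) * G"
      using G(2) 1(1) qs by (intro mult_left_mono_neg) (auto simp: mult_nonpos_nonneg)
    moreover have "(1 + s - p * s + p * (2 + q * s) * s) * N > 0" using c N by simp
    ultimately show ?thesis by (simp add: algebra_simps)
  next
    case 2
    have "p * s \<le> 1 * s" using 2 s by (intro mult_right_mono)
    then have "(1 + s - p * s) * N > 0" using N by simp
    moreover have "p * (2 + q * s) * G \<ge> 0" using 2 qs G by (intro mult_nonneg_nonneg)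
    ultimately show ?thesis by linarith
  next
    case 3
    have "1 + s - p * s > 0"
    \<comment> \<open>The strict inequality defining the region stays strict under multiplication by
      \<open>s\<close> only for positive \<open>s\<close>; at 0 the value is 1.\<close>
    proof (cases "s = 0")
      case False
      then have "\<mu> * q * s < (1 - p) * s" using 3 s by (intro mult_strict_right_mono) auto
      then show ?thesis using s(2) by (simp add: algebra_simps)
    qed simp
    then have "(1 + s - p * s) * N > 0" using N by simp
    moreover have "p * (2 + q * s) * G \<ge> 0" using 3 qs G by (intro mult_nonneg_nonneg) auto
    ultimately show ?thesis by linarith
  qed
qed

text \<open>
  The energy density of \<open>(1 + t \<psi>) \<sigma>\<close> at a point, in terms of \<open>s = |\<sigma>|\<^sup>2\<close>, \<open>N = |\<nabla>\<sigma>|\<^sup>2\<close>, \<open>G = |\<nabla>F|\<^sup>2\<close>,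
  \<open>P = \<langle>\<nabla>\<psi>, \<nabla>F\<rangle>\<close>, \<open>R = |\<nabla>\<psi>|\<^sup>2\<close> and \<open>a = \<psi>\<close>.
\<close>

definition scaled_num :: "real \<Rightarrow> real \<Rightarrow> real \<Rightarrow> real \<Rightarrow> real \<Rightarrow> real \<Rightarrow> real \<Rightarrow> real \<Rightarrow> real" where
  "scaled_num q s N G P R a t =
     (1 + t * a)\<^sup>2 * N + 2 * (1 + t * a) * t * P + t\<^sup>2 * R * s +
     q * ((1 + t * a)\<^sup>2 * (t\<^sup>2 * s\<^sup>2 * R + 2 * t * (1 + t * a) * s * P + (1 + t * a)\<^sup>2 * G))"

definition scaled_num_deriv :: "real \<Rightarrow> real \<Rightarrow> real \<Rightarrow> real \<Rightarrow> real \<Rightarrow> real \<Rightarrow> real \<Rightarrow> real \<Rightarrow> real" where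
  "scaled_num_deriv q s N G P R a t =
     2 * (1 + t * a) * a * N + 2 * P * (a * t + (1 + t * a)) + 2 * t * R * s +
     q * (2 * (1 + t * a) * a * (t\<^sup>2 * s\<^sup>2 * R + 2 * t * (1 + t * a) * s * P + (1 + t * a)\<^sup>2 * G) +
       (1 + t * a)\<^sup>2 * (2 * t * s\<^sup>2 * R + 2 * s * P * (1 + t * a + t * a) + 2 * (1 + t * a) * a * G))"

definition scaled_density :: "real \<Rightarrow> real \<Rightarrow> real \<Rightarrow> real \<Rightarrow> real \<Rightarrow> real \<Rightarrow> real \<Rightarrow> real \<Rightarrow> real \<Rightarrow> real" where
  "scaled_density p q s N G P R a t = (1 + (1 + t * a)\<^sup>2 * s) powr (- p) * scaled_num q s N G P R a t"

definition scaled_density_deriv :: "real \<Rightarrow> real \<Rightarrow> real \<Rightarrow> real \<Rightarrow> real \<Rightarrow> real \<Rightarrow> real \<Rightarrow> real \<Rightarrow> real \<Rightarrow> real" where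
  "scaled_density_deriv p q s N G P R a t =
     (- p * (1 + (1 + t * a)\<^sup>2 * s) powr (- p - 1)) * (2 * (1 + t * a) * a * s) * scaled_num q s N G P R a t +
     (1 + (1 + t * a)\<^sup>2 * s) powr (- p) * scaled_num_deriv q s N G P R a t"

lemma scaled_density_has_derivative:
  assumes "s \<ge> 0"
  shows "(scaled_density p q s N G P R a has_real_derivative scaled_density_deriv p q s N G P R a t) (at t)"
proof -
  have pos: "1 + (1 + t * a)\<^sup>2 * s > 0" using assms by (simp add: add_pos_nonneg)
  have 1: "(scaled_num q s N G P R a has_real_derivative scaled_num_deriv q s N G P R a t) (at t)"
    unfolding scaled_num_def scaled_num_deriv_def
    by (rule derivative_eq_intros refl | simp)+ (simp add: algebra_simps power2_eq_square)
  have "((\<lambda>t. 1 + (1 + t * a)\<^sup>2 * s) has_real_derivative 2 * (1 + t * a) * a * s) (at t)"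
    by (rule derivative_eq_intros refl | simp)+
  from DERIV_chain2[OF has_real_derivative_powr[OF pos, of "- p"] this]
  have 2: "((\<lambda>t. (1 + (1 + t * a)\<^sup>2 * s) powr (- p)) has_real_derivative
      (- p * (1 + (1 + t * a)\<^sup>2 * s) powr (- p - 1)) * (2 * (1 + t * a) * a * s)) (at t)" .
  from DERIV_mult[OF 2 1] show ?thesis
    unfolding scaled_density_def scaled_density_deriv_def by (simp add: add.commute mult.commute)
qed

text \<open>The second summand is \<open>2 * B s * P + 4 * a * B' s * G\<close> for
  \<open>B s = (1 + s) powr (- p) * (1 + q * s)\<close>, the integrand that harmonicity will
  annihilate. Its \<open>G\<close> term has been added and subtracted, which reduces the coefficient
  of \<open>G\<close> in the first summand to \<open>p * (2 + q * s)\<close>.\<close>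

lemma scaled_density_deriv_0:
  assumes "s \<ge> 0"
  shows "scaled_density_deriv p q s N G P R a 0 =
    2 * a * (1 + s) powr (- p - 1) * ((1 + s - p * s) * N + p * (2 + q * s) * G)
    + (2 * ((1 + s) powr (- p) * (1 + q * s)) * P
      + 4 * a * (- p * (1 + s) powr (- p - 1) * (1 + q * s) + (1 + s) powr (- p) * q) * G)"
proof -
  have "(1 + s) powr (- p) = (1 + s) powr (- p - 1) * (1 + s)"
    using assms powr_add[of "1 + s" "- p - 1" 1] by simp
  then show ?thesis
    unfolding scaled_density_deriv_def scaled_num_def scaled_num_deriv_def by (simp add: algebra_simps)
qed

text \<open>All arguments are functions on an arbitrary space, so as to cover both continuity in the
  point alone, for integrability, and joint continuity in time and point, for differentiation under
  the integral.\<close>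

lemma continuous_on_scaled_density:
  fixes s N G P R a t :: "'a::topological_space \<Rightarrow> real"
  assumes [continuous_intros]: "continuous_on X s" "continuous_on X N" "continuous_on X G" "continuous_on X P"
      "continuous_on X R" "continuous_on X a" "continuous_on X t"
    and s: "\<And>x. x \<in> X \<Longrightarrow> s x \<ge> 0"
  shows "continuous_on X (\<lambda>x. scaled_density p q (s x) (N x) (G x) (P x) (R x) (a x) (t x))"
    and "continuous_on X (\<lambda>x. scaled_density_deriv p q (s x) (N x) (G x) (P x) (R x) (a x) (t x))"
proof -
  have pos: "1 + (1 + t x * a x)\<^sup>2 * s x > 0" if "x \<in> X" for x using s[OF that] by (simp add: add_pos_nonneg)
  then have ne: "\<forall>x\<in>X. 1 + (1 + t x * a x)\<^sup>2 * s x \<noteq> 0" by fastforce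
  have w [continuous_intros]: "continuous_on X (\<lambda>x. (1 + (1 + t x * a x)\<^sup>2 * s x) powr r)" for r
    by (rule continuous_on_powr[OF _ _ ne]) (intro continuous_intros)+
  have n: "continuous_on X (\<lambda>x. scaled_num q (s x) (N x) (G x) (P x) (R x) (a x) (t x))"
    unfolding scaled_num_def
    by (rule continuous_on_add continuous_on_mult continuous_on_power continuous_on_const assms(1-7))+
  have n': "continuous_on X (\<lambda>x. scaled_num_deriv q (s x) (N x) (G x) (P x) (R x) (a x) (t x))"
    unfolding scaled_num_deriv_def
    by (rule continuous_on_add continuous_on_mult continuous_on_power continuous_on_const assms(1-7))+
  show "continuous_on X (\<lambda>x. scaled_density p q (s x) (N x) (G x) (P x) (R x) (a x) (t x))"
    unfolding scaled_density_def by (rule continuous_on_mult w n)+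
  show "continuous_on X (\<lambda>x. scaled_density_deriv p q (s x) (N x) (G x) (P x) (R x) (a x) (t x))"
    unfolding scaled_density_deriv_def
    by (rule n n' w continuous_on_add continuous_on_mult continuous_on_const assms(1-7))+
qed

context metric_bundle
begin

section \<open>Continuity of traces and of the energy density\<close>

lemma continuous_on_charts:
  assumes "\<And>c. c \<in> A \<Longrightarrow> continuous_on (fst c) f" shows "continuous_on UNIV f"
proof -
  have "continuous_on (\<Union>c\<in>A. fst c) f"
    by (rule continuous_on_open_UN) (use assms chart_open in auto)
  moreover have "(\<Union>c\<in>A. fst c) = UNIV" using chart_ex by auto
  ultimately show ?thesis by simp
qed

text \<open>The inner product of the gradients of \<open>f\<close> and \<open>f'\<close>.\<close>

definition trace2 :: "('m \<Rightarrow> real) \<Rightarrow> ('m \<Rightarrow> real) \<Rightarrow> 'm \<Rightarrow> real" where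
  "trace2 f f' x = (\<Sum>k\<in>UNIV. frame x k f * frame x k f')"

text \<open>The summands need not be continuous, as \<open>frame\<close> is an arbitrary choice at
  each point; the sum is, because \<open>frame_trace\<close> expresses it through coordinate
  quantities.\<close>

lemma trace_continuous:
  assumes Q: "\<And>x. tv_bilinear A x (Q x)"
    and cont: "\<And>c i j. c \<in> A \<Longrightarrow> continuous_on (fst c) (\<lambda>x. Q x (coord_vec c i x) (coord_vec c j x))"
  shows "continuous_on UNIV (\<lambda>x. \<Sum>k\<in>UNIV. Q x (frame x k) (frame x k))"
proof (rule continuous_on_charts)
  fix c assume c: "c \<in> A"
  have inv: "continuous_on (fst c) (\<lambda>x. matrix_inv (gram g c x) $ i $ j)" for i j
  proof -
    have "continuous_on (fst c) (\<lambda>x. matrix_inv (gram g c (chart_inv c (snd c x))) $ i $ j)"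
      by (rule continuous_on_compose2[OF ck_on_imp_continuous[OF matrix_inv_gram_ck1[OF c]] chart_continuous[OF c]]) auto
    then show ?thesis by (rule continuous_on_eq) (use c in auto)
  qed
  have "continuous_on (fst c) (\<lambda>x. \<Sum>i\<in>UNIV. \<Sum>j\<in>UNIV. matrix_inv (gram g c x) $ i $ j * Q x (coord_vec c i x) (coord_vec c j x))"
    by (intro continuous_intros inv cont c)
  then show "continuous_on (fst c) (\<lambda>x. \<Sum>k\<in>UNIV. Q x (frame x k) (frame x k))"
    by (rule continuous_on_eq) (use frame_trace[OF Q frame c] in auto)
qed

lemma differential_trace_continuous:
  assumes f: "smooth_map_on A UNIV f" and f': "smooth_map_on A UNIV f'"
  shows "continuous_on UNIV (\<lambda>x. \<Sum>k\<in>UNIV. frame x k f * frame x k f')"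
  by (rule trace_continuous[where Q="\<lambda>x u v. u f * v f'", OF differential_bilinear])
    (intro continuous_intros coord_vec_continuous f f')

lemma half_sq_smooth:
  assumes \<sigma>: "smooth_section A E T \<sigma>" shows "smooth_map_on A UNIV (\<lambda>y. 1 / 2 * sq \<sigma> y)"
  by (intro smooth_map_on_mult open_UNIV smooth_map_on_const sq_smooth \<sigma>)

lemma nn2_continuous:
  assumes \<sigma>: "smooth_section A E T \<sigma>" shows "continuous_on UNIV (nn2 \<sigma>)"
proof -
  have "continuous_on UNIV (\<lambda>x. \<Sum>k\<in>UNIV. h x (nabla \<sigma> x (frame x k)) (nabla \<sigma> x (frame x k)))"
    by (rule trace_continuous[where Q="\<lambda>x u v. h x (nabla \<sigma> x u) (nabla \<sigma> x v)", OF nabla_bilinear[OF \<sigma>]])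
      (intro smooth_map_on_continuous h_sections_smooth nabla_smooth \<sigma> chart_open)
  then show ?thesis by (simp only: nabla_norm2_frame[symmetric])
qed

lemma gn2_frame: "gn2 \<sigma> x = (\<Sum>k\<in>UNIV. frame x k (\<lambda>y. 1 / 2 * sq \<sigma> y) * frame x k (\<lambda>y. 1 / 2 * sq \<sigma> y))"
  by (simp only: grad_norm2_frame[OF frame] power2_eq_square)

lemma gn2_continuous:
  assumes \<sigma>: "smooth_section A E T \<sigma>" shows "continuous_on UNIV (gn2 \<sigma>)"
proof -
  have "continuous_on UNIV (\<lambda>x. gn2 \<sigma> x)"
    unfolding gn2_frame by (rule differential_trace_continuous[OF half_sq_smooth[OF \<sigma>] half_sq_smooth[OF \<sigma>]])
  then show ?thesis .
qed

lemma sq_continuous: "smooth_section A E T \<sigma> \<Longrightarrow> continuous_on UNIV (sq \<sigma>)"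
  by (intro smooth_map_on_continuous sq_smooth open_UNIV)

lemma energy_density_continuous:
  assumes \<sigma>: "smooth_section A E T \<sigma>" shows "continuous_on UNIV (energy_density p q \<sigma>)"
proof -
  have pos: "1 + sq \<sigma> x > 0" for x using sq_nonneg[OF \<sigma>, of x] by linarith
  then have ne: "\<forall>x\<in>UNIV. 1 + sq \<sigma> x \<noteq> 0" by (metis less_irrefl)
  have "continuous_on UNIV (\<lambda>x. 1 / (1 + sq \<sigma> x) powr p * (nn2 \<sigma> x + q * gn2 \<sigma> x))"
    by (intro continuous_on_mult continuous_on_divide continuous_on_const continuous_on_add continuous_on_powr
        sq_continuous nn2_continuous gn2_continuous \<sigma> ne) (use ne in auto)
  then show ?thesis by (simp only: energy_density_def[abs_def])
qed

section \<open>The rescaled sections \<open>(1 + t \<psi>) \<sigma>\<close>\<close>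

definition rescale :: "('m \<Rightarrow> real) \<Rightarrow> ('m \<Rightarrow> 'f) \<Rightarrow> real \<Rightarrow> 'm \<Rightarrow> 'f" where
  "rescale \<psi> \<sigma> t x = (1 + t * \<psi> x) *\<^sub>R \<sigma> x"

abbreviation cross :: "('m \<Rightarrow> real) \<Rightarrow> ('m \<Rightarrow> 'f) \<Rightarrow> 'm \<Rightarrow> real" where
  "cross \<psi> \<sigma> \<equiv> trace2 \<psi> (\<lambda>y. 1 / 2 * sq \<sigma> y)"

lemma rescale_factor_smooth: "smooth_map_on A UNIV (\<psi> :: 'm \<Rightarrow> real) \<Longrightarrow> smooth_map_on A UNIV (\<lambda>x. 1 + t * \<psi> x)"
  using smooth_map_on_add[OF open_UNIV smooth_map_on_const smooth_map_on_mult[OF open_UNIV smooth_map_on_const]]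
  by blast

lemma rescale_section:
  "smooth_section A E T \<sigma> \<Longrightarrow> smooth_map_on A UNIV \<psi> \<Longrightarrow> smooth_section A E T (rescale \<psi> \<sigma> t)"
  unfolding rescale_def[abs_def] by (intro section_scale rescale_factor_smooth)

lemma rescale_variation:
  assumes \<sigma>: "smooth_section A E T \<sigma>" and \<psi>: "smooth_map_on A UNIV \<psi>"
  shows "smooth_variation A E T \<sigma> 1 (rescale \<psi> \<sigma>)"
  unfolding smooth_variation_def
proof (intro conjI ballI)
  show "rescale \<psi> \<sigma> 0 = \<sigma>" by (simp add: rescale_def fun_eq_iff)
  show "\<forall>x. rescale \<psi> \<sigma> t x \<in> E x" for t using section_in[OF rescale_section[OF \<sigma> \<psi>]] by blast
  fix s c assume s: "s \<in> T" and c: "c \<in> A"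
  let ?V = "snd c ` (fst c \<inter> fst s)" and ?O = "{-1<..<1::real} \<times> snd c ` (fst c \<inter> fst s)"
  have V: "open ?V" by (rule chart_image_open_Int[OF c triv_open[OF s]])
  have O: "open ?O" by (intro open_Times V open_greaterThanLessThan)
  have "ck_on k ?O (\<lambda>(t, y). snd s (chart_inv c y) (rescale \<psi> \<sigma> t (chart_inv c y)))" for k
  proof -
    have 1: "ck_on k ?O (\<lambda>z. \<psi> (chart_inv c (snd z)))"
      by (rule ck_on_compose[OF O ck_on_linear[OF bounded_linear_snd] ck_on_subset[OF smooth_map_on_ck[OF \<psi> c]], of ?V]) auto
    have 2: "ck_on k ?O (\<lambda>z. snd s (chart_inv c (snd z)) (\<sigma> (chart_inv c (snd z))))"
      by (rule ck_on_compose[OF O ck_on_linear[OF bounded_linear_snd] ck_on_subset[OF smooth_map_on_ck[OF section_smooth[OF \<sigma> s] c]], of ?V]) auto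
    have 3: "ck_on k ?O (\<lambda>z. (1 + fst z * \<psi> (chart_inv c (snd z))) *\<^sub>R snd s (chart_inv c (snd z)) (\<sigma> (chart_inv c (snd z))))"
      by (intro ck_on_scaleR ck_on_add ck_on_mult ck_on_const O 1 2 ck_on_linear bounded_linear_fst)
    have eq: "(1 + fst z * \<psi> (chart_inv c (snd z))) *\<^sub>R snd s (chart_inv c (snd z)) (\<sigma> (chart_inv c (snd z)))
      = (\<lambda>(t, y). snd s (chart_inv c y) (rescale \<psi> \<sigma> t (chart_inv c y))) z" if "z \<in> ?O" for z
    proof -
      have "chart_inv c (snd z) \<in> fst s" using that c by auto
      then show ?thesis by (simp add: split_beta rescale_def triv_scale[OF s _ section_in[OF \<sigma>]])
    qed
    show ?thesis by (rule iffD1[OF ck_on_cong[OF O] 3]) (rule eq)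
  qed
  then show "smooth_on ?O (\<lambda>(t, y). snd s (chart_inv c y) (rescale \<psi> \<sigma> t (chart_inv c y)))"
    by (simp add: smooth_on_def)
qed simp

text \<open>By the Leibniz rule the covariant derivative along \<open>v\<close> is \<open>(t * v
  \<psi>) *\<^sub>R \<sigma> x + (1 + t * \<psi> x) *\<^sub>R nabla \<sigma> x v\<close>. Pairing it
  with itself and with the section and summing over the frame leaves, at each point, a function of
  \<open>t\<close> with scalar parameters.\<close>

lemma rescale_density:
  assumes \<sigma>: "smooth_section A E T \<sigma>" and \<psi>: "smooth_map_on A UNIV \<psi>"
  shows "energy_density p q (rescale \<psi> \<sigma> t) x =
    scaled_density p q (sq \<sigma> x) (nn2 \<sigma> x) (gn2 \<sigma> x) (cross \<psi> \<sigma> x) (trace2 \<psi> \<psi> x) (\<psi> x) t"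
proof -
  let ?f = "1 + t * \<psi> x" and ?s = "sq \<sigma> x"
  define F where "F = (\<lambda>y. 1 / 2 * sq \<sigma> y)"
  have sec: "smooth_section A E T (rescale \<psi> \<sigma> t)" by (rule rescale_section[OF \<sigma> \<psi>])
  have vF: "h x (nabla \<sigma> x v) (\<sigma> x) = v F" if "v \<in> tangent_space A x" for v
    unfolding F_def by (rule tangent_vec_half_sq[OF \<sigma> that, symmetric])
  have nab: "nabla (rescale \<psi> \<sigma> t) x v = (t * v \<psi>) *\<^sub>R \<sigma> x + ?f *\<^sub>R nabla \<sigma> x v" if v: "v \<in> tangent_space A x" for v
  proof -
    have "v (\<lambda>y. 1 + t * \<psi> y) = v (\<lambda>y. 1) + v (\<lambda>y. t * \<psi> y)"
      by (rule tangent_vec_add[OF v smooth_map_on_const smooth_map_on_mult[OF open_UNIV smooth_map_on_const \<psi>]]) simp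
    also have "\<dots> = t * v \<psi>" using tangent_vec_const[OF v] tangent_vec_cmult[OF v \<psi>] by simp
    finally show ?thesis
      unfolding rescale_def[abs_def] using nabla_leibniz[OF \<sigma> rescale_factor_smooth[OF \<psi>] v, of t] by simp
  qed
  have sq: "sq (rescale \<psi> \<sigma> t) x = ?f\<^sup>2 * ?s"
    by (simp add: rescale_def h_scale section_in[OF \<sigma>] power2_eq_square)
  have hn: "h x (nabla (rescale \<psi> \<sigma> t) x v) (nabla (rescale \<psi> \<sigma> t) x v) =
      ?f\<^sup>2 * h x (nabla \<sigma> x v) (nabla \<sigma> x v) + 2 * ?f * t * (v \<psi> * v F) + t\<^sup>2 * ?s * (v \<psi> * v \<psi>)"
    if v: "v \<in> tangent_space A x" for v
  proof -
    let ?n = "nabla \<sigma> x v"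
    have E: "\<sigma> x \<in> E x" "?n \<in> E x" using section_in[OF \<sigma>] nabla_in[OF \<sigma> v] by auto
    have E2: "(t * v \<psi>) *\<^sub>R \<sigma> x + ?f *\<^sub>R ?n \<in> E x" by (intro fibre_add fibre_scale E)
    show ?thesis
      unfolding nab[OF v] h_lin[OF E E2] h_lin2[OF E E(1)] h_lin2[OF E E(2)] h_sym[OF E] vF[OF v]
      by (simp add: algebra_simps power2_eq_square)
  qed
  have hs: "h x (nabla (rescale \<psi> \<sigma> t) x v) (rescale \<psi> \<sigma> t x) = ?f * (t * ?s * v \<psi> + ?f * v F)"
    if v: "v \<in> tangent_space A x" for v
  proof -
    let ?n = "nabla \<sigma> x v"
    have E: "\<sigma> x \<in> E x" "?n \<in> E x" using section_in[OF \<sigma>] nabla_in[OF \<sigma> v] by auto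
    have "h x ((t * v \<psi>) *\<^sub>R \<sigma> x + ?f *\<^sub>R ?n) (?f *\<^sub>R \<sigma> x) = ?f * (t * ?s * v \<psi> + ?f * v F)"
      unfolding h_lin[OF E fibre_scale[OF E(1)]]
      using h_scale[OF E(1) E(1), of 1 ?f] h_scale[OF E(2) E(1), of 1 ?f] vF[OF v]
      by (simp add: algebra_simps)
    then show ?thesis unfolding nab[OF v] by (simp only: rescale_def)
  qed
  have N: "nn2 (rescale \<psi> \<sigma> t) x = ?f\<^sup>2 * nn2 \<sigma> x + 2 * ?f * t * cross \<psi> \<sigma> x + t\<^sup>2 * ?s * trace2 \<psi> \<psi> x"
    unfolding nabla_norm2_frame trace2_def F_def[symmetric] sum_distrib_left
    by (simp add: hn[OF frame_in] sum.distrib)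
  have gF: "grad_norm2 A g F x = (\<Sum>k\<in>UNIV. frame x k F * frame x k F)"
    unfolding F_def by (rule gn2_frame)
  have "gn2 (rescale \<psi> \<sigma> t) x = (\<Sum>k\<in>UNIV. ?f\<^sup>2 * (t\<^sup>2 * ?s\<^sup>2 * (frame x k \<psi> * frame x k \<psi>)
      + 2 * t * ?f * ?s * (frame x k \<psi> * frame x k F) + ?f\<^sup>2 * (frame x k F * frame x k F)))"
    unfolding grad_half_sq[OF sec]
    by (intro sum.cong refl) (simp add: hs[OF frame_in] power2_eq_square algebra_simps)
  also have "\<dots> = ?f\<^sup>2 * (t\<^sup>2 * ?s\<^sup>2 * trace2 \<psi> \<psi> x + 2 * t * ?f * ?s * cross \<psi> \<sigma> x + ?f\<^sup>2 * gn2 \<sigma> x)"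
    unfolding F_def[symmetric] trace2_def gF by (simp only: sum.distrib[symmetric] sum_distrib_left)
  finally have G: "gn2 (rescale \<psi> \<sigma> t) x = ?f\<^sup>2 * (t\<^sup>2 * ?s\<^sup>2 * trace2 \<psi> \<psi> x + 2 * t * ?f * ?s * cross \<psi> \<sigma> x + ?f\<^sup>2 * gn2 \<sigma> x)" .
  show ?thesis
    unfolding energy_density_def scaled_density_def scaled_num_def sq N G powr_minus_divide by (simp only: mult_ac)
qed

lemma rescale_density_local:
  assumes \<sigma>: "smooth_section A E T \<sigma>" and \<psi>: "smooth_map_on A UNIV \<psi>"
    and W: "open W" "x \<in> W" "\<And>y. y \<in> W \<Longrightarrow> \<psi> y = 0"
  shows "energy_density p q (rescale \<psi> \<sigma> t) x = energy_density p q \<sigma> x"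
proof -
  have "frame x k \<psi> = 0" for k
  proof -
    have "frame x k \<psi> = frame x k (\<lambda>y. 0)" by (rule tangent_vec_local[OF frame_in W(1,2)]) (simp add: W(3))
    then show ?thesis using tangent_vec_const[OF frame_in] by simp
  qed
  then have "cross \<psi> \<sigma> x = 0" "trace2 \<psi> \<psi> x = 0" by (simp_all add: trace2_def)
  then show ?thesis
    unfolding rescale_density[OF \<sigma> \<psi>] using W(2,3)
    by (simp add: scaled_density_def scaled_num_def energy_density_def powr_minus_divide)
qed

lemma trace_chart:
  assumes c: "c \<in> A" "x \<in> fst c"
  shows "(\<Sum>k\<in>UNIV. frame x k f * frame x k f') =
    (\<Sum>i\<in>UNIV. coord_vec c i x f * (\<Sum>j\<in>UNIV. matrix_inv (gram g c x) $ i $ j * coord_vec c j x f'))"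
  using frame_trace[OF differential_bilinear frame c, of f f'] by (simp add: sum_distrib_left mult_ac)

section \<open>Critical sections are parallel\<close>

text \<open>
  The weak form of \<open>\<Delta> u = 0\<close>, tested against \<open>\<psi> B(u)\<close> for a bump function \<open>\<psi>\<close> supported in a chart.
\<close>

lemma harmonic_weak:
  assumes u: "harmonic_function A g u" and c: "c \<in> A"
    and ab: "cbox a b \<subseteq> snd c ` fst c" and r: "r > 0" "cball y0 r \<subseteq> cbox a b"
    and B: "\<And>x. (B has_real_derivative B' (u x)) (at (u x))" and B': "continuous_on (range u) B'"
  shows "integral (cbox a b) (\<lambda>y. chart_density c y *
    (B (u (chart_inv c y)) * trace2 (chart_bump c y0 r) u (chart_inv c y) +
     chart_bump c y0 r (chart_inv c y) * B' (u (chart_inv c y)) * trace2 u u (chart_inv c y))) = 0"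
proof -
  let ?V = "snd c ` fst c" and ?K = "cball y0 r" and ?\<psi> = "chart_bump c y0 r"
  have V: "open ?V" by (rule chart_image_open[OF c])
  have KV: "?K \<subseteq> ?V" using r(2) ab by blast
  have us: "smooth_map_on A UNIV u" using u by (simp add: harmonic_function_def)
  have \<psi>s: "smooth_map_on A UNIV ?\<psi>" by (rule chart_bump_smooth[OF c r(1) KV])
  define w where "w y = u (chart_inv c y)" for y
  have w: "ck_on k ?V w" for k using smooth_map_on_ck[OF us c, of k] by (simp add: w_def[abs_def])
  define pw where "pw j y = frechet_derivative w (at y) (axis j 1)" for j y
  have pw: "ck_on 1 ?V (pw j)" for j
    using w[of "Suc 1"] unfolding pw_def[abs_def] ck_on.simps(2)[of 1] by blast
  \<comment> \<open>The coordinate components of the density times the gradient of \<open>u\<close>;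
    the sum of their partial derivatives is the density times the divergence, which is 0.\<close>
  define Z where "Z i y = chart_density c y * (\<Sum>j\<in>UNIV. matrix_inv (gram g c (chart_inv c y)) $ i $ j * pw j y)" for i y
  have Z: "ck_on 1 ?V (Z i)" for i
    unfolding Z_def[abs_def] using vol_density_ck1[OF c]
    by (intro ck_on_mult ck_on_sum V matrix_inv_gram_ck1 c pw) (simp add: chart_density_def[abs_def])
  have Bw: "ck_on 1 ?V (\<lambda>y. B (w y))"
  proof (rule ck_on_1_real_compose[OF V w, where \<phi>'=B'])
    show "(B has_real_derivative B' (w y)) (at (w y))" for y unfolding w_def by (rule B)
    show "continuous_on (w ` ?V) B'" by (rule continuous_on_subset[OF B']) (auto simp: w_def)
  qed
  define L where "L i y = B (w y) * Z i y" for i y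
  have L: "ck_on 1 ?V (L i)" for i unfolding L_def[abs_def] by (intro ck_on_mult V Bw Z)
  define \<beta> where "\<beta> = bump y0 r"
  have \<beta>: "ck_on k S \<beta>" if "open S" for k S unfolding \<beta>_def by (rule smooth_onD[OF smooth_on_bump[OF that]])
  have \<beta>0: "\<beta> y = 0" if "y \<notin> ?K" for y
    using bump_pos_iff(2)[OF r(1), of y0 y] that unfolding \<beta>_def by auto
  \<comment> \<open>The components of \<open>\<psi> B(u) \<nabla>u\<close> times the density,
    extended by 0. The cut-off vanishes off a closed ball inside the chart image, so the extension
    is continuously differentiable on the whole model space.\<close>
  define Y where "Y i y = \<beta> y * (if y \<in> ?V then L i y else 0)" for i y
  have Y: "ck_on 1 UNIV (Y i)" for i
  proof -
    have oK: "open (- ?K)" by (intro open_Compl closed_cball)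
    have 1: "ck_on 1 ?V (Y i)"
      by (rule iffD1[OF ck_on_cong[OF V] ck_on_mult[OF V \<beta>[OF V] L[of i]]]) (simp add: Y_def)
    have 2: "ck_on 1 (- ?K) (Y i)"
      by (rule iffD1[OF ck_on_cong[OF oK] ck_on_const[of 1 _ 0]]) (use \<beta>0 in \<open>auto simp: Y_def\<close>)
    have "?V \<union> - ?K = UNIV" using KV by blast
    then show ?thesis using ck_on_Un[OF V oK 1 2] by simp
  qed
  let ?d = "\<lambda>f y i. frechet_derivative f (at y) (axis i 1)"
  have int0: "integral (cbox a b) (\<lambda>y. ?d (Y i) y i) = 0" for i
  proof (rule integral_directional_derivative_eq_0[OF _ _ compact_cball _ r(2)])
    show "Y i differentiable at y" "continuous_on UNIV (\<lambda>y. ?d (Y i) y i)" for y using Y[of i] by simp_all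
    show "Y i y = 0" if "y \<notin> ?K" for y using \<beta>0[OF that] by (simp add: Y_def)
  qed
  have cont: "continuous_on (cbox a b) (\<lambda>y. ?d (Y i) y i)" for i
    using Y[of i] by (auto intro: continuous_on_subset)
  have "integral (cbox a b) (\<lambda>y. \<Sum>i\<in>UNIV. ?d (Y i) y i) = (\<Sum>i\<in>UNIV. integral (cbox a b) (\<lambda>y. ?d (Y i) y i))"
    by (rule integral_sum) (auto intro: integrable_continuous cont)
  then have "integral (cbox a b) (\<lambda>y. \<Sum>i\<in>UNIV. ?d (Y i) y i) = 0" by (simp add: int0)
  moreover have "(\<Sum>i\<in>UNIV. ?d (Y i) y i) = chart_density c y *
    (B (u (chart_inv c y)) * trace2 ?\<psi> u (chart_inv c y) +
     ?\<psi> (chart_inv c y) * B' (u (chart_inv c y)) * trace2 u u (chart_inv c y))" if y: "y \<in> cbox a b" for y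
  proof -
    let ?x = "chart_inv c y"
    have yV: "y \<in> ?V" using y ab by blast
    have x: "?x \<in> fst c" and yx: "snd c ?x = y" using yV c by auto
    have d\<beta>: "(\<beta> has_derivative frechet_derivative \<beta> (at y)) (at y)"
      using ck_on_SucD[OF \<beta>[OF V] yV] .
    have dw: "(w has_derivative frechet_derivative w (at y)) (at y)"
      using ck_on_SucD[OF w yV] .
    have dZ: "(Z i has_derivative frechet_derivative (Z i) (at y)) (at y)" for i
      using ck_on_SucD[of 0 ?V "Z i" y] Z[of i] yV by simp
    have dB: "((\<lambda>y. B (w y)) has_derivative (\<lambda>v. frechet_derivative w (at y) v * B' (w y))) (at y)"
      using DERIV_compose_FDERIV[OF B[of ?x, folded w_def] dw] .
    have dY: "?d (Y i) y i = \<beta> y * (B (w y) * ?d (Z i) y i + (pw i y * B' (w y)) * Z i y) + ?d \<beta> y i * (B (w y) * Z i y)" for i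
    proof -
      have "((\<lambda>y. \<beta> y * (B (w y) * Z i y)) has_derivative
        (\<lambda>v. \<beta> y * (B (w y) * frechet_derivative (Z i) (at y) v + (frechet_derivative w (at y) v * B' (w y)) * Z i y)
           + frechet_derivative \<beta> (at y) v * (B (w y) * Z i y))) (at y)"
        by (rule has_derivative_mult[OF d\<beta> has_derivative_mult[OF dB dZ]])
      then have "(Y i has_derivative
        (\<lambda>v. \<beta> y * (B (w y) * frechet_derivative (Z i) (at y) v + (frechet_derivative w (at y) v * B' (w y)) * Z i y)
           + frechet_derivative \<beta> (at y) v * (B (w y) * Z i y))) (at y)"
        by (rule has_derivative_transform_within_open[OF _ V yV]) (simp add: Y_def L_def)
      from frechet_derivative_at[OF this, symmetric] show ?thesis by (simp add: pw_def)
    qed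
    have \<beta>\<psi>: "?\<psi> (chart_inv c z) = \<beta> z" if "z \<in> ?V" for z
      using that c by (auto simp: chart_bump_def \<beta>_def)
    have cw: "coord_vec c j ?x u = pw j y" for j
      using coord_vec_frechet[OF us c, of y j] yV by (simp add: pw_def w_def[abs_def])
    have c\<beta>: "coord_vec c i ?x ?\<psi> = ?d \<beta> y i" for i
    proof -
      have "((\<lambda>y. ?\<psi> (chart_inv c y)) has_derivative frechet_derivative \<beta> (at y)) (at y)"
        by (rule has_derivative_transform_within_open[OF d\<beta> V yV]) (simp add: \<beta>\<psi>)
      from frechet_derivative_at[OF this, symmetric]
      show ?thesis using coord_vec_frechet[OF \<psi>s c, of y i] yV by simp
    qed
    have div: "(\<Sum>i\<in>UNIV. ?d (Z i) y i) = 0"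
    proof -
      have "divergence g c (gradient A g u) ?x = 0"
        using u c x by (auto simp: harmonic_function_def)
      then have "(\<Sum>i\<in>UNIV. coord_vec c i ?x (\<lambda>z. vol_density g c z * gradient A g u z (\<lambda>z. snd c z $ i))) = 0"
        using vol_density_pos[OF c x] by (simp add: divergence_def)
      moreover have "coord_vec c i ?x (\<lambda>z. vol_density g c z * gradient A g u z (\<lambda>z. snd c z $ i)) = ?d (Z i) y i" for i
      proof -
        let ?F = "(\<lambda>z. vol_density g c z * gradient A g u z (\<lambda>z. snd c z $ i)) \<circ> chart_inv c"
        have "Z i z = ?F z" if z: "z \<in> ?V" for z
        proof -
          have zx: "chart_inv c z \<in> fst c" using z c by auto
          have "coord_vec c j (chart_inv c z) u = pw j z" for j
            using coord_vec_frechet[OF us c, of z j] z by (simp add: pw_def w_def[abs_def])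
          then have "gradient A g u (chart_inv c z) (\<lambda>z. snd c z $ i) = (\<Sum>j\<in>UNIV. matrix_inv (gram g c (chart_inv c z)) $ i $ j * pw j z)"
            unfolding gradient_chart(1)[OF c zx] chart_vec_coord_fun[OF c zx] by (simp add: matrix_vector_mult_def)
          then show ?thesis by (simp add: Z_def chart_density_def)
        qed
        then have F: "(?F has_derivative frechet_derivative (Z i) (at y)) (at y)"
          by (rule has_derivative_transform_within_open[OF dZ V yV])
        then have "?F differentiable (at (snd c ?x))" unfolding yx differentiable_def by blast
        from chart_vec_differentiable[OF this, of "axis i 1"] show ?thesis
          unfolding coord_vec_def yx frechet_derivative_at[OF F, symmetric] .
      qed
      ultimately show ?thesis by simp
    qed
    have tr: "chart_density c y * trace2 f u ?x = (\<Sum>i\<in>UNIV. coord_vec c i ?x f * Z i y)" for f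
      unfolding trace2_def trace_chart[OF c x] cw Z_def by (simp add: sum_distrib_left mult_ac)
    have "(\<Sum>i\<in>UNIV. ?d (Y i) y i) = \<beta> y * B (w y) * (\<Sum>i\<in>UNIV. ?d (Z i) y i)
      + \<beta> y * B' (w y) * (\<Sum>i\<in>UNIV. pw i y * Z i y) + B (w y) * (\<Sum>i\<in>UNIV. ?d \<beta> y i * Z i y)"
      unfolding dY by (simp add: sum.distrib sum_distrib_left algebra_simps)
    also have "\<dots> = chart_density c y * (B (w y) * trace2 ?\<psi> u ?x + \<beta> y * B' (w y) * trace2 u u ?x)"
      using tr[of u] tr[of ?\<psi>] by (simp add: div cw c\<beta> algebra_simps)
    finally show ?thesis using \<beta>\<psi>[OF yV] by (simp add: w_def)
  qed
  ultimately show ?thesis by (subst (asm) integral_cong) (assumption, simp)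
qed

text \<open>A relatively compact domain is open, whereas differentiation under the integral and the
  vanishing criterion for continuous integrands live on a closed box. The two integrals agree
  because the boundary of a box is a null set.\<close>

lemma integral_vol_box:
  assumes c: "c \<in> A" and ab: "cbox a b \<subseteq> snd c ` fst c" and f: "continuous_on UNIV (f :: 'm \<Rightarrow> real)"
  shows "(LINT x:chart_inv c ` box a b|vol. f x) = integral (cbox a b) (\<lambda>y. chart_density c y * f (chart_inv c y))"
proof -
  let ?D = "chart_inv c ` box a b"
  have box: "box a b \<subseteq> snd c ` fst c" using ab box_subset_cbox by blast
  have D: "open ?D" by (rule chart_inv_image(3)[OF c box open_box])
  have f': "(\<lambda>x. indicator ?D x * f x) \<in> borel_measurable borel"
    using borel_open[OF D] borel_measurable_continuous_onI[OF f] by (intro borel_measurable_times borel_measurable_indicator) auto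
  have Dc: "?D \<subseteq> fst c" using chart_inv_image(1)[OF c box] by blast
  let ?F = "\<lambda>y. chart_density c y * f (chart_inv c y)"
  have cont: "continuous_on (cbox a b) ?F"
  proof (rule continuous_on_subset[OF _ ab])
    show "continuous_on (snd c ` fst c) ?F"
      using ck_on_imp_continuous[OF vol_density_ck1[OF c]] continuous_on_compose2[OF f chart_inv_continuous[OF c]]
      by (intro continuous_on_mult) (simp_all add: chart_density_def[abs_def])
  qed
  have "set_integrable lborel (cbox a b) ?F"
    unfolding set_integrable_def by (rule borel_integrable_compact[OF compact_cbox cont])
  then have int: "set_integrable lborel (box a b) ?F"
    by (rule set_integrable_subset) (auto simp: box_subset_cbox)
  have "(LINT x:?D|vol. f x) = (LINT y|lborel. indicator (snd c ` ?D) y * ?F y)"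
    by (rule integral_vol_chart[OF c borel_open[OF D] Dc f'])
  also have "\<dots> = (LINT y:box a b|lborel. ?F y)"
    unfolding chart_inv_image(2)[OF c box] set_lebesgue_integral_def by simp
  also have "\<dots> = integral (box a b) ?F" by (rule set_borel_integral_eq_integral(2)[OF int])
  also have "\<dots> = integral (cbox a b) ?F" by (rule integral_open_interval)
  finally show ?thesis .
qed

text \<open>Unifies the two cases of \<open>harmonic_section\<close>. On a compact manifold the
  total energy differs from that over \<open>D\<close> by the energy over the complement, which does
  not change with \<open>t\<close> because \<open>\<psi>\<close> vanishes off
  \<open>K\<close>.\<close>

lemma energy_derivative_box:
  assumes crit: "harmonic_section A g E T h nabla p q \<sigma>" and \<psi>: "smooth_map_on A UNIV \<psi>"
    and K: "compact K" "\<And>x. x \<notin> K \<Longrightarrow> \<psi> x = 0" and D: "relatively_compact_domain D" "K \<subseteq> D"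
  shows "((\<lambda>t. vertical_energy A g h nabla p q D (rescale \<psi> \<sigma> t)) has_real_derivative 0) (at 0)"
proof -
  have \<sigma>: "smooth_section A E T \<sigma>" using crit by (simp add: harmonic_section_def)
  note var = rescale_variation[OF \<sigma> \<psi>]
  show ?thesis
  proof (cases "compact (UNIV :: 'm set)")
    case False
    have all: "((\<lambda>t. vertical_energy A g h nabla p q D (\<Sigma> t)) has_real_derivative 0) (at 0)"
      if "smooth_variation A E T \<sigma> \<epsilon> \<Sigma>" "compact K" "\<forall>t\<in>{-\<epsilon><..<\<epsilon>}. \<forall>x. x \<notin> K \<longrightarrow> \<Sigma> t x = \<sigma> x"
        "relatively_compact_domain D" "K \<subseteq> D" for \<epsilon> \<Sigma> K D
      using crit False that unfolding harmonic_section_def by (metis (no_types, lifting))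
    show ?thesis
      by (rule all[OF var K(1) _ D]) (simp add: rescale_def K(2))
  next
    case True
    let ?f = "\<lambda>t. energy_density p q (rescale \<psi> \<sigma> t)"
    have Dm: "D \<in> sets vol" "- D \<in> sets vol" using D(1) by (auto simp: relatively_compact_domain_def borel_open)
    \<comment> \<open>Splitting an integral over \<open>D\<close> and its complement requires
      integrability, here from continuity on a compact space of finite volume.\<close>
    have int: "set_integrable vol S (?f t)" if S: "S \<in> sets vol" for S t
    proof -
      have cont: "continuous_on UNIV (?f t)" by (rule energy_density_continuous[OF rescale_section[OF \<sigma> \<psi>]])
      obtain B where B: "\<forall>x\<in>UNIV. \<bar>?f t x\<bar> \<le> B" using continuous_on_compact_abs_bound[OF True cont] by blast
      have [measurable]: "?f t \<in> borel_measurable borel" by (rule borel_measurable_continuous_onI[OF cont])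
      show ?thesis unfolding set_integrable_def
      proof (rule integrableI_bounded_set[where A=UNIV and B=B])
        show "emeasure vol UNIV < \<infinity>" by (rule vol_compact_finite[OF True])
        show "AE x in vol. x \<in> UNIV \<longrightarrow> norm (indicat_real S x *\<^sub>R ?f t x) \<le> B"
        proof (intro AE_I2 impI)
          fix x
          have "\<bar>?f t x\<bar> \<le> B" "0 \<le> B" using B abs_ge_zero[of "?f t x"] order_trans by blast+
          then show "norm (indicat_real S x *\<^sub>R ?f t x) \<le> B" by (auto simp: indicator_def)
        qed
        show "(\<lambda>x. indicat_real S x *\<^sub>R ?f t x) \<in> borel_measurable vol"
          using S by measurable
      qed auto
    qed
    have split: "vertical_energy A g h nabla p q UNIV (rescale \<psi> \<sigma> t) =
        vertical_energy A g h nabla p q D (rescale \<psi> \<sigma> t) + 1 / 2 * (LINT x:- D|vol. energy_density p q \<sigma> x)" for t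
    proof -
      have "(LINT x:D \<union> - D|vol. ?f t x) = (LINT x:D|vol. ?f t x) + (LINT x:- D|vol. ?f t x)"
        by (rule set_integral_Un[OF _ int[OF Dm(1)] int[OF Dm(2)]]) simp
      moreover have "(LINT x:- D|vol. ?f t x) = (LINT x:- D|vol. energy_density p q \<sigma> x)"
      proof (rule set_lebesgue_integral_cong[OF Dm(2)], intro allI impI)
        fix x assume "x \<in> - D"
        then have "x \<in> - K" using D(2) by blast
        then show "?f t x = energy_density p q \<sigma> x"
          by (rule rescale_density_local[OF \<sigma> \<psi> open_Compl[OF compact_imp_closed[OF K(1)]]]) (simp add: K(2))
      qed
      ultimately show ?thesis unfolding vertical_energy_density by (simp add: distrib_left)
    qed
    have "((\<lambda>t. vertical_energy A g h nabla p q UNIV (rescale \<psi> \<sigma> t)) has_real_derivative 0) (at 0)"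
      using crit var True by (auto simp: harmonic_section_def)
    from DERIV_diff[OF this DERIV_const[of "1 / 2 * (LINT x:- D|vol. energy_density p q \<sigma> x)"]]
    show ?thesis unfolding split by simp
  qed
qed

lemma critical_imp_nabla_norm2_zero:
  assumes crit: "harmonic_section A g E T h nabla p q \<sigma>"
    and \<mu>: "\<mu> \<ge> 1 / 2" and reg: "(p, q) \<in> region \<mu>" and rie: "r_riemannian h (\<mu> * q) \<sigma>"
    and harm: "harmonic_function A g (sq \<sigma>)"
  shows "nn2 \<sigma> x0 = 0"
proof (rule ccontr)
  assume ne: "nn2 \<sigma> x0 \<noteq> 0"
  have \<sigma>: "smooth_section A E T \<sigma>" using crit by (simp add: harmonic_section_def)
  obtain c where c: "c \<in> A" "x0 \<in> fst c" using chart_ex by blast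
  let ?V = "snd c ` fst c" and ?y0 = "snd c x0"
  \<comment> \<open>The ball will carry the cut-off function, and the open box around it provides
    the domain: its image is open, connected and relatively compact.\<close>
  obtain a b where ab: "cbox a b \<subseteq> ?V" "?y0 \<in> box a b"
    by (rule open_contains_cbox[OF chart_image_open[OF c(1)], of ?y0]) (use c in auto)
  obtain r where r: "r > 0" "cball ?y0 r \<subseteq> box a b"
    using open_contains_cball[THEN iffD1, OF open_box] ab(2) by blast
  have rc: "cball ?y0 r \<subseteq> cbox a b" using r(2) box_subset_cbox by blast
  have KV: "cball ?y0 r \<subseteq> ?V" using rc ab(1) by blast
  have bV: "box a b \<subseteq> ?V" using ab(1) box_subset_cbox by blast
  define \<psi> where "\<psi> = chart_bump c ?y0 r"
  have \<psi>: "smooth_map_on A UNIV \<psi>" unfolding \<psi>_def by (rule chart_bump_smooth[OF c(1) r(1) KV])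
  define K where "K = chart_inv c ` cball ?y0 r"
  define D where "D = chart_inv c ` box a b"
  have K: "compact K" unfolding K_def by (rule chart_inv_image(4)[OF c(1) KV compact_cball])
  have K0: "\<psi> x = 0" if "x \<notin> K" for x
  proof (rule ccontr)
    assume "\<psi> x \<noteq> 0"
    then have "x \<in> fst c" "dist ?y0 (snd c x) < r" using chart_bump_support[OF r(1)] unfolding \<psi>_def by blast+
    then show False using that unfolding K_def chart_inv_image(1)[OF c(1) KV] by auto
  qed
  have KD: "K \<subseteq> D" unfolding K_def D_def using r(2) by blast
  have D: "relatively_compact_domain D"
  proof -
    have co: "compact (chart_inv c ` cbox a b)" by (rule chart_inv_image(4)[OF c(1) ab(1) compact_cbox])
    have "closure D \<subseteq> chart_inv c ` cbox a b"
      unfolding D_def using box_subset_cbox compact_imp_closed[OF co] by (intro closure_minimal) blast+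
    then have "compact (closure D)" using co closed_closure compact_Int_closed by (metis inf.absorb_iff2)
    moreover have "open D" "connected D" unfolding D_def
      using chart_inv_image(3,5)[OF c(1) bV] convex_connected[OF convex_box(2)] open_box by blast+
    ultimately show ?thesis by (simp add: relatively_compact_domain_def)
  qed
  have E0: "((\<lambda>t. vertical_energy A g h nabla p q D (rescale \<psi> \<sigma> t)) has_real_derivative 0) (at 0)"
    by (rule energy_derivative_box[OF crit \<psi> K K0 D KD])
  define s where "s y = sq \<sigma> (chart_inv c y)" for y
  define N where "N y = nn2 \<sigma> (chart_inv c y)" for y
  define G where "G y = gn2 \<sigma> (chart_inv c y)" for y
  define P where "P y = cross \<psi> \<sigma> (chart_inv c y)" for y
  define R where "R y = trace2 \<psi> \<psi> (chart_inv c y)" for y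
  define \<beta> where "\<beta> y = \<psi> (chart_inv c y)" for y
  define \<rho> where "\<rho> = chart_density c"
  let ?C = "cbox a b"
    and ?S = "\<lambda>y. scaled_density p q (s y) (N y) (G y) (P y) (R y) (\<beta> y)"
    and ?S' = "\<lambda>y. scaled_density_deriv p q (s y) (N y) (G y) (P y) (R y) (\<beta> y)"
  have chart: "continuous_on ?C (\<lambda>y. f (chart_inv c y))" if "continuous_on UNIV f" for f :: "'m \<Rightarrow> real"
    by (rule continuous_on_compose2[OF that continuous_on_subset[OF chart_inv_continuous[OF c(1)] ab(1)]]) simp
  have cs: "continuous_on ?C s" unfolding s_def[abs_def] by (rule chart[OF sq_continuous[OF \<sigma>]])
  have cN: "continuous_on ?C N" unfolding N_def[abs_def] by (rule chart[OF nn2_continuous[OF \<sigma>]])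
  have cG: "continuous_on ?C G" unfolding G_def[abs_def] by (rule chart[OF gn2_continuous[OF \<sigma>]])
  have cP: "continuous_on ?C P" unfolding P_def[abs_def] trace2_def
    by (rule chart[OF differential_trace_continuous[OF \<psi> half_sq_smooth[OF \<sigma>]]])
  have cR: "continuous_on ?C R" unfolding R_def[abs_def] trace2_def
    by (rule chart[OF differential_trace_continuous[OF \<psi> \<psi>]])
  have c\<beta>: "continuous_on ?C \<beta>" unfolding \<beta>_def[abs_def] by (rule chart[OF smooth_map_on_continuous[OF \<psi> open_UNIV]])
  have c\<rho>: "continuous_on ?C \<rho>"
    using continuous_on_subset[OF ck_on_imp_continuous[OF vol_density_ck1[OF c(1)]] ab(1)]
    unfolding \<rho>_def chart_density_def[abs_def] .
  have s0: "s y \<ge> 0" for y unfolding s_def by (rule sq_nonneg[OF \<sigma>])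
  have energy: "vertical_energy A g h nabla p q D (rescale \<psi> \<sigma> t) =
      1 / 2 * integral ?C (\<lambda>y. \<rho> y * ?S y t)" for t
    unfolding vertical_energy_density D_def
      integral_vol_box[OF c(1) ab(1) energy_density_continuous[OF rescale_section[OF \<sigma> \<psi>]]]
      rescale_density[OF \<sigma> \<psi>] s_def N_def G_def P_def R_def \<beta>_def \<rho>_def ..
  have "((\<lambda>t. integral ?C (\<lambda>y. \<rho> y * ?S y t)) has_field_derivative
      integral ?C (\<lambda>y. \<rho> y * ?S' y 0)) (at 0 within UNIV)"
  proof (rule leibniz_rule_field_derivative[where fx="\<lambda>t y. \<rho> y * ?S' y t"])
    show "((\<lambda>t. \<rho> y * ?S y t) has_field_derivative
        \<rho> y * ?S' y t) (at t within UNIV)" for t y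
      by (rule DERIV_cmult[OF scaled_density_has_derivative[OF s0]])
    show "(\<lambda>y. \<rho> y * ?S y t) integrable_on ?C" for t
      by (intro integrable_continuous continuous_on_mult c\<rho> continuous_on_scaled_density cs cN cG cP cR c\<beta> continuous_on_const s0)
    have sn: "continuous_on (UNIV \<times> ?C) (\<lambda>z. f (snd z))" if "continuous_on ?C f" for f :: "real ^ 'n \<Rightarrow> real"
      by (rule continuous_on_compose2[OF that continuous_on_snd[OF continuous_on_id]]) auto
    show "continuous_on (UNIV \<times> ?C) (\<lambda>(t, y). \<rho> y * ?S' y t)"
      unfolding split_beta
      by (intro continuous_on_mult continuous_on_scaled_density sn c\<rho> cs cN cG cP cR c\<beta> continuous_on_fst continuous_on_id s0)
  qed auto
  from DERIV_cmult[OF this, of "1 / 2"]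
  have "1 / 2 * integral ?C (\<lambda>y. \<rho> y * ?S' y 0) = 0"
    using E0 unfolding energy by (rule DERIV_unique)
  then have I0: "integral ?C (\<lambda>y. \<rho> y * ?S' y 0) = 0" by simp
  \<comment> \<open>The factor of \<open>2 * P\<close> in the first variation; as
    \<open>2 * P\<close> is the inner product of the gradients of \<open>\<psi>\<close> and
    \<open>sq \<sigma>\<close>, this is the function to use in \<open>harmonic_weak\<close>.\<close>
  define B where "B z = (1 + z) powr (- p) * (1 + q * z)" for z
  define B' where "B' z = - p * (1 + z) powr (- p - 1) * (1 + q * z) + (1 + z) powr (- p) * q" for z
  define Q where "Q y = 2 * \<beta> y * (1 + s y) powr (- p - 1) * ((1 + s y - p * s y) * N y + p * (2 + q * s y) * G y)" for y
  define J where "J y = B (s y) * trace2 \<psi> (sq \<sigma>) (chart_inv c y) + \<beta> y * B' (s y) * trace2 (sq \<sigma>) (sq \<sigma>) (chart_inv c y)" for y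
  \<comment> \<open>\<open>P\<close> and \<open>G\<close> are formed with half of
    \<open>sq \<sigma>\<close>, which accounts for the factors 2 and 4 below.\<close>
  have half: "v (\<lambda>y. 1 / 2 * sq \<sigma> y) = 1 / 2 * v (sq \<sigma>)" if "v \<in> tangent_space A x" for v x
    by (rule tangent_vec_cmult[OF that sq_smooth[OF \<sigma>]]) simp
  have PJ: "2 * P y = trace2 \<psi> (sq \<sigma>) (chart_inv c y)" for y
    unfolding P_def trace2_def half[OF frame_in] by (simp add: sum_distrib_left)
  have GJ: "4 * G y = trace2 (sq \<sigma>) (sq \<sigma>) (chart_inv c y)" for y
    unfolding G_def gn2_frame trace2_def half[OF frame_in] by (simp add: sum_distrib_left)
  have split: "?S' y 0 = Q y + J y" for y
    unfolding scaled_density_deriv_0[OF s0] Q_def J_def B_def B'_def PJ[symmetric] GJ[symmetric] by (simp add: mult_ac)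
  have pos1: "1 + sq \<sigma> x > 0" for x using sq_nonneg[OF \<sigma>, of x] by linarith
  have J0: "integral ?C (\<lambda>y. \<rho> y * J y) = 0"
    unfolding J_def \<rho>_def s_def \<beta>_def \<psi>_def
  proof (rule harmonic_weak[OF harm c(1) ab(1) r(1) rc])
    show "(B has_real_derivative B' (sq \<sigma> x)) (at (sq \<sigma> x))" for x
    proof -
      have 1: "((\<lambda>z. 1 + z) has_real_derivative 1) (at (sq \<sigma> x))"
        by (auto intro!: derivative_eq_intros)
      have "((\<lambda>z. (1 + z) powr (- p)) has_real_derivative - p * (1 + sq \<sigma> x) powr (- p - 1) * 1) (at (sq \<sigma> x))"
        by (rule DERIV_chain2[OF has_real_derivative_powr[OF pos1] 1])
      moreover have "((\<lambda>z. 1 + q * z) has_real_derivative q) (at (sq \<sigma> x))"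
        by (auto intro!: derivative_eq_intros)
      ultimately have "((\<lambda>z. (1 + z) powr (- p) * (1 + q * z)) has_real_derivative
        (- p * (1 + sq \<sigma> x) powr (- p - 1) * 1) * (1 + q * sq \<sigma> x) + q * (1 + sq \<sigma> x) powr (- p)) (at (sq \<sigma> x))"
        by (rule DERIV_mult)
      then show ?thesis unfolding B_def[abs_def] B'_def by (simp add: mult.commute)
    qed
    have "\<forall>z\<in>range (sq \<sigma>). 1 + z \<noteq> 0" using pos1 by (metis less_irrefl rangeE)
    then have "continuous_on (range (sq \<sigma>)) (\<lambda>z. (1 + z) powr e)" for e
      by (intro continuous_on_powr continuous_intros) auto
    then show "continuous_on (range (sq \<sigma>)) B'"
      unfolding B'_def[abs_def]
      by (intro continuous_on_mult continuous_on_add continuous_on_const continuous_on_id)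
  qed
  have cpowr: "continuous_on ?C (\<lambda>y. (1 + s y) powr e)" for e
  proof (rule continuous_on_powr)
    show "\<forall>y\<in>?C. 1 + s y \<noteq> 0" using s0 by (metis add_pos_nonneg less_irrefl zero_less_one)
  qed (intro continuous_intros cs)+
  have cQ: "continuous_on ?C (\<lambda>y. \<rho> y * Q y)"
    unfolding Q_def by (intro continuous_intros c\<rho> c\<beta> cpowr cs cN cG)
  have cB: "continuous_on ?C (\<lambda>y. B (s y))" "continuous_on ?C (\<lambda>y. B' (s y))"
    unfolding B_def B'_def by (intro continuous_intros cpowr cs)+
  have cJ: "continuous_on ?C (\<lambda>y. \<rho> y * J y)"
    unfolding J_def PJ[symmetric] GJ[symmetric] by (intro continuous_intros c\<rho> c\<beta> cP cG cB)
  have "integral ?C (\<lambda>y. \<rho> y * Q y + \<rho> y * J y) = integral ?C (\<lambda>y. \<rho> y * Q y) + integral ?C (\<lambda>y. \<rho> y * J y)"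
    by (intro integral_add integrable_continuous cQ cJ)
  then have Q0: "integral ?C (\<lambda>y. \<rho> y * Q y) = 0"
    using I0 J0 by (simp add: split distrib_left)
  have \<rho>pos: "\<rho> y > 0" if "y \<in> ?C" for y using chart_density_pos[OF c(1)] that ab(1) unfolding \<rho>_def by blast
  have base: "(1 + s y - p * s y) * N y + p * (2 + q * s y) * G y > 0" if "N y > 0" for y
  proof (rule region_pos[OF \<mu> reg s0 _ that])
    show "\<mu> * q * s y \<ge> - 1" using rie by (simp add: r_riemannian_def s_def)
    show "0 \<le> G y" unfolding G_def by (rule gn2_nonneg[OF \<sigma>])
    show "G y \<le> s y * N y" unfolding G_def s_def N_def by (rule kato[OF \<sigma>])
  qed
  \<comment> \<open>\<open>region_pos\<close> asks for positive \<open>N\<close>; where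
    \<open>N\<close> vanishes, \<open>kato\<close> forces \<open>G\<close> to vanish too and the
    expression is 0.\<close>
  have base0: "(1 + s y - p * s y) * N y + p * (2 + q * s y) * G y \<ge> 0" for y
  proof (cases "N y > 0")
    case False
    then have N0: "N y = 0" using nabla_norm2_nonneg[OF \<sigma>, of "chart_inv c y"] unfolding N_def by linarith
    then have "G y = 0"
      using kato[OF \<sigma>, of "chart_inv c y"] gn2_nonneg[OF \<sigma>, of "chart_inv c y"] unfolding G_def N_def by (metis antisym mult_zero_right)
    then show ?thesis using N0 by simp
  qed (use base in \<open>auto intro: less_imp_le\<close>)
  have \<beta>0: "\<beta> y \<ge> 0" for y unfolding \<beta>_def \<psi>_def chart_bump_def by (simp add: bump_nonneg)
  have nonneg: "\<rho> y * Q y \<ge> 0" if "y \<in> ?C" for y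
    unfolding Q_def using \<rho>pos[OF that] base0[of y] \<beta>0[of y] by (intro mult_nonneg_nonneg) auto
  have "box a b \<noteq> {}" using ab(2) by blast
  \<comment> \<open>A continuous nonnegative function with zero integral over a nondegenerate box
    vanishes on it, in particular at the centre of the bump.\<close>
  then have "\<forall>y\<in>?C. \<rho> y * Q y = 0"
    using integral_cbox_eq_0_iff[OF cQ _ nonneg] Q0 by blast
  moreover have y0: "?y0 \<in> ?C" using ab(2) box_subset_cbox by blast
  ultimately have z: "\<rho> ?y0 * Q ?y0 = 0" by blast
  have "N ?y0 > 0" using ne nabla_norm2_nonneg[OF \<sigma>, of x0] c by (simp add: N_def less_le)
  moreover have "\<beta> ?y0 > 0" using c r(1) bump_pos_iff(1)[OF r(1), of ?y0 ?y0] by (simp add: \<beta>_def \<psi>_def chart_bump_def)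
  moreover have "(1 + s ?y0) powr (- p - 1) > 0" using s0[of ?y0] by simp
  ultimately have "\<rho> ?y0 * Q ?y0 > 0"
    unfolding Q_def using \<rho>pos[OF y0] base by (intro mult_pos_pos) auto
  then show False using z by simp
qed

lemma harmonic_section_iff_parallel:
  assumes \<sigma>: "smooth_section A E T \<sigma>" and \<mu>: "\<mu> \<ge> 1 / 2" and reg: "(p, q) \<in> region \<mu>"
    and rie: "r_riemannian h (\<mu> * q) \<sigma>" and harm: "harmonic_function A g (sq \<sigma>)"
  shows "harmonic_section A g E T h nabla p q \<sigma> \<longleftrightarrow> parallel A nabla \<sigma>"
proof
  assume "harmonic_section A g E T h nabla p q \<sigma>"
  then show "parallel A nabla \<sigma>"
    unfolding parallel_iff_nabla_norm2[OF \<sigma>] using critical_imp_nabla_norm2_zero[OF _ \<mu> reg rie harm] by blast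
next
  assume par: "parallel A nabla \<sigma>"
  show "harmonic_section A g E T h nabla p q \<sigma>"
  proof (cases "compact (UNIV :: 'm set)")
    case True
    \<comment> \<open>On a compact manifold \<open>K\<close> is taken to be the whole space, which
      makes the support condition vacuous.\<close>
    then show ?thesis
      unfolding harmonic_section_def using \<sigma> parallel_imp_critical[OF _ par True] by simp
  next
    case False
    have "\<forall>\<epsilon> \<Sigma> K D. smooth_variation A E T \<sigma> \<epsilon> \<Sigma> \<and> compact K \<and>
        (\<forall>t\<in>{-\<epsilon><..<\<epsilon>}. \<forall>x. x \<notin> K \<longrightarrow> \<Sigma> t x = \<sigma> x) \<and> relatively_compact_domain D \<and> K \<subseteq> D \<longrightarrow>
        ((\<lambda>t. vertical_energy A g h nabla p q D (\<Sigma> t)) has_real_derivative 0) (at 0)"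
      using parallel_imp_critical[OF _ par] by blast
    with False \<sigma> show ?thesis unfolding harmonic_section_def by simp
  qed
qed

end

theorem theorem4p3:
  fixes A :: "('m::{t2_space, second_countable_topology}, 'n::finite) chart set"
    and g :: "'m metric"
    and E :: "'m \<Rightarrow> 'f::real_vector set"
    and T :: "('m, 'f, 'k::finite) triv set"
    and h :: "('m, 'f) fmetric"
    and nabla :: "('m, 'f) cov_deriv"
    and \<sigma> :: "'m \<Rightarrow> 'f"
    and \<mu> p q :: real
  assumes "smooth_atlas A" and "oriented_atlas A" and "connected (UNIV :: 'm set)"
    and "riemannian_metric A g"
    and "vector_bundle A E T" and "oriented_bundle E T"
    and "fibre_metric A E T h"
    and "connection A E T nabla" and "metric_connection A E T h nabla"
    and "\<mu> \<ge> 1 / 2" and "(p, q) \<in> region \<mu>"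
    and "smooth_section A E T \<sigma>"
    and "r_riemannian h (\<mu> * q) \<sigma>"
    and "harmonic_function A g (\<lambda>x. h x (\<sigma> x) (\<sigma> x))"
  shows "harmonic_section A g E T h nabla p q \<sigma> \<longleftrightarrow> parallel A nabla \<sigma>"
proof -
  interpret metric_bundle A g E T h nabla
    by unfold_locales (use assms in auto)
  show ?thesis
    by (rule harmonic_section_iff_parallel) (use assms in auto)
qed

end
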